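(* Let $K$ be a PAC field of characteristic $p\geq 0$, let $f_1,\ldots,f_r\in K[X]$ be pairwise non-associate irreducible separable polynomials, and for each $i$ let $\omega_i$ be a root of $f_i$ (in a fixed algebraic closure of $K$). Let $n$ be a positive integer, which is odd if $p=2$. Suppose that for every $i=1,\ldots,r$ the field $K(\omega_i)$ has a separable extension of degree $n$. Then there exists a Zariski dense set of $(a_1,\ldots,a_n)\in K^n$ such that, for $g(t)=t^n+a_1t^{n-1}+\cdots+a_n$, all of the polynomials $f_i(g(t))$, $i=1,\ldots,r$, are separable and irreducible in $K[t]$.
   Context: A field $K$ is PAC (pseudo algebraically closed) if $V(K)\neq\emptyset$ for every non-empty absolutely irreducible $K$-variety $V$. *)

theory Defs
  imports
    "HOL-Algebra.Algebraic_Closure_Type"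
    "HOL-Algebra.Generated_Fields"
    "HOL-Library.Poly_Mapping"
begin

text \<open>
  The ground field \<open>K\<close> is a type \<open>'k :: field\<close>, and \<open>'k alg_closure\<close> with the embedding \<open>to_ac\<close> is
  the fixed algebraic closure.
\<close>

text \<open>
  Affine \<open>n\<close>-space has coordinates \<open>x 1, \<dots>, x n\<close>; the remaining values are normalised to \<open>0\<close>, so that
  points are determined by their coordinates.
\<close>

definition affine_space :: "nat \<Rightarrow> (nat \<Rightarrow> 'a::zero) set" where
  "affine_space n = {x. \<forall>i. i \<notin> {1..n} \<longrightarrow> x i = 0}"

text \<open>Monomials are finitely supported exponent functions, polynomials are finitely supported
  functions from monomials to coefficients.\<close>

type_synonym 'a mpoly = "(nat \<Rightarrow>\<^sub>0 nat) \<Rightarrow>\<^sub>0 'a"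

definition mpolys :: "nat \<Rightarrow> 'a::zero mpoly set" where
  "mpolys n = {p. \<forall>m \<in> Poly_Mapping.keys p. Poly_Mapping.keys m \<subseteq> {1..n}}"

definition mpoly_eval :: "'a::comm_semiring_1 mpoly \<Rightarrow> (nat \<Rightarrow> 'a) \<Rightarrow> 'a" where
  "mpoly_eval p x = (\<Sum>m \<in> Poly_Mapping.keys p. Poly_Mapping.lookup p m *
     (\<Prod>i \<in> Poly_Mapping.keys m. x i ^ Poly_Mapping.lookup m i))"

definition mpoly_ideal :: "nat \<Rightarrow> 'a::comm_ring_1 mpoly set \<Rightarrow> 'a mpoly set" where
  "mpoly_ideal n S = {(\<Sum>s\<in>F. q s * s) | F q. finite F \<and> F \<subseteq> S \<and> (\<forall>s\<in>F. q s \<in> mpolys n)}"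

definition K_mpolys :: "nat \<Rightarrow> 'k::field alg_closure mpoly set" where
  "K_mpolys n = {p \<in> mpolys n. \<forall>m. Poly_Mapping.lookup p m \<in> range to_ac}"

definition zariski_closed :: "nat \<Rightarrow> (nat \<Rightarrow> 'a::field) set \<Rightarrow> bool" where
  "zariski_closed n V \<longleftrightarrow>
     (\<exists>S \<subseteq> mpolys n. V = {x \<in> affine_space n. \<forall>p\<in>S. mpoly_eval p x = 0})"

definition zariski_irreducible :: "nat \<Rightarrow> (nat \<Rightarrow> 'a::field) set \<Rightarrow> bool" where
  "zariski_irreducible n V \<longleftrightarrow>
     (\<forall>A B. zariski_closed n A \<and> zariski_closed n B \<and> V \<subseteq> A \<union> B \<longrightarrow> V \<subseteq> A \<or> V \<subseteq> B)"

definition vanishing_ideal :: "nat \<Rightarrow> (nat \<Rightarrow> 'a::field) set \<Rightarrow> 'a mpoly set" where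
  "vanishing_ideal n V = {p \<in> mpolys n. \<forall>x\<in>V. mpoly_eval p x = 0}"

text \<open>
  \<open>V\<close> is defined over \<open>K\<close> if its whole vanishing ideal over the algebraic closure is generated by
  polynomials over \<open>K\<close>.  Over imperfect \<open>K\<close> it is not enough that \<open>V\<close> is the zero set of some
  polynomials over \<open>K\<close>: the zero set of \<open>X ^ p - c\<close>, with \<open>c\<close> not a \<open>p\<close>-th power, is a single point
  that is not \<open>K\<close>-rational.
\<close>

definition defined_over_K :: "nat \<Rightarrow> (nat \<Rightarrow> 'k::field alg_closure) set \<Rightarrow> bool" where
  "defined_over_K n V \<longleftrightarrow>
     vanishing_ideal n V = mpoly_ideal n (vanishing_ideal n V \<inter> K_mpolys n)"

text \<open>
  An absolutely irreducible \<open>K\<close>-variety is identified with its set of points over the algebraic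
  closure.
\<close>

definition abs_irreducible_K_variety :: "nat \<Rightarrow> (nat \<Rightarrow> 'k::field alg_closure) set \<Rightarrow> bool" where
  "abs_irreducible_K_variety n V \<longleftrightarrow>
     zariski_closed n V \<and> defined_over_K n V \<and> zariski_irreducible n V"

definition K_points :: "(nat \<Rightarrow> 'k::field alg_closure) set \<Rightarrow> (nat \<Rightarrow> 'k alg_closure) set" where
  "K_points V = {x \<in> V. \<forall>i. x i \<in> range to_ac}"

definition pac_field :: "'k::field itself \<Rightarrow> bool" where
  "pac_field _ \<longleftrightarrow> (\<forall>n. \<forall>V :: (nat \<Rightarrow> 'k alg_closure) set.
     abs_irreducible_K_variety n V \<and> V \<noteq> {} \<longrightarrow> K_points V \<noteq> {})"

definition zariski_dense :: "nat \<Rightarrow> (nat \<Rightarrow> 'k::field) set \<Rightarrow> bool" where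
  "zariski_dense n A \<longleftrightarrow>
     (\<forall>V :: (nat \<Rightarrow> 'k alg_closure) set.
        zariski_closed n V \<and> (\<lambda>a. to_ac \<circ> a) ` A \<subseteq> V \<longrightarrow> V = affine_space n)"

definition separable_poly :: "'k::field poly \<Rightarrow> bool" where
  "separable_poly f \<longleftrightarrow> rsquarefree (map_poly to_ac f)"

abbreviation Kbar :: "'k::field alg_closure ring" where
  "Kbar \<equiv> ring_of_type_algebra"

definition K_adjoin :: "'k::field alg_closure \<Rightarrow> 'k alg_closure set" where
  "K_adjoin w = generate_field Kbar (insert w (range to_ac))"

definition minimal_poly_over ::
    "'k::field alg_closure set \<Rightarrow> 'k alg_closure \<Rightarrow> 'k alg_closure poly \<Rightarrow> bool" where
  "minimal_poly_over F x p \<longleftrightarrow>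
     lead_coeff p = 1 \<and> (\<forall>i. poly.coeff p i \<in> F) \<and> poly p x = 0 \<and>
     (\<forall>q. q \<noteq> 0 \<and> (\<forall>i. poly.coeff q i \<in> F) \<and> poly q x = 0 \<longrightarrow> degree p \<le> degree q)"

definition separable_over :: "'k::field alg_closure set \<Rightarrow> 'k alg_closure \<Rightarrow> bool" where
  "separable_over F x \<longleftrightarrow> (\<exists>p. minimal_poly_over F x p \<and> rsquarefree p)"

text \<open>
  Finite extensions of a subfield \<open>F\<close> of the algebraic closure containing \<open>K\<close> are, up to isomorphism
  over \<open>F\<close>, subfields of the algebraic closure.
\<close>

definition has_separable_extension_of_degree :: "'k::field alg_closure set \<Rightarrow> nat \<Rightarrow> bool" where
  "has_separable_extension_of_degree F n \<longleftrightarrow>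
     (\<exists>L. subfield L Kbar \<and> F \<subseteq> L \<and> ring.dimension Kbar n F L \<and> (\<forall>x\<in>L. separable_over F x))"

definition generic_monic :: "nat \<Rightarrow> (nat \<Rightarrow> 'k::field) \<Rightarrow> 'k poly" where
  "generic_monic n a = Polynomial.monom 1 n + (\<Sum>j=1..n. Polynomial.monom (a j) (n - j))"

end

theory Submission
  imports
    Defs
    "HOL-Computational_Algebra.Formal_Power_Series"
    "HOL-Combinatorics.Cycles"
begin

text \<open>
  An extension of \<open>K(\<omega> i)\<close> of degree \<open>n\<close> is generated over \<open>K\<close> by one element \<open>\<theta> i\<close>, whose minimal
  polynomial \<open>M i\<close> is separable and which satisfies \<open>\<omega> i = W i (\<theta> i)\<close> for a polynomial \<open>W i\<close>.  After
  shifting the \<open>\<theta> i\<close> by elements of \<open>K\<close> all these data are combined into one separable polynomial \<open>M\<close>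
  and one polynomial \<open>W\<close>, all of whose fibres on the roots of \<open>M\<close> have exactly \<open>n\<close> elements.

  It suffices to find \<open>a \<in> K\<^sup>n\<close> off a given hypersurface and \<open>Q \<in> K[t]\<close>, injective on the roots of \<open>M\<close>,
  with \<open>g (Q \<theta>) = W \<theta>\<close> for all roots \<open>\<theta>\<close>: then \<open>f i (g t)\<close>, of degree \<open>n * degree (f i)\<close>, vanishes at
  the \<open>n * degree (f i)\<close> distinct conjugates of \<open>Q (\<theta> i)\<close>.  Such pairs \<open>(a, Q)\<close> are the \<open>K\<close>-points of a
  variety over \<open>K\<close> whose geometric points are the labellings, fibre by fibre, of the roots of the equations
  \<open>g (\<tau> \<theta>) = W \<theta>\<close>.  This variety is absolutely irreducible because the monodromy group contains every
  permutation preserving the fibres.  Indeed, near \<open>g = t ^ (n - 1) * (t - \<epsilon>) + W \<theta>\<close> the other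
  fibres split into distinct power series by Hensel's lemma, while two roots in the fibre of \<open>\<theta>\<close> can be
  exchanged.  The roots in a single fibre being independent, the group maps onto the permutations of that
  fibre, so that conjugation turns one transposition into all of them.  The oddness of \<open>n\<close> in
  characteristic \<open>2\<close> excludes \<open>n = 2\<close>, where \<open>t ^ 2 + a t + b\<close> is separable for all values or for none.
\<close>

subsection \<open>Ring homomorphisms, subrings and ideals\<close>

text \<open>The PAC property yields points only on a variety that is irreducible over the closure
  and whose full vanishing ideal is generated over K. So the explicit equations must be shown to
  generate a radical ideal, and this ideal must be prime. Both are obtained without function fields.
  A good ideal records only that the roots satisfy their equations and that root differences are
  nonzerodivisors; kernels of geometric points, kernels of power series points and the ideal of the
  equations are all good. The lemma \<open>vanishing_imp_in_good_ideal\<close> compares such ideals: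
  a polynomial killed by a sufficiently symmetric family of points lies in them. It gives radicality
  for the family of all geometric points, prime avoidance for the conjugates of a generic point, and
  irreducibility once the transpositions are known to preserve the ideal of the generic point.
  Monodromy is accordingly expressed by inclusions of prime ideals instead of automorphisms. Density
  refers to hypersurfaces over the closure, while PAC handles equations over K; a K-linear
  functional applied to coefficients closes this gap.\<close>

definition is_hom :: "('a::comm_ring_1 \<Rightarrow> 'b::comm_ring_1) \<Rightarrow> bool" where
  "is_hom h \<longleftrightarrow> h 1 = 1 \<and> (\<forall>x y. h (x + y) = h x + h y) \<and> (\<forall>x y. h (x * y) = h x * h y)"

lemma is_homI:
  assumes "h 1 = 1" "\<And>x y. h (x + y) = h x + h y" "\<And>x y. h (x * y) = h x * h y"
  shows "is_hom h"
  using assms by (simp add: is_hom_def)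

context
  fixes h :: "'a::comm_ring_1 \<Rightarrow> 'b::comm_ring_1"
  assumes h: "is_hom h"
begin

lemma hom_one: "h 1 = 1" and hom_add: "h (x + y) = h x + h y" and hom_mult: "h (x * y) = h x * h y"
  using h by (auto simp: is_hom_def)

lemma hom_zero: "h 0 = 0"
  using hom_add[of 0 0] by simp

lemma hom_uminus: "h (- x) = - h x"
  using hom_add[of x "- x"] by (simp add: hom_zero eq_neg_iff_add_eq_0 add.commute)

lemma hom_diff: "h (x - y) = h x - h y"
  using hom_add[of x "- y"] by (simp add: hom_uminus)

lemma hom_sum: "h (sum f A) = (\<Sum>x\<in>A. h (f x))"
  by (induction A rule: infinite_finite_induct) (auto simp: hom_zero hom_add)

lemma hom_prod: "h (prod f A) = (\<Prod>x\<in>A. h (f x))"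
  by (induction A rule: infinite_finite_induct) (auto simp: hom_one hom_mult)

lemma hom_power: "h (x ^ k) = h x ^ k"
  by (induction k) (auto simp: hom_one hom_mult)

lemmas hom_simps = hom_zero hom_one hom_add hom_mult hom_uminus hom_diff hom_sum hom_prod hom_power

lemma coeff_map_hom: "poly.coeff (map_poly h p) i = h (poly.coeff p i)"
  by (simp add: coeff_map_poly hom_zero)

lemma map_hom_pCons: "map_poly h (pCons c p) = pCons (h c) (map_poly h p)"
  by (rule poly_eqI) (auto simp: coeff_map_hom coeff_pCons split: nat.splits)

lemma is_hom_map_poly: "is_hom (map_poly h)"
  by (rule is_homI)
     (auto intro!: poly_eqI simp: coeff_map_hom hom_one hom_add coeff_mult hom_sum hom_mult map_poly_1)

lemma poly_map_hom: "poly (map_poly h p) (h x) = h (poly p x)"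
  by (induction p) (auto simp: hom_zero map_hom_pCons hom_add hom_mult)

lemma map_hom_monom: "map_poly h (Polynomial.monom c n) = Polynomial.monom (h c) n"
  by (simp add: map_poly_monom hom_zero)

lemma map_hom_pcompose: "map_poly h (pcompose p q) = pcompose (map_poly h p) (map_poly h q)"
proof (induction p)
  case (pCons c p)
  then show ?case
    using is_hom_map_poly
    by (simp add: pcompose_pCons map_hom_pCons is_hom_def hom_zero)
qed (simp add: hom_zero)

lemma lead_coeff_monic_map_hom:
  assumes "lead_coeff p = 1"
  shows "degree (map_poly h p) = degree p" "lead_coeff (map_poly h p) = 1"
proof -
  have "degree (map_poly h p) \<le> degree p"
    by (rule degree_le) (auto simp: coeff_map_hom coeff_eq_0 hom_zero)
  moreover have "degree p \<le> degree (map_poly h p)"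
    by (rule le_degree) (simp add: coeff_map_hom assms hom_one)
  ultimately show "degree (map_poly h p) = degree p" by simp
  then show "lead_coeff (map_poly h p) = 1"
    by (simp add: coeff_map_hom assms hom_one)
qed

end

lemma is_hom_comp: "is_hom g \<Longrightarrow> is_hom h \<Longrightarrow> is_hom (\<lambda>x. g (h x))"
  by (auto simp: is_hom_def)

lemma is_hom_id: "is_hom (\<lambda>x. x)"
  by (auto simp: is_hom_def)

lemma is_hom_to_ac: "is_hom to_ac"
  by (auto simp: is_hom_def)

lemma is_hom_poly: "is_hom (\<lambda>p. poly p x)"
  by (auto simp: is_hom_def)

definition is_subring :: "'a::comm_ring_1 set \<Rightarrow> bool" where
  "is_subring S \<longleftrightarrow> 1 \<in> S \<and> (\<forall>x\<in>S. \<forall>y\<in>S. x - y \<in> S \<and> x * y \<in> S)"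

context
  fixes S :: "'a::comm_ring_1 set"
  assumes S: "is_subring S"
begin

lemma subring_one: "1 \<in> S" and subring_diff: "x \<in> S \<Longrightarrow> y \<in> S \<Longrightarrow> x - y \<in> S"
  and subring_mult: "x \<in> S \<Longrightarrow> y \<in> S \<Longrightarrow> x * y \<in> S"
  using S by (auto simp: is_subring_def)

lemma subring_zero: "0 \<in> S"
  using subring_diff[OF subring_one subring_one] by simp

lemma subring_uminus: "x \<in> S \<Longrightarrow> - x \<in> S"
  using subring_diff[OF subring_zero] by simp

lemma subring_add: "x \<in> S \<Longrightarrow> y \<in> S \<Longrightarrow> x + y \<in> S"
  using subring_diff[of x "- y"] subring_uminus by simp

lemma subring_sum: "(\<And>i. i \<in> A \<Longrightarrow> f i \<in> S) \<Longrightarrow> sum f A \<in> S"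
  by (induction A rule: infinite_finite_induct) (auto simp: subring_zero subring_add)

lemma subring_prod: "(\<And>i. i \<in> A \<Longrightarrow> f i \<in> S) \<Longrightarrow> prod f A \<in> S"
  by (induction A rule: infinite_finite_induct) (auto simp: subring_one subring_mult)

lemma subring_power: "x \<in> S \<Longrightarrow> x ^ k \<in> S"
  by (induction k) (auto simp: subring_one subring_mult)

lemmas subring_intros = subring_zero subring_one subring_add subring_mult subring_uminus
  subring_diff subring_sum subring_prod subring_power

end

definition polys_over :: "'a::comm_ring_1 set \<Rightarrow> 'a poly set" where
  "polys_over S = {p. \<forall>i. poly.coeff p i \<in> S}"

lemma is_subring_polys_over:
  assumes "is_subring S"
  shows "is_subring (polys_over S)"
  unfolding is_subring_def
proof (intro conjI ballI)
  show "1 \<in> polys_over S"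
    using assms by (auto simp: polys_over_def coeff_pCons subring_intros simp flip: one_poly_eq_simps split: nat.splits)
next
  fix p q assume "p \<in> polys_over S" "q \<in> polys_over S"
  then show "p - q \<in> polys_over S" "p * q \<in> polys_over S"
    using assms by (auto simp: polys_over_def coeff_mult intro!: subring_intros)
qed

lemma polys_over_pCons:
  "pCons c p \<in> polys_over S \<longleftrightarrow> c \<in> S \<and> p \<in> polys_over S"
proof -
  have "(\<forall>i. poly.coeff (pCons c p) i \<in> S) \<longleftrightarrow> c \<in> S \<and> (\<forall>i. poly.coeff p i \<in> S)"
    by (metis coeff_pCons_0 coeff_pCons_Suc not0_implies_Suc)
  then show ?thesis by (simp add: polys_over_def)
qed

lemma poly_in_subring:
  assumes S: "is_subring S" and "p \<in> polys_over S" "x \<in> S"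
  shows "poly p x \<in> S"
  unfolding poly_altdef using assms
  by (intro subring_sum[OF S] subring_mult[OF S] subring_power[OF S]) (auto simp: polys_over_def)

lemma pcompose_polys_over:
  assumes S: "is_subring S" and p: "p \<in> polys_over S" and q: "q \<in> polys_over S"
  shows "pcompose p q \<in> polys_over S"
  using p
proof (induction p)
  case (pCons c p)
  note P = is_subring_polys_over[OF S]
  from pCons have "[:c:] \<in> polys_over S" "pcompose p q \<in> polys_over S"
    using subring_zero[OF P] by (auto simp: polys_over_pCons)
  then show ?case
    unfolding pcompose_pCons by (intro subring_add[OF P] subring_mult[OF P] q)
qed (simp add: polys_over_def)

lemma polys_over_0: "is_subring S \<Longrightarrow> 0 \<in> polys_over S"
  by (simp add: polys_over_def subring_zero)

lemma polys_over_monom: "is_subring S \<Longrightarrow> c \<in> S \<Longrightarrow> Polynomial.monom c k \<in> polys_over S"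
  by (auto simp: polys_over_def subring_zero)

lemma synthetic_div_polys_over:
  assumes S: "is_subring S" and x: "x \<in> S" and p: "p \<in> polys_over S"
  shows "synthetic_div p x \<in> polys_over S"
  using p
proof (induction p)
  case (pCons c p)
  then show ?case
    by (simp add: polys_over_pCons poly_in_subring[OF S _ x])
qed (simp add: polys_over_0[OF S])

text \<open>Division by a monic polynomial inverts nothing, so quotient and remainder stay over any
  subring. Bounding the remainder by vanishing coefficients also says that it is \<open>0\<close>
  when \<open>m\<close> is constant.\<close>

lemma monic_division:
  assumes S: "is_subring S" and m: "m \<in> polys_over S" "lead_coeff m = 1" and p: "p \<in> polys_over S"
  shows "\<exists>q \<in> polys_over S. \<exists>r \<in> polys_over S. p = q * m + r \<and> (\<forall>i \<ge> degree m. poly.coeff r i = 0)"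
  using p
proof (induction p)
  case 0
  show ?case
    by (intro bexI[of _ 0]) (auto simp: polys_over_0[OF S])
next
  case (pCons c p)
  note P = is_subring_polys_over[OF S]
  from pCons obtain q r where q: "q \<in> polys_over S" and r: "r \<in> polys_over S"
    and pe: "p = q * m + r" and d: "\<forall>i \<ge> degree m. poly.coeff r i = 0" and c: "c \<in> S"
    by (auto simp: polys_over_pCons)
  define r1 where "r1 = pCons c r"
  have r1: "r1 \<in> polys_over S" "\<And>i. i > degree m \<Longrightarrow> poly.coeff r1 i = 0"
    using r c d by (auto simp: r1_def polys_over_pCons coeff_pCons split: nat.splits)
  define l where "l = poly.coeff r1 (degree m)"
  have l: "l \<in> S" using r1 by (auto simp: l_def polys_over_def)
  have lm: "smult l m \<in> polys_over S"
    using l m S by (auto simp: polys_over_def subring_mult)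
  define r2 where "r2 = r1 - smult l m"
  have "pCons c p = pCons l q * m + r2"
    by (simp add: pe r1_def r2_def)
  moreover have "r2 \<in> polys_over S"
    unfolding r2_def by (rule subring_diff[OF P r1(1) lm])
  moreover have "pCons l q \<in> polys_over S" using l q by (simp add: polys_over_pCons)
  moreover have "poly.coeff r2 i = 0" if "i \<ge> degree m" for i
    using that m r1(2)[of i] by (cases "i = degree m") (auto simp: r2_def l_def coeff_eq_0)
  ultimately show ?case by blast
qed

definition is_ideal :: "'a::comm_ring_1 set \<Rightarrow> bool" where
  "is_ideal J \<longleftrightarrow> 0 \<in> J \<and> (\<forall>x\<in>J. \<forall>y\<in>J. x + y \<in> J) \<and> (\<forall>r. \<forall>x\<in>J. r * x \<in> J)"

context
  fixes J :: "'a::comm_ring_1 set"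
  assumes J: "is_ideal J"
begin

lemma ideal_zero: "0 \<in> J" and ideal_add: "x \<in> J \<Longrightarrow> y \<in> J \<Longrightarrow> x + y \<in> J"
  and ideal_mult: "x \<in> J \<Longrightarrow> r * x \<in> J"
  using J by (auto simp: is_ideal_def)

lemma ideal_mult2: "x \<in> J \<Longrightarrow> x * r \<in> J"
  using ideal_mult[of x r] by (simp add: mult.commute)

lemma ideal_uminus: "x \<in> J \<Longrightarrow> - x \<in> J"
  using ideal_mult[of x "-1"] by simp

lemma ideal_diff: "x \<in> J \<Longrightarrow> y \<in> J \<Longrightarrow> x - y \<in> J"
  using ideal_add[of x "- y"] ideal_uminus by simp

lemma ideal_sum: "(\<And>i. i \<in> A \<Longrightarrow> f i \<in> J) \<Longrightarrow> sum f A \<in> J"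
  by (induction A rule: infinite_finite_induct) (auto simp: ideal_zero ideal_add)

lemma poly_in_ideal: "p \<in> polys_over J \<Longrightarrow> poly p x \<in> J"
  unfolding poly_altdef by (intro ideal_sum ideal_mult2) (auto simp: polys_over_def)

end

lemma is_ideal_kernel: "is_hom h \<Longrightarrow> is_ideal {x. h x = 0}"
  by (auto simp: is_ideal_def hom_simps)

inductive_set subalg :: "('c \<Rightarrow> 'r::comm_ring_1) \<Rightarrow> 'r set \<Rightarrow> 'r set" for \<iota> G where
  const: "\<iota> c \<in> subalg \<iota> G"
| gen: "x \<in> G \<Longrightarrow> x \<in> subalg \<iota> G"
| add: "x \<in> subalg \<iota> G \<Longrightarrow> y \<in> subalg \<iota> G \<Longrightarrow> x + y \<in> subalg \<iota> G"
| mult: "x \<in> subalg \<iota> G \<Longrightarrow> y \<in> subalg \<iota> G \<Longrightarrow> x * y \<in> subalg \<iota> G"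

lemma is_subring_subalg:
  assumes "is_hom (\<iota> :: 'c::comm_ring_1 \<Rightarrow> 'r::comm_ring_1)"
  shows "is_subring (subalg \<iota> G)"
  unfolding is_subring_def
proof (intro conjI ballI)
  show "1 \<in> subalg \<iota> G"
    using subalg.const[of \<iota> 1 G] by (simp add: hom_one[OF assms])
next
  fix x y assume xy: "x \<in> subalg \<iota> G" "y \<in> subalg \<iota> G"
  have "x + \<iota> (-1) * y \<in> subalg \<iota> G"
    by (intro subalg.intros xy)
  then show "x - y \<in> subalg \<iota> G"
    by (simp add: hom_uminus[OF assms] hom_one[OF assms])
  show "x * y \<in> subalg \<iota> G" by (intro subalg.mult xy)
qed

lemma subalg_mono: "G \<subseteq> H \<Longrightarrow> x \<in> subalg \<iota> G \<Longrightarrow> x \<in> subalg \<iota> H"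
  by (rotate_tac, induction rule: subalg.induct) (auto intro: subalg.intros)

lemma subalg_subset: "G \<subseteq> subalg \<iota> H \<Longrightarrow> x \<in> subalg \<iota> G \<Longrightarrow> x \<in> subalg \<iota> H"
  by (rotate_tac, induction rule: subalg.induct) (auto intro: subalg.intros)

lemma subalg_hom_cong:
  assumes "x \<in> subalg \<iota> G" "is_hom h" "is_hom h'" "\<And>c. h (\<iota> c) = h' (\<iota> c)" "\<And>g. g \<in> G \<Longrightarrow> h g = h' g"
  shows "h x = h' x"
  using assms(1) by (induction rule: subalg.induct) (auto simp: assms hom_add hom_mult)

text \<open>Isolating one generator prepares division with remainder in it, the other generators
  becoming coefficients.\<close>

lemma subalg_insert:
  assumes "is_hom (\<iota> :: 'c::comm_ring_1 \<Rightarrow> 'r::comm_ring_1)" "x \<in> subalg \<iota> (insert t G)"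
  shows "\<exists>p \<in> polys_over (subalg \<iota> G). x = poly p t"
  using assms(2)
proof (induction rule: subalg.induct)
  case (const c)
  then show ?case
    by (intro bexI[of _ "[:\<iota> c:]"])
       (auto simp: polys_over_pCons polys_over_0 is_subring_subalg[OF assms(1)] intro: subalg.const)
next
  case (gen y)
  note z = is_subring_subalg[OF assms(1), of G]
  show ?case
  proof (cases "y = t")
    case True
    then show ?thesis
      by (intro bexI[of _ "[:0, 1:]"]) (auto simp: polys_over_pCons polys_over_0 z subring_intros)
  next
    case False
    with gen show ?thesis
      by (intro bexI[of _ "[:y:]"]) (auto simp: polys_over_pCons polys_over_0 z subalg.gen)
  qed
next
  case (add x y)
  then obtain p q where "p \<in> polys_over (subalg \<iota> G)" "q \<in> polys_over (subalg \<iota> G)" "x = poly p t" "y = poly q t"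
    by blast
  then show ?case
    by (intro bexI[of _ "p + q"]) (auto intro!: subring_add is_subring_polys_over is_subring_subalg assms)
next
  case (mult x y)
  then obtain p q where "p \<in> polys_over (subalg \<iota> G)" "q \<in> polys_over (subalg \<iota> G)" "x = poly p t" "y = poly q t"
    by blast
  then show ?case
    by (intro bexI[of _ "p * q"]) (auto intro!: subring_mult is_subring_polys_over is_subring_subalg assms)
qed

inductive_set ideal_gen :: "'r::comm_ring_1 set \<Rightarrow> 'r set" for S where
  zero: "0 \<in> ideal_gen S"
| step: "x \<in> ideal_gen S \<Longrightarrow> s \<in> S \<Longrightarrow> x + r * s \<in> ideal_gen S"

lemma is_ideal_ideal_gen: "is_ideal (ideal_gen S)"
  unfolding is_ideal_def
proof (intro conjI ballI allI)
  fix x y assume x: "x \<in> ideal_gen S" and y: "y \<in> ideal_gen S"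
  from y show "x + y \<in> ideal_gen S"
    by induction (use x in \<open>auto intro: ideal_gen.step simp flip: add.assoc\<close>)
next
  fix r x assume "x \<in> ideal_gen S"
  then show "r * x \<in> ideal_gen S"
    by induction (auto intro: ideal_gen.intros simp: distrib_left simp flip: mult.assoc)
qed (rule ideal_gen.zero)

lemma ideal_gen_base: "s \<in> S \<Longrightarrow> s \<in> ideal_gen S"
  using ideal_gen.step[OF ideal_gen.zero, of s S 1] by simp

text \<open>\<open>mpoly_ideal\<close> allows one multiplier per generator, so repeated uses of a
  generator in the inductive description have to be merged.\<close>

lemma ideal_gen_explicit:
  "x \<in> ideal_gen S \<Longrightarrow> \<exists>F q. finite F \<and> F \<subseteq> S \<and> x = (\<Sum>s\<in>F. q s * s)"
proof (induction rule: ideal_gen.induct)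
  case zero
  show ?case by (intro exI[of _ "{}"]) auto
next
  case (step x s r)
  then obtain F q where F: "finite F" "F \<subseteq> S" "x = (\<Sum>s\<in>F. q s * s)" by blast
  define q' where "q' = (\<lambda>t. (if t \<in> F then q t else 0) + (if t = s then r else 0))"
  have "(\<Sum>t\<in>insert s F. q' t * t) = (\<Sum>t\<in>insert s F. (if t \<in> F then q t else 0) * t)
      + (\<Sum>t\<in>insert s F. (if t = s then r else 0) * t)"
    by (simp add: q'_def distrib_right sum.distrib)
  also have "(\<Sum>t\<in>insert s F. (if t = s then r else 0) * t) = r * s"
    using F(1) by (simp add: if_distrib[of "\<lambda>u. u * _"] cong: if_cong)
  also have "(\<Sum>t\<in>insert s F. (if t \<in> F then q t else 0) * t) = (\<Sum>t\<in>F. q t * t)"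
    using F(1) by (intro sum.mono_neutral_cong_right) auto
  finally have "x + r * s = (\<Sum>t\<in>insert s F. q' t * t)"
    using F by simp
  then show ?case
    using F step by (intro exI[of _ "insert s F"] exI[of _ q']) auto
qed

subsection \<open>Multivariate polynomials\<close>

definition mono_eval :: "(nat \<Rightarrow> 'b::comm_semiring_1) \<Rightarrow> (nat \<Rightarrow>\<^sub>0 nat) \<Rightarrow> 'b" where
  "mono_eval x m = (\<Prod>i \<in> Poly_Mapping.keys m. x i ^ Poly_Mapping.lookup m i)"

text \<open>Coefficients pass through \<open>\<iota>\<close>, so that one map evaluates at points of
  the field, at polynomials (substitution is \<open>ev Const s\<close>) and at power series.\<close>

definition ev :: "('a::comm_ring_1 \<Rightarrow> 'b::comm_ring_1) \<Rightarrow> (nat \<Rightarrow> 'b) \<Rightarrow> 'a mpoly \<Rightarrow> 'b" where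
  "ev \<iota> x p = (\<Sum>m \<in> Poly_Mapping.keys p. \<iota> (Poly_Mapping.lookup p m) * mono_eval x m)"

lemma mpoly_eval_ev: "mpoly_eval p x = ev (\<lambda>c. c) x p"
  by (simp add: mpoly_eval_def ev_def mono_eval_def)

definition Const :: "'a::comm_ring_1 \<Rightarrow> 'a mpoly" where
  "Const c = Poly_Mapping.single 0 c"

definition Var :: "nat \<Rightarrow> 'a::comm_ring_1 mpoly" where
  "Var i = Poly_Mapping.single (Poly_Mapping.single i 1) 1"

lemma mono_eval_superset:
  assumes "finite A" "Poly_Mapping.keys m \<subseteq> A"
  shows "mono_eval x m = (\<Prod>i \<in> A. x i ^ Poly_Mapping.lookup m i)"
  unfolding mono_eval_def
  by (rule prod.mono_neutral_left) (use assms in \<open>auto simp: in_keys_iff\<close>)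

lemma mono_eval_add: "mono_eval x (m + m') = mono_eval x m * mono_eval x m'"
proof -
  let ?A = "Poly_Mapping.keys m \<union> Poly_Mapping.keys m'"
  have "mono_eval x (m + m') = (\<Prod>i \<in> ?A. x i ^ Poly_Mapping.lookup (m + m') i)"
    by (rule mono_eval_superset) (use keys_add[of m m'] in auto)
  also have "\<dots> = (\<Prod>i \<in> ?A. x i ^ Poly_Mapping.lookup m i) * (\<Prod>i \<in> ?A. x i ^ Poly_Mapping.lookup m' i)"
    by (simp add: lookup_add power_add prod.distrib)
  also have "\<dots> = mono_eval x m * mono_eval x m'"
    by (subst (1 2) mono_eval_superset[of ?A]) auto
  finally show ?thesis .
qed

context
  fixes \<iota> :: "'a::comm_ring_1 \<Rightarrow> 'b::comm_ring_1" and x :: "nat \<Rightarrow> 'b"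
  assumes \<iota>: "is_hom \<iota>"
begin

lemma ev_superset:
  assumes "finite A" "Poly_Mapping.keys p \<subseteq> A"
  shows "ev \<iota> x p = (\<Sum>m \<in> A. \<iota> (Poly_Mapping.lookup p m) * mono_eval x m)"
  unfolding ev_def
  by (rule sum.mono_neutral_left) (use assms in \<open>auto simp: in_keys_iff hom_zero[OF \<iota>]\<close>)

lemma ev_add: "ev \<iota> x (p + q) = ev \<iota> x p + ev \<iota> x q"
proof -
  let ?A = "Poly_Mapping.keys p \<union> Poly_Mapping.keys q"
  have "ev \<iota> x (p + q) = (\<Sum>m \<in> ?A. \<iota> (Poly_Mapping.lookup (p + q) m) * mono_eval x m)"
    by (rule ev_superset) (use keys_add[of p q] in auto)
  also have "\<dots> = ev \<iota> x p + ev \<iota> x q"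
    by (subst (1 2) ev_superset[of ?A])
       (auto simp: lookup_add hom_add[OF \<iota>] distrib_right sum.distrib)
  finally show ?thesis .
qed

lemma ev_zero: "ev \<iota> x 0 = 0"
  by (simp add: ev_def)

lemma ev_single: "ev \<iota> x (Poly_Mapping.single m c) = \<iota> c * mono_eval x m"
  by (subst ev_superset[of "{m}"]) auto

lemma ev_sum: "ev \<iota> x (sum f A) = (\<Sum>i\<in>A. ev \<iota> x (f i))"
  by (induction A rule: infinite_finite_induct) (auto simp: ev_zero ev_add)

end

lemma mpoly_sum_singles:
  "p = (\<Sum>m\<in>Poly_Mapping.keys p. Poly_Mapping.single m (Poly_Mapping.lookup p m))"
proof (rule poly_mapping_eqI)
  fix k
  show "Poly_Mapping.lookup p k =
    Poly_Mapping.lookup (\<Sum>m\<in>Poly_Mapping.keys p. Poly_Mapping.single m (Poly_Mapping.lookup p m)) k"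
    by (auto simp: lookup_sum lookup_single when_def in_keys_iff)
qed

lemma is_hom_ev:
  assumes \<iota>: "is_hom \<iota>"
  shows "is_hom (ev \<iota> x)"
proof (rule is_homI)
  show "ev \<iota> x 1 = 1"
    using ev_single[OF \<iota>, of x 0 1] by (simp add: hom_one[OF \<iota>] mono_eval_def)
next
  fix p q :: "'a mpoly"
  show "ev \<iota> x (p + q) = ev \<iota> x p + ev \<iota> x q" by (rule ev_add[OF \<iota>])
  have "p * q = (\<Sum>m\<in>Poly_Mapping.keys p. \<Sum>m'\<in>Poly_Mapping.keys q.
      Poly_Mapping.single (m + m') (Poly_Mapping.lookup p m * Poly_Mapping.lookup q m'))"
    by (subst (1) mpoly_sum_singles[of p], subst (1) mpoly_sum_singles[of q])
       (simp only: sum_product mult_single)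
  then have "ev \<iota> x (p * q) = (\<Sum>m\<in>Poly_Mapping.keys p. \<Sum>m'\<in>Poly_Mapping.keys q.
      (\<iota> (Poly_Mapping.lookup p m) * mono_eval x m) * (\<iota> (Poly_Mapping.lookup q m') * mono_eval x m'))"
    by (simp add: ev_sum[OF \<iota>] ev_single[OF \<iota>] hom_mult[OF \<iota>] mono_eval_add mult_ac)
  also have "\<dots> = ev \<iota> x p * ev \<iota> x q"
    by (simp add: ev_def sum_product)
  finally show "ev \<iota> x (p * q) = ev \<iota> x p * ev \<iota> x q" .
qed

lemma ev_Const: "is_hom \<iota> \<Longrightarrow> ev \<iota> x (Const c) = \<iota> c"
  by (simp add: Const_def ev_single mono_eval_def)

lemma ev_Var: "is_hom \<iota> \<Longrightarrow> ev \<iota> x (Var i) = x i"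
  by (simp add: Var_def ev_single mono_eval_def hom_one)

lemma is_hom_Const: "is_hom Const"
  by (rule is_homI) (auto simp: Const_def single_add mult_single)

lemma single_power:
  "(Poly_Mapping.single m 1 :: 'a::comm_ring_1 mpoly) ^ k = Poly_Mapping.single (\<Sum>_<k. m) 1"
  by (induction k) (auto simp: mult_single add.commute lessThan_Suc simp del: sum_constant)

lemma mono_decomp: "Poly_Mapping.single m (c::'a::comm_ring_1) = Const c * mono_eval Var m"
proof -
  have *: "(\<Prod>i\<in>A. Var i ^ Poly_Mapping.lookup m i)
     = (Poly_Mapping.single (\<Sum>i\<in>A. Poly_Mapping.single i (Poly_Mapping.lookup m i)) 1 :: 'a mpoly)"
    if "finite A" for A
    using that
  proof (induction A rule: finite_induct)
    case (insert i A)
    have "(\<Sum>_<k. Poly_Mapping.single i (1::nat)) = Poly_Mapping.single i k" for k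
      by (induction k) (auto simp: add.commute simp del: sum_constant simp flip: single_add)
    with insert show ?case
      by (simp add: Var_def single_power mult_single)
  qed auto
  have "mono_eval Var m = (Poly_Mapping.single m 1 :: 'a mpoly)"
    unfolding mono_eval_def by (subst *) (auto simp flip: mpoly_sum_singles)
  then show ?thesis by (simp add: Const_def mult_single)
qed

lemma ev_Const_Var: "ev Const Var p = p"
  unfolding ev_def mono_decomp[symmetric] by (rule mpoly_sum_singles[symmetric])

lemma hom_ev:
  assumes "is_hom h" "is_hom \<iota>"
  shows "h (ev \<iota> x p) = ev (\<lambda>c. h (\<iota> c)) (\<lambda>i. h (x i)) p"
  unfolding ev_def mono_eval_def by (simp add: hom_simps[OF assms(1)])

lemma ev_subst:
  assumes "is_hom \<iota>"
  shows "ev \<iota> y (ev Const s p) = ev \<iota> (\<lambda>i. ev \<iota> y (s i)) p"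
  using assms by (simp add: hom_ev[OF is_hom_ev is_hom_Const] ev_Const)

lemma ev_cong:
  assumes "p \<in> mpolys n" "\<And>i. i \<in> {1..n} \<Longrightarrow> x i = y i"
  shows "ev \<iota> x p = ev \<iota> y p"
  unfolding ev_def mono_eval_def
proof (intro sum.cong refl arg_cong2[of _ _ _ _ "(*)"] prod.cong)
  fix m i assume "m \<in> Poly_Mapping.keys p" "i \<in> Poly_Mapping.keys m"
  then have "i \<in> {1..n}" using assms(1) unfolding mpolys_def by blast
  then show "x i ^ Poly_Mapping.lookup m i = y i ^ Poly_Mapping.lookup m i"
    using assms(2) by simp
qed

text \<open>In this form the generators can be exchanged: the same ring will be generated by the
  coefficients of \<open>g\<close> and the roots.\<close>

lemma mpolys_eq_subalg: "(mpolys n :: 'a::comm_ring_1 mpoly set) = subalg Const (Var ` {1..n})"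
proof
  show "(mpolys n :: 'a mpoly set) \<subseteq> subalg Const (Var ` {1..n})"
  proof
    fix p :: "'a mpoly" assume p: "p \<in> mpolys n"
    note S = is_subring_subalg[OF is_hom_Const, of "Var ` {1..n} :: 'a mpoly set"]
    have "ev Const Var p \<in> subalg Const (Var ` {1..n})"
      unfolding ev_def mono_eval_def
      by (intro subring_intros[OF S] subalg.intros) (use p in \<open>auto simp: mpolys_def\<close>)
    then show "p \<in> subalg Const (Var ` {1..n})" by (simp add: ev_Const_Var)
  qed
next
  show "subalg Const (Var ` {1..n}) \<subseteq> (mpolys n :: 'a mpoly set)"
  proof
    fix p :: "'a mpoly" assume "p \<in> subalg Const (Var ` {1..n})"
    then show "p \<in> mpolys n"
    proof induction
      case (const c)
      show ?case by (auto simp: mpolys_def Const_def)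
    next
      case (gen x)
      then show ?case by (auto simp: mpolys_def Var_def)
    next
      case (add x y)
      then show ?case using keys_add[of x y] by (auto simp: mpolys_def)
    next
      case (mult x y)
      show ?case unfolding mpolys_def
      proof (intro CollectI ballI)
        fix m assume "m \<in> Poly_Mapping.keys (x * y)"
        then obtain a b where "m = a + b" "a \<in> Poly_Mapping.keys x" "b \<in> Poly_Mapping.keys y"
          using keys_mult[of x y] by blast
        then show "Poly_Mapping.keys m \<subseteq> {1..n}"
          using mult.IH keys_add[of a b] unfolding mpolys_def by blast
      qed
    qed
  qed
qed

lemma is_subring_mpolys: "is_subring (mpolys n :: 'a::comm_ring_1 mpoly set)"
  unfolding mpolys_eq_subalg by (rule is_subring_subalg[OF is_hom_Const])

lemma Const_in_mpolys: "Const c \<in> mpolys n"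
  by (auto simp: mpolys_eq_subalg intro: subalg.const)

lemma Var_in_mpolys: "i \<in> {1..n} \<Longrightarrow> Var i \<in> mpolys n"
  by (auto simp: mpolys_eq_subalg intro: subalg.gen)

lemma mpolys_mono: "n \<le> k \<Longrightarrow> mpolys n \<subseteq> mpolys k"
proof -
  assume "n \<le> k"
  then have "{1..n} \<subseteq> {1..k}" by auto
  then show ?thesis unfolding mpolys_def by blast
qed

subsection \<open>Generic monic polynomials\<close>

text \<open>\<open>generic_monic\<close> over an arbitrary commutative ring, since its coefficients
  will also be variables and power series. The constant coefficient is \<open>a n\<close>.\<close>

definition gmon :: "nat \<Rightarrow> (nat \<Rightarrow> 'a::comm_ring_1) \<Rightarrow> 'a poly" where
  "gmon n a = Polynomial.monom 1 n + (\<Sum>j=1..n. Polynomial.monom (a j) (n - j))"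

lemma generic_monic_eq_gmon: "generic_monic n a = gmon n a"
  by (simp add: generic_monic_def gmon_def)

lemma coeff_gmon:
  "poly.coeff (gmon n a) i = (if i = n then 1 else if i < n then a (n - i) else 0)"
proof -
  have "poly.coeff (\<Sum>j=1..n. Polynomial.monom (a j) (n - j)) i
      = (\<Sum>j=1..n. if n - j = i then a j else 0)"
    by (simp add: coeff_sum)
  also have "\<dots> = (if i < n then a (n - i) else 0)"
  proof (cases "i < n")
    case True
    have "(\<Sum>j=1..n. if n - j = i then a j else 0) = (\<Sum>j=1..n. if j = n - i then a j else 0)"
      using True by (intro sum.cong) auto
    then show ?thesis using True by simp
  qed (auto intro!: sum.neutral)
  finally show ?thesis by (auto simp: gmon_def)
qed

lemma gmon_degree: "degree (gmon n a :: 'a::comm_ring_1 poly) = n"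
  and gmon_monic: "lead_coeff (gmon n a :: 'a::comm_ring_1 poly) = 1"
proof -
  show *: "degree (gmon n a :: 'a poly) = n"
    by (rule antisym[OF degree_le le_degree]) (auto simp: coeff_gmon)
  show "lead_coeff (gmon n a :: 'a poly) = 1"
    unfolding * by (simp add: coeff_gmon)
qed

lemma map_poly_gmon: "is_hom h \<Longrightarrow> map_poly h (gmon n a) = gmon n (\<lambda>j. h (a j))"
  by (rule poly_eqI) (auto simp: coeff_map_hom coeff_gmon hom_one hom_zero)

lemma gmon_cong: "(\<And>j. j \<in> {1..n} \<Longrightarrow> a j = b j) \<Longrightarrow> gmon n a = gmon n b"
  by (rule poly_eqI) (auto simp: coeff_gmon)

lemma gmon_coeffs:
  assumes "degree p = n" "lead_coeff p = 1"
  shows "gmon n (\<lambda>j. poly.coeff p (n - j)) = p"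
  by (rule poly_eqI) (use assms in \<open>auto simp: coeff_gmon coeff_eq_0\<close>)

lemma gmon_polys_over: "is_subring S \<Longrightarrow> (\<And>j. j \<in> {1..n} \<Longrightarrow> a j \<in> S) \<Longrightarrow> gmon n a \<in> polys_over S"
  by (auto simp: polys_over_def coeff_gmon subring_intros)

lemma lead_coeff_synthetic_div:
  fixes p :: "'a::comm_ring_1 poly"
  assumes "degree p > 0"
  shows "lead_coeff (synthetic_div p c) = lead_coeff p"
proof -
  define q where "q = synthetic_div p c"
  have d: "degree p = Suc (degree q)" using assms by (simp add: q_def degree_synthetic_div)
  have "poly.coeff p (Suc (degree q)) = poly.coeff ([:-c, 1:] * q + [:poly p c:]) (Suc (degree q))"
    unfolding q_def synthetic_div_correct' ..
  also have "\<dots> = lead_coeff q"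
    by (simp add: coeff_eq_0)
  finally show ?thesis by (simp add: d flip: q_def)
qed

text \<open>The unknowns \<open>\<tau> \<theta>\<close> are to be solutions of \<open>g (\<tau> \<theta>) = w \<theta>\<close>, where \<open>g\<close> is monic with
  coefficients \<open>a\<close>; good ideals describe such solutions with \<open>\<tau> \<theta> \<noteq> \<tau> \<eta>\<close> for \<open>\<theta> \<noteq> \<eta>\<close>.\<close>

locale fibred =
  fixes \<iota> :: "'c::field \<Rightarrow> 'r::comm_ring_1" and a :: "nat \<Rightarrow> 'r" and \<tau> :: "'i \<Rightarrow> 'r"
    and w :: "'i \<Rightarrow> 'c" and \<Theta> :: "'i set" and n :: nat
  assumes \<iota>: "is_hom \<iota>" and n_pos: "n > 0" and finite_\<Theta>: "finite \<Theta>"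
    and card_fibre: "\<And>\<theta>. \<theta> \<in> \<Theta> \<Longrightarrow> card {\<eta> \<in> \<Theta>. w \<eta> = w \<theta>} = n"
begin

text \<open>Root differences are nonzerodivisors modulo \<open>J\<close> rather than merely outside
  \<open>J\<close>: the ideal need not be prime, and cancelling these differences is what permits
  roots to be split off one by one.\<close>

definition good :: "'r set \<Rightarrow> bool" where
  "good J \<longleftrightarrow> is_ideal J \<and> (\<forall>\<theta>\<in>\<Theta>. poly (gmon n a) (\<tau> \<theta>) - \<iota> (w \<theta>) \<in> J) \<and>
     (\<forall>\<theta>\<in>\<Theta>. \<forall>\<eta>\<in>\<Theta>. \<theta> \<noteq> \<eta> \<longrightarrow> (\<forall>p. (\<tau> \<theta> - \<tau> \<eta>) * p \<in> J \<longrightarrow> p \<in> J))"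

abbreviation alg :: "'i set \<Rightarrow> 'r set" where
  "alg S \<equiv> subalg \<iota> (a ` {1..n} \<union> \<tau> ` S)"

lemma alg_mono: "S \<subseteq> T \<Longrightarrow> alg S \<subseteq> alg T"
  by (intro subsetI, erule subalg_mono[rotated]) auto

lemma is_subring_alg: "is_subring (alg S)"
  by (rule is_subring_subalg[OF \<iota>])

text \<open>The remaining factor of the generic polynomial after splitting off the roots in \<open>S\<close>;
  all congruences hold modulo every good ideal at once.\<close>

lemma remaining_factor:
  assumes "finite S" "S \<subseteq> {\<theta> \<in> \<Theta>. w \<theta> = c}"
  shows "\<exists>\<psi> \<in> polys_over (alg S). degree \<psi> = n - card S \<and> lead_coeff \<psi> = 1 \<and>
    (\<forall>J. good J \<longrightarrow> (\<forall>\<theta>\<in>\<Theta> - S. w \<theta> = c \<longrightarrow> poly \<psi> (\<tau> \<theta>) \<in> J) \<and>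
       gmon n a - [:\<iota> c:] - \<psi> * (\<Prod>s\<in>S. [:- \<tau> s, 1:]) \<in> polys_over J)"
  using assms
proof (induction S rule: finite_induct)
  case empty
  define \<psi> where "\<psi> = gmon n a - [:\<iota> c:]"
  have d: "degree \<psi> = n" "lead_coeff \<psi> = 1"
  proof -
    have "\<psi> = gmon n (a(n := a n - \<iota> c))"
      unfolding \<psi>_def using n_pos by (intro poly_eqI) (auto simp: coeff_gmon coeff_pCons split: nat.splits)
    then show "degree \<psi> = n" "lead_coeff \<psi> = 1" by (auto simp: gmon_degree coeff_gmon)
  qed
  have "\<psi> \<in> polys_over (alg {})"
    unfolding \<psi>_def
    by (intro subring_diff[OF is_subring_polys_over[OF is_subring_alg]] gmon_polys_over is_subring_alg)
       (auto simp: polys_over_pCons polys_over_0 is_subring_alg[of "{}", simplified] intro: subalg.intros)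
  moreover have "poly \<psi> (\<tau> \<theta>) \<in> J" if "good J" "\<theta> \<in> \<Theta>" "w \<theta> = c" for J \<theta>
    using that by (auto simp: \<psi>_def good_def)
  moreover have "gmon n a - [:\<iota> c:] - \<psi> * (\<Prod>s\<in>{}. [:- \<tau> s, 1:]) \<in> polys_over J" if "good J" for J
    using that by (auto simp: \<psi>_def good_def polys_over_def ideal_zero)
  ultimately show ?case
    using d by (intro bexI[of _ \<psi>]) simp_all
next
  case (insert s S)
  then obtain \<psi> where \<psi>: "\<psi> \<in> polys_over (alg S)" "degree \<psi> = n - card S" "lead_coeff \<psi> = 1"
    and \<psi>J: "\<And>J \<theta>. good J \<Longrightarrow> \<theta> \<in> \<Theta> - S \<Longrightarrow> w \<theta> = c \<Longrightarrow> poly \<psi> (\<tau> \<theta>) \<in> J"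
      "\<And>J. good J \<Longrightarrow> gmon n a - [:\<iota> c:] - \<psi> * (\<Prod>s\<in>S. [:- \<tau> s, 1:]) \<in> polys_over J"
    by auto
  have s: "s \<in> \<Theta>" "w s = c" "s \<notin> S" using insert by auto
  \<comment> \<open>The fibre still contains \<open>s\<close>, so fewer than \<open>n\<close> roots
    have been split off and \<open>\<psi>\<close> is not constant.\<close>
  have "card (insert s S) \<le> card {\<theta> \<in> \<Theta>. w \<theta> = c}"
    using insert finite_\<Theta> by (intro card_mono) auto
  then have "card (insert s S) \<le> n"
    using card_fibre[OF s(1)] s by simp
  then have pos: "degree \<psi> > 0" using insert \<psi> by simp
  define \<psi>' where "\<psi>' = synthetic_div \<psi> (\<tau> s)"
  have split: "\<psi> = [:- \<tau> s, 1:] * \<psi>' + [:poly \<psi> (\<tau> s):]"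
    unfolding \<psi>'_def by (rule synthetic_div_correct'[symmetric])
  have "\<psi> \<in> polys_over (alg (insert s S))"
    using \<psi>(1) alg_mono[of S "insert s S"] by (auto simp: polys_over_def)
  then have "\<psi>' \<in> polys_over (alg (insert s S))"
    unfolding \<psi>'_def by (intro synthetic_div_polys_over is_subring_alg) (auto intro: subalg.gen)
  moreover have "degree \<psi>' = n - card (insert s S)"
    using insert \<psi> by (simp add: \<psi>'_def degree_synthetic_div)
  moreover have "lead_coeff \<psi>' = 1"
    unfolding \<psi>'_def using lead_coeff_synthetic_div[OF pos] \<psi> by simp
  moreover have "poly \<psi>' (\<tau> \<theta>) \<in> J" if J: "good J" and \<theta>: "\<theta> \<in> \<Theta> - insert s S" "w \<theta> = c" for J \<theta>
  proof -
    have I: "is_ideal J" using J by (simp add: good_def)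
    \<comment> \<open>Both values of \<open>\<psi>\<close> lie in \<open>J\<close>, hence so does
      the product; the factor \<open>\<tau> \<theta> - \<tau> s\<close> is cancelled because
      \<open>J\<close> is good.\<close>
    have "poly \<psi> (\<tau> \<theta>) = (\<tau> \<theta> - \<tau> s) * poly \<psi>' (\<tau> \<theta>) + poly \<psi> (\<tau> s)"
      by (subst split) (simp add: algebra_simps)
    then have "(\<tau> \<theta> - \<tau> s) * poly \<psi>' (\<tau> \<theta>) = poly \<psi> (\<tau> \<theta>) - poly \<psi> (\<tau> s)" by simp
    also have "\<dots> \<in> J"
      using \<theta> s by (intro ideal_diff[OF I] \<psi>J[OF J]) auto
    finally show ?thesis using J \<theta> s unfolding good_def by auto
  qed
  moreover have "gmon n a - [:\<iota> c:] - \<psi>' * (\<Prod>s\<in>insert s S. [:- \<tau> s, 1:]) \<in> polys_over J" if J: "good J" for J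
  proof -
    have I: "is_ideal J" using J by (simp add: good_def)
    define P where "P = (\<Prod>s\<in>S. [:- \<tau> s, 1:])"
    have "gmon n a - [:\<iota> c:] - \<psi>' * (\<Prod>s\<in>insert s S. [:- \<tau> s, 1:])
      = (gmon n a - [:\<iota> c:] - \<psi> * P) + (\<psi> - [:- \<tau> s, 1:] * \<psi>') * P"
      using insert unfolding P_def[symmetric] by (simp add: P_def[symmetric] algebra_simps del: mult_pCons_left mult_pCons_right)
    also have "\<psi> - [:- \<tau> s, 1:] * \<psi>' = [:poly \<psi> (\<tau> s):]"
      by (subst (1) split) simp
    finally have eq: "gmon n a - [:\<iota> c:] - \<psi>' * (\<Prod>s\<in>insert s S. [:- \<tau> s, 1:])
      = (gmon n a - [:\<iota> c:] - \<psi> * P) + smult (poly \<psi> (\<tau> s)) P" by simp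
    have "poly \<psi> (\<tau> s) \<in> J" using \<psi>J(1)[OF J, of s] s by auto
    then show ?thesis
      unfolding eq using \<psi>J(2)[OF J]
      by (auto simp only: polys_over_def P_def coeff_add coeff_smult mem_Collect_eq intro!: ideal_add[OF I] ideal_mult2[OF I])
  qed
  ultimately show ?case by (intro bexI[of _ \<psi>']) auto
qed

lemma good_kernel_separates:
  assumes "is_hom (\<phi> :: 'r \<Rightarrow> 'd::comm_ring_1)" "good {x. \<phi> x = 0}" "\<theta> \<in> \<Theta>" "\<eta> \<in> \<Theta>" "\<theta> \<noteq> \<eta>"
  shows "\<phi> (\<tau> \<theta>) \<noteq> \<phi> (\<tau> \<eta>)"
proof
  assume "\<phi> (\<tau> \<theta>) = \<phi> (\<tau> \<eta>)"
  then have "(\<tau> \<theta> - \<tau> \<eta>) * 1 \<in> {x. \<phi> x = 0}"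
    using assms(1) by (simp add: hom_diff)
  then have "1 \<in> {x. \<phi> x = 0}" using assms unfolding good_def by blast
  then show False using assms(1) by (simp add: hom_one)
qed

text \<open>Labels are removed one at a time. Modulo the remaining factor, \<open>p\<close> becomes
  a polynomial in \<open>\<tau> q\<close> of degree below the number of free labels in the fibre of
  \<open>q\<close>. By the symmetry of \<open>F\<close> this polynomial vanishes at all free roots,
  so its coefficients are killed by \<open>F\<close> and the induction applies to them. What is left
  at the end is the algebra of \<open>S0\<close>, where \<open>base\<close> takes over.\<close>

lemma vanishing_imp_in_good_ideal:
  fixes F :: "('r \<Rightarrow> 'd::idom) set"
  assumes F: "\<And>\<phi>. \<phi> \<in> F \<Longrightarrow> is_hom \<phi> \<and> good {x. \<phi> x = 0}"
    and swap: "\<And>\<phi> \<theta> \<eta>. \<phi> \<in> F \<Longrightarrow> \<theta> \<in> \<Theta> - S0 \<Longrightarrow> \<eta> \<in> \<Theta> - S0 \<Longrightarrow> w \<theta> = w \<eta> \<Longrightarrow>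
      \<exists>\<phi>'\<in>F. (\<forall>c. \<phi>' (\<iota> c) = \<phi> (\<iota> c)) \<and> (\<forall>j\<in>{1..n}. \<phi>' (a j) = \<phi> (a j)) \<and>
        (\<forall>s\<in>\<Theta>. \<phi>' (\<tau> s) = \<phi> (\<tau> (transpose \<theta> \<eta> s)))"
    and S0: "S0 \<subseteq> \<Theta>" "\<And>\<theta> \<eta>. \<theta> \<in> S0 \<Longrightarrow> \<eta> \<in> \<Theta> \<Longrightarrow> w \<eta> = w \<theta> \<Longrightarrow> \<eta> \<in> S0"
    and J: "good J"
    and base: "\<And>p. p \<in> alg S0 \<Longrightarrow> (\<And>\<phi>. \<phi> \<in> F \<Longrightarrow> \<phi> p = 0) \<Longrightarrow> p \<in> J"
    and p: "p \<in> alg \<Theta>" "\<And>\<phi>. \<phi> \<in> F \<Longrightarrow> \<phi> p = 0"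
  shows "p \<in> J"
proof -
  have I: "is_ideal J" using J by (simp add: good_def)
  have "finite T \<Longrightarrow> T \<subseteq> \<Theta> - S0 \<Longrightarrow> p \<in> alg (S0 \<union> T) \<Longrightarrow> (\<And>\<phi>. \<phi> \<in> F \<Longrightarrow> \<phi> p = 0) \<Longrightarrow> p \<in> J"
    for T p
  proof (induction T arbitrary: p rule: finite_induct)
    case empty
    then show ?case using base by simp
  next
    case (insert q T)
    define U where "U = S0 \<union> T"
    \<comment> \<open>\<open>S0\<close> consists of whole fibres and misses \<open>q\<close>, so all
      labels already used in the fibre of \<open>q\<close> come from \<open>T\<close>.\<close>
    define S where "S = {\<theta> \<in> T. w \<theta> = w q}"
    have q: "q \<in> \<Theta>" "q \<notin> S0" "q \<notin> T" using insert by auto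
    have "finite S" "S \<subseteq> {\<theta> \<in> \<Theta>. w \<theta> = w q}" using insert by (auto simp: S_def)
    from remaining_factor[OF this] obtain \<psi> where
      \<psi>: "\<psi> \<in> polys_over (alg S)" "degree \<psi> = n - card S" "lead_coeff \<psi> = 1"
      and \<psi>J: "\<And>J \<theta>. good J \<Longrightarrow> \<theta> \<in> \<Theta> - S \<Longrightarrow> w \<theta> = w q \<Longrightarrow> poly \<psi> (\<tau> \<theta>) \<in> J" by auto
    have qS: "q \<in> \<Theta> - S" using q by (auto simp: S_def)
    have \<psi>U: "\<psi> \<in> polys_over (alg U)"
      using \<psi>(1) alg_mono[of S U] by (auto simp: polys_over_def S_def U_def)
    have "p \<in> subalg \<iota> (insert (\<tau> q) (a ` {1..n} \<union> \<tau> ` U))"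
      using insert.prems by (simp add: U_def)
    from subalg_insert[OF \<iota> this] obtain P where P: "P \<in> polys_over (alg U)" "p = poly P (\<tau> q)"
      by auto
    from monic_division[OF is_subring_alg \<psi>U \<psi>(3) P(1)] obtain Q r where
      r: "r \<in> polys_over (alg U)" "P = Q * \<psi> + r" "\<And>i. i \<ge> n - card S \<Longrightarrow> poly.coeff r i = 0"
      using \<psi>(2) by auto
    have p_r: "p = poly Q (\<tau> q) * poly \<psi> (\<tau> q) + poly r (\<tau> q)"
      by (simp add: P(2) r(2))
    have coeffs: "poly.coeff r i \<in> J" for i
    proof (rule insert.IH)
      show "T \<subseteq> \<Theta> - S0" using insert by auto
      show "poly.coeff r i \<in> alg (S0 \<union> T)" using r(1) by (simp add: polys_over_def U_def)
    next
      fix \<phi> assume \<phi>: "\<phi> \<in> F"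
      note h = conjunct1[OF F[OF \<phi>]] and g = conjunct2[OF F[OF \<phi>]]
      \<comment> \<open>The labels of the fibre that are still free, \<open>q\<close> among them.
        There are \<open>n - card S\<close> of them, which exceeds the degree of
        \<open>r\<close>.\<close>
      define Z where "Z = {\<eta> \<in> \<Theta> - S. w \<eta> = w q}"
      have root: "poly (map_poly \<phi> r) (\<phi> (\<tau> \<eta>)) = 0" if "\<eta> \<in> Z" for \<eta>
      proof -
        have \<eta>: "\<eta> \<in> \<Theta>" "w \<eta> = w q" "\<eta> \<notin> S0" "\<eta> \<notin> T"
          using that S0(2)[of \<eta> q] q by (auto simp: Z_def S_def)
        obtain \<phi>' where \<phi>': "\<phi>' \<in> F" "\<And>c. \<phi>' (\<iota> c) = \<phi> (\<iota> c)" "\<And>j. j \<in> {1..n} \<Longrightarrow> \<phi>' (a j) = \<phi> (a j)"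
           "\<And>s. s \<in> \<Theta> \<Longrightarrow> \<phi>' (\<tau> s) = \<phi> (\<tau> (transpose q \<eta> s))"
          using swap[OF \<phi>, of q \<eta>] q \<eta> by auto
        note h' = conjunct1[OF F[OF \<phi>'(1)]] and g' = conjunct2[OF F[OF \<phi>'(1)]]
        \<comment> \<open>Exchanging \<open>q\<close> with the free label \<open>\<eta>\<close>
          touches no generator of \<open>alg U\<close>: the coefficients of \<open>r\<close> keep
          their values while \<open>\<tau> q\<close> goes to the root labelled
          \<open>\<eta>\<close>.\<close>
        have agree: "\<phi>' x = \<phi> x" if "x \<in> alg U" for x
        proof (rule subalg_hom_cong[OF that h' h])
          fix g assume "g \<in> a ` {1..n} \<union> \<tau> ` U"
          then show "\<phi>' g = \<phi> g"
          proof
            assume "g \<in> \<tau> ` U"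
            then obtain s where s: "s \<in> U" "g = \<tau> s" by auto
            then have "s \<in> \<Theta>" "s \<noteq> q" "s \<noteq> \<eta>" using \<eta> q insert.prems S0(1) by (auto simp: U_def)
            then show ?thesis using \<phi>'(4)[of s] s by (simp add: transpose_apply_other)
          qed (auto simp: \<phi>')
        qed (rule \<phi>'(2))
        have "map_poly \<phi>' r = map_poly \<phi> r"
          using r(1) by (intro poly_eqI) (auto simp: coeff_map_hom[OF h] coeff_map_hom[OF h'] polys_over_def agree)
        moreover have "\<phi>' (poly r (\<tau> q)) = 0"
        proof -
          have "\<phi>' (poly \<psi> (\<tau> q)) = 0" using \<psi>J[OF g' qS] by simp
          moreover have "\<phi>' p = 0" using insert.prems \<phi>'(1) by auto
          ultimately show ?thesis
            using p_r by (simp add: hom_add[OF h'] hom_mult[OF h'])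
        qed
        ultimately show ?thesis
          using \<phi>'(4)[OF q(1)] by (simp add: poly_map_hom[OF h'] flip: poly_map_hom[OF h'])
      qed
      have "map_poly \<phi> r = 0"
      proof (rule ccontr)
        assume nz: "map_poly \<phi> r \<noteq> 0"
        have cZ: "card Z = n - card S"
        proof -
          have "Z = {\<eta> \<in> \<Theta>. w \<eta> = w q} - S" by (auto simp: Z_def)
          moreover have "S \<subseteq> {\<eta> \<in> \<Theta>. w \<eta> = w q}" using insert by (auto simp: S_def)
          ultimately show ?thesis
            using card_fibre[OF q(1)] \<open>finite S\<close> by (simp add: card_Diff_subset)
        qed
        have "inj_on (\<lambda>\<eta>. \<phi> (\<tau> \<eta>)) Z"
          using good_kernel_separates[OF h g] by (auto simp: inj_on_def Z_def)
        then have "card Z = card ((\<lambda>\<eta>. \<phi> (\<tau> \<eta>)) ` Z)" by (simp add: card_image)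
        also have "\<dots> \<le> card {x. poly (map_poly \<phi> r) x = 0}"
          using root poly_roots_finite[OF nz] by (intro card_mono) auto
        also have "\<dots> \<le> degree (map_poly \<phi> r)" by (rule card_poly_roots_bound[OF nz])
        finally have "n - card S \<le> degree (map_poly \<phi> r)" using cZ by simp
        then have "lead_coeff (map_poly \<phi> r) = 0"
          using r(3) by (simp add: coeff_map_hom[OF h] hom_zero[OF h])
        with nz show False by simp
      qed
      then show "\<phi> (poly.coeff r i) = 0"
        by (metis coeff_0 coeff_map_hom[OF h])
    qed
    have "poly r (\<tau> q) \<in> J"
      by (rule poly_in_ideal[OF I]) (use coeffs in \<open>auto simp: polys_over_def\<close>)
    then show ?case
      unfolding p_r using \<psi>J[OF J qS] by (intro ideal_add[OF I] ideal_mult[OF I]) auto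
  qed
  from this[of "\<Theta> - S0" p] show ?thesis
    using finite_\<Theta> p S0(1) by (simp add: Un_absorb1)
qed

text \<open>Once a whole fibre is split off the remaining factor is \<open>1\<close>, so modulo good
  ideals \<open>g - w \<theta>\<close> is the product of linear factors over the fibre. This
  eliminates the coefficients from relations among the roots of one fibre.\<close>

lemma coefficients_from_fibre:
  assumes \<theta>: "\<theta> \<in> \<Theta>"
  shows "\<exists>A. (\<forall>j\<in>{1..n}. A j \<in> subalg \<iota> (\<tau> ` {\<eta> \<in> \<Theta>. w \<eta> = w \<theta>})) \<and>
    (\<forall>J. good J \<longrightarrow> (\<forall>j\<in>{1..n}. a j - A j \<in> J))"
proof -
  define S where "S = {\<eta> \<in> \<Theta>. w \<eta> = w \<theta>}"
  define Q where "Q = (\<Prod>s\<in>S. [:- \<tau> s, 1:]) + [:\<iota> (w \<theta>):]"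
  define A where "A j = poly.coeff Q (n - j)" for j
  have "finite S" "S \<subseteq> {\<eta> \<in> \<Theta>. w \<eta> = w \<theta>}" using finite_\<Theta> by (auto simp: S_def)
  from remaining_factor[OF this] card_fibre[OF \<theta>] obtain \<psi> where \<psi>: "degree \<psi> = 0" "lead_coeff \<psi> = 1"
    and J: "\<And>J. good J \<Longrightarrow> gmon n a - [:\<iota> (w \<theta>):] - \<psi> * (\<Prod>s\<in>S. [:- \<tau> s, 1:]) \<in> polys_over J"
    by (auto simp: S_def)
  have "\<psi> = 1"
    using \<psi> by (metis degree_eq_zeroE lead_coeff_pCons(2) one_pCons pCons_0_0 lead_coeff_pCons(1))
  have "a j - A j \<in> J" if "good J" "j \<in> {1..n}" for J j
  proof -
    have "poly.coeff (gmon n a - [:\<iota> (w \<theta>):] - (\<Prod>s\<in>S. [:- \<tau> s, 1:])) (n - j) \<in> J"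
      using J[OF that(1)] by (simp add: \<open>\<psi> = 1\<close> polys_over_def)
    moreover have "n - j \<noteq> n" "n - (n - j) = j" "n - j < n" using that by auto
    ultimately show ?thesis
      by (simp add: coeff_gmon A_def Q_def algebra_simps)
  qed
  moreover have "A j \<in> subalg \<iota> (\<tau> ` S)" for j
  proof -
    note R = is_subring_subalg[OF \<iota>, of "\<tau> ` S"]
    have "Q \<in> polys_over (subalg \<iota> (\<tau> ` S))"
      unfolding Q_def
      by (intro subring_add[OF is_subring_polys_over[OF R]] subring_prod[OF is_subring_polys_over[OF R]])
         (auto simp: polys_over_pCons polys_over_0[OF R] subring_one[OF R] intro!: subring_uminus[OF R] intro: subalg.intros)
    then show ?thesis by (simp add: A_def polys_over_def)
  qed
  ultimately show ?thesis unfolding S_def by (intro exI[of _ A]) blast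
qed

text \<open>The bound on the number of roots, carried out modulo \<open>J\<close>: synthetic
  division lowers the degree, and root differences can be cancelled although the quotient by
  \<open>J\<close> need not be a domain.\<close>

lemma interpolation_unique:
  assumes J: "good J" and "finite S" "S \<subseteq> \<Theta>"
    and "\<And>i. i \<ge> card S \<Longrightarrow> poly.coeff U i = 0" "\<And>\<theta>. \<theta> \<in> S \<Longrightarrow> poly U (\<tau> \<theta>) \<in> J"
  shows "U \<in> polys_over J"
  using assms(2-)
proof (induction S arbitrary: U rule: finite_induct)
  case empty
  then have "U = 0" by (intro poly_eqI) auto
  then show ?case using J by (auto simp: polys_over_def good_def ideal_zero)
next
  case (insert s S)
  have I: "is_ideal J" using J by (simp add: good_def)
  define U' where "U' = synthetic_div U (\<tau> s)"
  have split: "U = [:- \<tau> s, 1:] * U' + [:poly U (\<tau> s):]"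
    unfolding U'_def by (rule synthetic_div_correct'[symmetric])
  have "U' \<in> polys_over J"
  proof (rule insert.IH)
    show "S \<subseteq> \<Theta>" using insert by auto
    fix i assume i: "i \<ge> card S"
    have "degree U \<le> card S" using insert by (intro degree_le) auto
    then have "U' = 0 \<or> degree U' < i"
      using i by (cases "degree U = 0") (auto simp: U'_def synthetic_div_eq_0_iff degree_synthetic_div)
    then show "poly.coeff U' i = 0" by (auto simp: coeff_eq_0)
  next
    fix \<theta> assume \<theta>: "\<theta> \<in> S"
    have "poly U (\<tau> \<theta>) = (\<tau> \<theta> - \<tau> s) * poly U' (\<tau> \<theta>) + poly U (\<tau> s)"
      by (subst split) (simp add: algebra_simps)
    then have "(\<tau> \<theta> - \<tau> s) * poly U' (\<tau> \<theta>) = poly U (\<tau> \<theta>) - poly U (\<tau> s)" by simp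
    also have "\<dots> \<in> J" using insert \<theta> by (intro ideal_diff[OF I]) auto
    finally have "(\<tau> \<theta> - \<tau> s) * poly U' (\<tau> \<theta>) \<in> J" .
    moreover have "\<theta> \<in> \<Theta>" "s \<in> \<Theta>" "\<theta> \<noteq> s" using insert \<theta> by auto
    ultimately show "poly U' (\<tau> \<theta>) \<in> J" using J unfolding good_def by blast
  qed
  moreover have "poly U (\<tau> s) \<in> J" using insert by auto
  ultimately have "[:- \<tau> s, 1:] * U' + [:poly U (\<tau> s):] \<in> polys_over J"
    by (auto simp: polys_over_def coeff_pCons split: nat.splits
        intro!: ideal_add[OF I] ideal_mult[OF I] ideal_uminus[OF I] ideal_diff[OF I])
  then show ?case using split by simp
qed

end

section \<open>Separable members of a pencil, and points where a polynomial does not vanish\<close>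

lemma card_roots_separable:
  fixes p :: "'c::alg_closed_field poly"
  assumes "p \<noteq> 0" "\<And>x. poly p x = 0 \<Longrightarrow> poly (pderiv p) x \<noteq> 0"
  shows "card {x. poly p x = 0} = degree p"
  using assms
proof (induction "degree p" arbitrary: p)
  case 0
  then obtain c where "p = [:c:]" by (metis degree_0_id degree_eq_zeroE)
  with 0 show ?case by auto
next
  case (Suc d)
  then obtain x where x: "poly p x = 0" using alg_closed_imp_poly_has_root[of p] by auto
  then obtain q where q: "p = [:-x, 1:] * q" by (metis dvdE poly_eq_0_iff_dvd)
  have q0: "q \<noteq> 0" using Suc q by auto
  have dq: "degree q = d" using Suc(2) q0 unfolding q by (subst (asm) degree_mult_eq) auto
  have pd: "pderiv p = [:-x, 1:] * pderiv q + q" unfolding q pderiv_mult by (simp add: pderiv_pCons)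
  have nx: "poly q x \<noteq> 0" using Suc(4)[OF x] pd by simp
  have "card {y. poly q y = 0} = degree q"
  proof (rule Suc(1)[OF _ q0])
    show "d = degree q" using dq by simp
    fix y assume y: "poly q y = 0"
    then have "poly p y = 0" by (simp add: q)
    then have "poly (pderiv p) y \<noteq> 0" by (rule Suc(4))
    with y show "poly (pderiv q) y \<noteq> 0" by (auto simp: pd)
  qed
  moreover have "{y. poly p y = 0} = insert x {y. poly q y = 0}" by (auto simp: q)
  moreover have "finite {y. poly q y = 0}" by (rule poly_roots_finite[OF q0])
  ultimately show ?case using nx dq Suc(2) by simp
qed

text \<open>Euclid's argument: the product of all \<open>X - c\<close>, increased by
  \<open>1\<close>, would have no root.\<close>

lemma infinite_UNIV_alg_closed: "infinite (UNIV :: 'c::alg_closed_field set)"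
proof
  assume fin: "finite (UNIV :: 'c set)"
  define p :: "'c poly" where "p = (\<Prod>c\<in>UNIV. [:- c, 1:]) + 1"
  have "degree (\<Prod>c\<in>UNIV. [:- c, 1:] :: 'c poly) = card (UNIV :: 'c set)"
    by (subst degree_prod_eq_sum_degree) auto
  moreover have "card (UNIV :: 'c set) > 0" using fin by (simp add: card_gt_0_iff)
  ultimately have "degree p > 0" unfolding p_def by (subst degree_add_eq_left) auto
  then obtain x where "poly p x = 0" using alg_closed_imp_poly_has_root by blast
  moreover have "poly p x = 1"
    using fin by (auto simp: p_def poly_prod prod_zero_iff)
  ultimately show False by simp
qed

text \<open>A double root of \<open>h - c + s u\<close> is a zero of the Wronskian \<open>wr\<close>
  of \<open>h - c\<close> and \<open>u\<close>, and each zero serves at most one \<open>s\<close>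
  since \<open>h - c\<close> is separable. If \<open>wr\<close> is identically zero, then
  \<open>u\<close> vanishes at all \<open>degree h\<close> roots of \<open>h - c\<close>, so
  \<open>u = 0\<close> and the pencil is constant.\<close>

lemma finite_singular_members:
  fixes h u :: "'c::alg_closed_field poly"
  assumes sep: "\<And>x. poly h x = c \<Longrightarrow> poly (pderiv h) x \<noteq> 0" and deg: "degree u < degree h"
  shows "finite {s. \<exists>x. poly (h + smult s u) x = c \<and> poly (pderiv (h + smult s u)) x = 0}"
proof -
  define wr where "wr = (h - [:c:]) * pderiv u - pderiv h * u"
  define B where "B x = {s. poly (h + smult s u) x = c \<and> poly (pderiv (h + smult s u)) x = 0}" for x
  have B: "poly wr x = 0" if "s \<in> B x" for s x
  proof -
    from that have "poly h x - c = - (s * poly u x)" "poly (pderiv h) x = - (s * poly (pderiv u) x)"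
      by (auto simp: B_def pderiv_add pderiv_smult algebra_simps eq_neg_iff_add_eq_0)
    then show ?thesis by (simp add: wr_def)
  qed
  have fin: "finite (B x)" for x
  proof (cases "B x = {}")
    case False
    then obtain s0 where s0: "s0 \<in> B x" by auto
    have "s = s0" if "s \<in> B x" for s
    proof -
      have "(s - s0) * poly u x = 0" "(s - s0) * poly (pderiv u) x = 0"
        using that s0 by (auto simp: B_def pderiv_add pderiv_smult algebra_simps add_eq_0_iff)
      moreover have "poly u x \<noteq> 0 \<or> poly (pderiv u) x \<noteq> 0"
        using s0 sep[of x] by (auto simp: B_def pderiv_add pderiv_smult)
      ultimately show ?thesis by auto
    qed
    then have "B x \<subseteq> {s0}" by auto
    then show ?thesis by (rule finite_subset) simp
  qed simp
  have eq: "{s. \<exists>x. poly (h + smult s u) x = c \<and> poly (pderiv (h + smult s u)) x = 0} = (\<Union>x. B x)"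
    by (auto simp: B_def)
  show ?thesis
  proof (cases "wr = 0")
    case False
    have "(\<Union>x. B x) \<subseteq> (\<Union>x\<in>{x. poly wr x = 0}. B x)" using B by auto
    then show ?thesis unfolding eq by (rule finite_subset) (use poly_roots_finite[OF False] fin in auto)
  next
    case True
    have hd: "degree (h - [:c:]) = degree h"
      using deg by (subst diff_conv_add_uminus, subst degree_add_eq_left) auto
    have hc: "h - [:c:] \<noteq> 0" using hd deg by auto
    have cd: "card {x. poly (h - [:c:]) x = 0} = degree h"
      unfolding hd[symmetric] using sep by (intro card_roots_separable hc) (auto simp: pderiv_diff pderiv_pCons)
    have sub: "{x. poly (h - [:c:]) x = 0} \<subseteq> {x. poly u x = 0}"
    proof
      fix x assume x: "x \<in> {x. poly (h - [:c:]) x = 0}"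
      have "poly wr x = 0" using True by simp
      then show "x \<in> {x. poly u x = 0}" using x sep[of x] by (auto simp: wr_def)
    qed
    have "u = 0"
    proof (rule ccontr)
      assume nz: "u \<noteq> 0"
      have "degree h \<le> card {x. poly u x = 0}"
        unfolding cd[symmetric] by (rule card_mono[OF poly_roots_finite[OF nz] sub])
      also have "\<dots> \<le> degree u" by (rule card_poly_roots_bound[OF nz])
      finally show False using deg by simp
    qed
    then have False if "poly (h + smult s u) x = c" "poly (pderiv (h + smult s u)) x = 0" for s x
      using that sep[of x] by simp
    then have "{s. \<exists>x. poly (h + smult s u) x = c \<and> poly (pderiv (h + smult s u)) x = 0} = {}" by blast
    then show ?thesis by (simp only: finite.emptyI)
  qed
qed

lemma mpoly_nonvanishing_point:
  fixes p :: "'c::idom mpoly"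
  assumes inf: "infinite (UNIV :: 'c set)" and "p \<in> mpolys n" "p \<noteq> 0"
  shows "\<exists>x. ev (\<lambda>c. c) x p \<noteq> 0"
  using assms(2-)
proof (induction n arbitrary: p)
  case 0
  then have "p \<in> subalg Const {}" by (simp add: mpolys_eq_subalg)
  then have "\<exists>c. p = Const c"
    by (induction rule: subalg.induct)
       (auto, metis hom_add[OF is_hom_Const], metis hom_mult[OF is_hom_Const])
  then obtain c where "p = Const c" by blast
  then show ?case using 0 by (auto simp: ev_Const is_hom_id hom_zero[OF is_hom_Const])
next
  case (Suc n)
  have "p \<in> subalg Const (insert (Var (Suc n)) (Var ` {1..n}))"
    using Suc.prems by (simp add: mpolys_eq_subalg atLeastAtMostSuc_conv)
  from subalg_insert[OF is_hom_Const this] obtain P where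
    P: "P \<in> polys_over (mpolys n)" "p = poly P (Var (Suc n))"
    unfolding mpolys_eq_subalg by blast
  have "P \<noteq> 0" using P Suc.prems by auto
  then obtain i where i: "poly.coeff P i \<noteq> 0" by (meson leading_coeff_0_iff)
  have Pi: "poly.coeff P i \<in> mpolys n" for i using P by (simp add: polys_over_def)
  from Suc.IH[OF Pi i] obtain x where x: "ev (\<lambda>c. c) x (poly.coeff P i) \<noteq> 0" by auto
  define Q where "Q = map_poly (ev (\<lambda>c. c) x) P"
  have "poly.coeff Q i \<noteq> 0" using x by (simp add: Q_def coeff_map_hom[OF is_hom_ev[OF is_hom_id]])
  then have "Q \<noteq> 0" by auto
  then have "finite {y. poly Q y = 0}" by (rule poly_roots_finite)
  then obtain y where y: "poly Q y \<noteq> 0" using inf by (metis (mono_tags) UNIV_eq_I mem_Collect_eq)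
  define x' where "x' = x(Suc n := y)"
  have "map_poly (ev (\<lambda>c. c) x') P = Q"
    unfolding Q_def by (intro poly_eqI) (auto simp: coeff_map_hom[OF is_hom_ev[OF is_hom_id]] x'_def intro!: ev_cong[OF Pi])
  then have "ev (\<lambda>c. c) x' p = poly Q (x' (Suc n))"
    using poly_map_hom[OF is_hom_ev[OF is_hom_id], of x' P "Var (Suc n)"]
    by (simp add: P(2) ev_Var is_hom_id)
  then have "ev (\<lambda>c. c) x' p \<noteq> 0" using y by (simp add: x'_def)
  then show ?case by (intro exI[of _ x'])
qed

text \<open>The restriction to the line is a polynomial in \<open>s\<close>, nonzero at
  \<open>s = 1\<close>, which is the point \<open>b\<close>.\<close>

lemma mpoly_line_nonvanishing:
  fixes p :: "'c::idom mpoly"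
  assumes "ev (\<lambda>c. c) b p \<noteq> 0"
  shows "finite {s. ev (\<lambda>c. c) (\<lambda>j. a j + s * (b j - a j)) p = 0}"
proof -
  have hC: "is_hom (\<lambda>c::'c. [:c:])" by (auto simp: is_hom_def one_pCons)
  define q where "q = ev (\<lambda>c. [:c:]) (\<lambda>j. [:a j, b j - a j:]) p"
  have q: "poly q s = ev (\<lambda>c. c) (\<lambda>j. a j + s * (b j - a j)) p" for s
    unfolding q_def by (subst hom_ev[OF is_hom_poly hC]) simp
  have "poly q 1 \<noteq> 0" using assms by (simp add: q)
  then have "q \<noteq> 0" by auto
  from poly_roots_finite[OF this] show ?thesis by (simp add: q)
qed

text \<open>When the characteristic divides \<open>n\<close> every value of \<open>t ^ n\<close> is critical, hence \<open>eps = 1\<close> in that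
  case.\<close>

lemma one_critical_value:
  fixes t :: "'c::field"
  assumes n: "n > 0" and eps: "eps = (if of_nat n = (0::'c) then 1 else 0)" and "\<not> (n = 2 \<and> of_nat n = (0::'c))"
    and t: "poly ([:0, 1:] ^ (n - 1) * [:- eps, 1:]) t \<noteq> 0"
  shows "poly (pderiv ([:0, 1:] ^ (n - 1) * [:- eps, 1:])) t \<noteq> 0"
proof -
  have t0: "t ^ (n - 1) \<noteq> 0" "t \<noteq> eps" using t by auto
  have d: "poly (pderiv ([:0, 1:] ^ (n - 1) * [:- eps, 1:])) t = t ^ (n - 1) + (t - eps) * (of_nat (n - 1) * t ^ (n - 1 - 1))"
    unfolding pderiv_mult by (simp add: pderiv_power pderiv_pCons algebra_simps)
  show ?thesis
  proof (cases "n = 1")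
    case True
    then show ?thesis by (simp add: pderiv_pCons)
  next
    case False
    have tt: "t ^ (n - 1) = t * t ^ (n - 1 - 1)" using False n by (metis One_nat_def Suc_lessI Suc_pred diff_Suc_1 less_one not_gr_zero power_Suc zero_less_diff)
    have nz: "t ^ (n - 1 - 1) \<noteq> 0" using t0 tt by auto
    have o: "of_nat (n - 1) = (of_nat n - 1 :: 'c)" using n by (simp add: of_nat_diff)
    show ?thesis
    proof (cases "of_nat n = (0::'c)")
      case True
      have "poly (pderiv ([:0, 1:] ^ (n - 1) * [:- eps, 1:])) t = t ^ (n - 1 - 1) * (t - (t - 1))"
        unfolding d tt o using True by (simp add: eps algebra_simps)
      then show ?thesis using nz by simp
    next
      case F: False
      have "poly (pderiv ([:0, 1:] ^ (n - 1) * [:- eps, 1:])) t = t ^ (n - 1) * of_nat n"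
        unfolding d o using F tt by (simp add: eps algebra_simps)
      then show ?thesis using t0 F by simp
    qed
  qed
qed

subsection \<open>Power series\<close>

definition fps_map :: "('a::comm_ring_1 \<Rightarrow> 'b::comm_ring_1) \<Rightarrow> 'a fps \<Rightarrow> 'b fps" where
  "fps_map h f = Abs_fps (\<lambda>i. h (fps_nth f i))"

lemma is_hom_fps_map: "is_hom h \<Longrightarrow> is_hom (fps_map h)"
  by (rule is_homI) (auto intro!: fps_ext simp: fps_map_def hom_simps fps_mult_nth)

lemma fps_map_const: "is_hom h \<Longrightarrow> fps_map h (fps_const c) = fps_const (h c)"
  by (rule fps_ext) (auto simp: fps_map_def hom_zero)

lemma fps_map_X: "is_hom h \<Longrightarrow> fps_map h fps_X = fps_X"
  by (rule fps_ext) (auto simp: fps_map_def hom_zero hom_one)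

lemma is_hom_fps_const: "is_hom fps_const"
  by (rule is_homI) auto

lemma is_hom_fps_nth_0: "is_hom (\<lambda>f::'a::comm_ring_1 fps. fps_nth f 0)"
  by (rule is_homI) auto

lemma poly_diff_dvd: "(x - y :: 'a::comm_ring_1) dvd poly p x - poly p y"
proof (induction p)
  case (pCons c p)
  have "poly (pCons c p) x - poly (pCons c p) y = x * (poly p x - poly p y) + (x - y) * poly p y"
    by (simp add: algebra_simps)
  then show ?case using pCons by (metis dvd_add dvd_mult dvd_triv_left)
qed simp

lemma poly_taylor_2: "\<exists>r. poly p (x + d) = poly p x + d * poly (pderiv p) x + d ^ 2 * (r :: 'a::idom)"
proof (induction p)
  case (pCons c p)
  then obtain r where r: "poly p (x + d) = poly p x + d * poly (pderiv p) x + d ^ 2 * r" by auto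
  have "poly (pCons c p) (x + d) = poly (pCons c p) x + d * poly (pderiv (pCons c p)) x
      + d ^ 2 * (poly (pderiv p) x + x * r + d * r)"
    unfolding poly_pCons r by (simp add: pderiv_pCons algebra_simps power2_eq_square)
  then show ?case by blast
qed simp

lemma fps_X_power_dvd_nth_eq:
  fixes f g :: "'a::comm_ring_1 fps"
  assumes "fps_X ^ k dvd f - g" "i < k"
  shows "fps_nth f i = fps_nth g i"
proof -
  from assms obtain h where "f - g = fps_X ^ k * h" by auto
  then have "fps_nth (f - g) i = 0" using assms(2) by (simp add: fps_X_power_mult_nth)
  then show ?thesis by simp
qed

lemma fps_X_power_dvdI:
  fixes f :: "'a::comm_ring_1 fps"
  assumes "\<And>i. i < k \<Longrightarrow> fps_nth f i = 0"
  shows "fps_X ^ k dvd f"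
proof
  show "f = fps_X ^ k * Abs_fps (\<lambda>i. fps_nth f (i + k))"
    by (rule fps_ext) (use assms in \<open>auto simp: fps_X_power_mult_nth\<close>)
qed

text \<open>Newton's iteration with the inverse \<open>c\<close> of the derivative modulo
  \<open>fps_X\<close> kept fixed. Each step gains only one power of \<open>fps_X\<close>, but
  nothing besides that residue is inverted, so the coefficients may form a domain such as a
  polynomial ring.\<close>

lemma hensel_root:
  fixes F :: "'a::idom fps poly"
  assumes root: "poly (map_poly (\<lambda>f. fps_nth f 0) F) z = 0"
    and unit: "c * poly (pderiv (map_poly (\<lambda>f. fps_nth f 0) F)) z = 1"
  shows "\<exists>y. poly F y = 0 \<and> fps_nth y 0 = z"
proof -
  note h0 = is_hom_fps_nth_0
  have pd: "map_poly (\<lambda>f. fps_nth f 0) (pderiv F) = pderiv (map_poly (\<lambda>f. fps_nth f 0) F)"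
    by (rule poly_eqI) (simp add: coeff_map_hom[OF h0] coeff_pderiv)
  define step where "step y = y - fps_const c * poly F y" for y
  define Y where "Y k = (step ^^ k) (fps_const z)" for k
  have Y0: "Y 0 = fps_const z" and YS: "Y (Suc k) = step (Y k)" for k by (simp_all add: Y_def)
  have inv: "fps_nth (Y k) 0 = z \<and> fps_X ^ Suc k dvd poly F (Y k)" for k
  proof (induction k)
    case 0
    have "fps_nth (poly F (fps_const z)) 0 = 0"
      using root poly_map_hom[OF h0, of F "fps_const z"] by simp
    then show ?case using fps_X_power_dvdI[of 1 "poly F (fps_const z)"] by (simp add: Y0)
  next
    case (Suc k)
    define y where "y = Y k"
    from Suc have y: "fps_nth y 0 = z" "fps_X ^ Suc k dvd poly F y" by (auto simp: y_def)
    have "fps_nth (poly F y) 0 = 0"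
      using root poly_map_hom[OF h0, of F y] y by simp
    then have c1: "fps_nth (step y) 0 = z" by (simp add: step_def y)
    obtain r where r: "poly F (step y) = poly F y + (- fps_const c * poly F y) * poly (pderiv F) y
        + (- fps_const c * poly F y) ^ 2 * r"
      using poly_taylor_2[of F y "- fps_const c * poly F y"]
      unfolding step_def diff_conv_add_uminus mult_minus_left by blast
    \<comment> \<open>The new error is the old one times a factor with constant term
      \<open>0\<close>: the derivative contributes \<open>1\<close> minus a product equal to
      \<open>1\<close>, and the last summand contains the old error.\<close>
    have r': "poly F (step y) = poly F y * ((1 - fps_const c * poly (pderiv F) y) + fps_const c ^ 2 * r * poly F y)"
    proof -
      define k where "k = fps_const c"
      show ?thesis unfolding r k_def[symmetric] by (simp add: algebra_simps power2_eq_square)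
    qed
    have "fps_nth (poly (pderiv F) y) 0 = poly (pderiv (map_poly (\<lambda>f. fps_nth f 0) F)) z"
      using poly_map_hom[OF h0, of "pderiv F" y] y pd by simp
    then have "fps_nth ((1 - fps_const c * poly (pderiv F) y) + fps_const c ^ 2 * r * poly F y) 0 = 0"
      using unit \<open>fps_nth (poly F y) 0 = 0\<close> by simp
    then have "fps_X ^ 1 dvd ((1 - fps_const c * poly (pderiv F) y) + fps_const c ^ 2 * r * poly F y)"
      by (intro fps_X_power_dvdI) simp
    then have "fps_X ^ Suc k * fps_X ^ 1 dvd poly F (step y)"
      unfolding r' using y(2) by (intro mult_dvd_mono)
    then show ?case using c1 by (simp add: YS y_def mult.commute)
  qed
  have near: "fps_X ^ Suc k dvd Y (Suc k) - Y k" for k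
  proof -
    have "fps_X ^ Suc k dvd poly F (Y k)" using inv[of k] by auto
    then have "fps_X ^ Suc k dvd - (fps_const c * poly F (Y k))" by (simp del: power_Suc)
    then show ?thesis by (simp add: YS step_def del: power_Suc)
  qed
  have stable: "fps_nth (Y (k + m)) k = fps_nth (Y k) k" for k m
  proof (induction m)
    case (Suc m)
    have "fps_nth (Y (Suc (k + m))) k = fps_nth (Y (k + m)) k"
      by (rule fps_X_power_dvd_nth_eq[OF near]) simp
    then show ?case using Suc by simp
  qed simp
  \<comment> \<open>The diagonal limit: the coefficient of index \<open>i\<close> no longer changes
    from \<open>Y i\<close> on.\<close>
  define y where "y = Abs_fps (\<lambda>i. fps_nth (Y i) i)"
  have yY: "fps_X ^ Suc k dvd y - Y k" for k
  proof (rule fps_X_power_dvdI)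
    fix i assume "i < Suc k"
    then show "fps_nth (y - Y k) i = 0" using stable[of i "k - i"] by (simp add: y_def)
  qed
  have "poly F y = 0"
  proof (rule fps_ext)
    fix k
    have "fps_X ^ Suc k dvd poly F y - poly F (Y k)"
      using yY[of k] poly_diff_dvd[of y "Y k" F] dvd_trans by blast
    then have "fps_X ^ Suc k dvd (poly F y - poly F (Y k)) + poly F (Y k)"
      using inv[of k] by (intro dvd_add) auto
    then have "fps_X ^ Suc k dvd poly F y - 0" by (simp del: power_Suc)
    from fps_X_power_dvd_nth_eq[OF this, of k] show "fps_nth (poly F y) k = fps_nth 0 k" by simp
  qed
  moreover have "fps_nth y 0 = z" by (simp add: y_def Y0)
  ultimately show ?thesis by blast
qed

text \<open>The Taylor formula for two roots gives \<open>d * g = 0\<close> with \<open>g\<close> of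
  constant term \<open>1\<close>. Uniqueness forces a coefficientwise endomorphism preserving
  \<open>F\<close> and the residue \<open>z\<close> to fix the lifted root.\<close>

lemma hensel_root_unique:
  fixes F :: "'a::idom fps poly"
  assumes unit: "c * poly (pderiv (map_poly (\<lambda>f. fps_nth f 0) F)) z = 1"
    and y: "poly F y = 0" "fps_nth y 0 = z" and y': "poly F y' = 0" "fps_nth y' 0 = z"
  shows "y = y'"
proof -
  note h0 = is_hom_fps_nth_0
  have pd: "map_poly (\<lambda>f. fps_nth f 0) (pderiv F) = pderiv (map_poly (\<lambda>f. fps_nth f 0) F)"
    by (rule poly_eqI) (simp add: coeff_map_hom[OF h0] coeff_pderiv)
  define d where "d = y' - y"
  obtain r where "poly F (y + d) = poly F y + d * poly (pderiv F) y + d ^ 2 * r"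
    using poly_taylor_2 by blast
  then have "d * (poly (pderiv F) y + d * r) = 0"
    using y y' by (simp add: d_def algebra_simps power2_eq_square)
  moreover have "fps_nth (poly (pderiv F) y) 0 = poly (pderiv (map_poly (\<lambda>f. fps_nth f 0) F)) z"
    using poly_map_hom[OF h0, of "pderiv F" y] y pd by simp
  moreover define g where "g = fps_const c * (poly (pderiv F) y + d * r)"
  ultimately have dg: "d * g = 0" and g0: "fps_nth g 0 = 1"
    using unit y y' by (auto simp: d_def mult.left_commute)
  from g0 have "g \<noteq> 0" by auto
  with dg have "d = 0" by simp
  then show ?thesis by (simp add: d_def)
qed

lemma poly_eq_sum_lessThan:
  fixes p :: "'a::comm_ring_1 poly"
  assumes "\<And>i. i \<ge> k \<Longrightarrow> poly.coeff p i = 0"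
  shows "poly p x = (\<Sum>i<k. poly.coeff p i * x ^ i)"
proof (cases "p = 0")
  case False
  have "degree p < k"
    using assms[of "degree p"] False by (metis leading_coeff_0_iff not_le)
  then show ?thesis
    unfolding poly_altdef by (intro sum.mono_neutral_left) (auto simp: coeff_eq_0)
qed simp

lemma subalg_image_ev:
  assumes "x \<in> subalg Const (s ` {1..n})"
  shows "\<exists>q \<in> mpolys n. x = ev Const s (q :: 'c::comm_ring_1 mpoly)"
  using assms
proof (induction rule: subalg.induct)
  case (const c)
  then show ?case by (intro bexI[of _ "Const c"]) (auto simp: ev_Const is_hom_Const Const_in_mpolys)
next
  case (gen x)
  then obtain i where "i \<in> {1..n}" "x = s i" by auto
  then show ?case by (intro bexI[of _ "Var i"]) (auto simp: ev_Var is_hom_Const intro!: Var_in_mpolys)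
next
  case (add x y)
  then obtain p q where "p \<in> mpolys n" "q \<in> mpolys n" "x = ev Const s p" "y = ev Const s q" by blast
  then show ?case
    by (intro bexI[of _ "p + q"]) (auto simp: hom_add[OF is_hom_ev[OF is_hom_Const]] subring_add[OF is_subring_mpolys])
next
  case (mult x y)
  then obtain p q where "p \<in> mpolys n" "q \<in> mpolys n" "x = ev Const s p" "y = ev Const s q" by blast
  then show ?case
    by (intro bexI[of _ "p * q"]) (auto simp: hom_mult[OF is_hom_ev[OF is_hom_Const]] subring_mult[OF is_subring_mpolys])
qed

lemma Const_eq_iff: "Const c = Const d \<longleftrightarrow> c = d"
  unfolding Const_def by (metis lookup_single_eq)

lemma Var_eq_iff: "(Var i :: 'c::comm_ring_1 mpoly) = Var j \<longleftrightarrow> i = j"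
proof
  assume "(Var i :: 'c mpoly) = Var j"
  then have "Poly_Mapping.keys (Var i :: 'c mpoly) = Poly_Mapping.keys (Var j :: 'c mpoly)" by simp
  then have "Poly_Mapping.keys (Poly_Mapping.single i (1::nat)) = Poly_Mapping.keys (Poly_Mapping.single j (1::nat))"
    by (simp add: Var_def)
  then show "i = j" by simp
qed simp

lemma is_hom_fps_of_poly: "is_hom (fps_of_poly :: 'a::comm_ring_1 poly \<Rightarrow> _)"
  by (rule is_homI) (auto simp: fps_of_poly_add fps_of_poly_mult)

subsection \<open>Solutions with prescribed values\<close>

text \<open>The geometric side only; the field of definition enters in \<open>K_cover\<close>. The
  last assumption is the form in which the parity hypothesis on \<open>n\<close> is used.\<close>

locale cover =
  fixes \<Theta> :: "'c::alg_closed_field set" and w :: "'c \<Rightarrow> 'c" and n :: nat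
  assumes fin: "finite \<Theta>" and n0: "n > 0"
    and fibres: "\<And>\<theta>. \<theta> \<in> \<Theta> \<Longrightarrow> card {\<eta> \<in> \<Theta>. w \<eta> = w \<theta>} = n"
    and char2: "\<not> (n = 2 \<and> of_nat n = (0::'c))"
begin

definition N :: nat where "N = card \<Theta>"

text \<open>The Lagrange basis for the nodes \<open>\<Theta>\<close>.\<close>

definition lag :: "'c \<Rightarrow> 'c poly" where
  "lag \<theta> = (\<Prod>\<eta>\<in>\<Theta> - {\<theta>}. smult (inverse (\<theta> - \<eta>)) [:- \<eta>, 1:])"

lemma poly_lag: "\<theta> \<in> \<Theta> \<Longrightarrow> \<eta> \<in> \<Theta> \<Longrightarrow> poly (lag \<theta>) \<eta> = (if \<theta> = \<eta> then 1 else 0)"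
proof -
  assume \<theta>: "\<theta> \<in> \<Theta>" and \<eta>: "\<eta> \<in> \<Theta>"
  have eq: "poly (lag \<theta>) \<eta> = (\<Prod>\<zeta>\<in>\<Theta> - {\<theta>}. inverse (\<theta> - \<zeta>) * (\<eta> - \<zeta>))"
    by (simp add: lag_def poly_prod algebra_simps)
  show ?thesis
  proof (cases "\<theta> = \<eta>")
    case True
    then show ?thesis unfolding eq by (auto intro!: prod.neutral left_inverse)
  next
    case False
    have "(\<Prod>\<zeta>\<in>\<Theta> - {\<theta>}. inverse (\<theta> - \<zeta>) * (\<eta> - \<zeta>)) = 0"
      using False \<eta> fin by (intro prod_zero) auto
    then show ?thesis using False by (simp add: eq)
  qed
qed

lemma coeff_lag: "\<theta> \<in> \<Theta> \<Longrightarrow> i \<ge> N \<Longrightarrow> poly.coeff (lag \<theta>) i = 0"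
proof (rule coeff_eq_0)
  assume "\<theta> \<in> \<Theta>" "i \<ge> N"
  have "degree (lag \<theta>) \<le> (\<Sum>\<eta>\<in>\<Theta> - {\<theta>}. degree (smult (inverse (\<theta> - \<eta>)) [:- \<eta>, 1:]))"
    unfolding lag_def using degree_prod_sum_le[of "\<Theta> - {\<theta>}" "\<lambda>\<eta>. smult (inverse (\<theta> - \<eta>)) [:- \<eta>, 1:]"] fin
    by (simp add: o_def)
  also have "\<dots> \<le> (\<Sum>\<eta>\<in>\<Theta> - {\<theta>}. 1)"
    by (intro sum_mono) (auto intro: order.trans[OF degree_smult_le])
  also have "\<dots> = N - 1" using fin \<open>\<theta> \<in> \<Theta>\<close> by (simp add: N_def)
  also have "\<dots> < i"
  proof -
    have "N > 0" using \<open>\<theta> \<in> \<Theta>\<close> fin by (auto simp: N_def card_gt_0_iff)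
    then show ?thesis using \<open>i \<ge> N\<close> by simp
  qed
  finally show "degree (lag \<theta>) < i" .
qed

text \<open>The Lagrange coefficients invert the Vandermonde matrix, because interpolating the
  values of a monomial of degree below \<open>N\<close> returns that monomial.\<close>

lemma lag_dual:
  assumes "s < N" "s' < N"
  shows "(\<Sum>\<theta>\<in>\<Theta>. poly.coeff (lag \<theta>) s * \<theta> ^ s') = (if s = s' then 1 else 0)"
proof -
  define q where "q = (\<Sum>\<theta>\<in>\<Theta>. smult (\<theta> ^ s') (lag \<theta>)) - Polynomial.monom 1 s'"
  have "q = 0"
  proof (rule ccontr)
    assume nz: "q \<noteq> 0"
    have "poly.coeff q i = 0" if "i \<ge> N" for i
      using that assms by (auto simp: q_def coeff_sum coeff_lag intro!: sum.neutral)
    then have "degree q < N" using nz by (metis leading_coeff_0_iff not_le)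
    moreover have "\<Theta> \<subseteq> {x. poly q x = 0}"
    proof
      fix \<eta> assume \<eta>: "\<eta> \<in> \<Theta>"
      have "(\<Sum>\<theta>\<in>\<Theta>. \<theta> ^ s' * poly (lag \<theta>) \<eta>) = (\<Sum>\<theta>\<in>\<Theta>. if \<theta> = \<eta> then \<theta> ^ s' else 0)"
        using \<eta> by (intro sum.cong) (auto simp: poly_lag)
      then show "\<eta> \<in> {x. poly q x = 0}"
        using fin \<eta> by (simp add: q_def poly_sum poly_monom)
    qed
    then have "N \<le> degree q"
      unfolding N_def using card_mono[OF poly_roots_finite[OF nz]] card_poly_roots_bound[OF nz] order.trans by blast
    ultimately show False by simp
  qed
  then have "poly.coeff q s = 0" by simp
  then show ?thesis by (simp add: q_def coeff_sum mult.commute split: if_splits)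
qed

text \<open>The coordinates \<open>n + 1, \<dots>, n + N\<close> are the coefficients of the interpolation polynomial of the
  root vector \<open>t\<close>.\<close>

definition pt :: "('c \<Rightarrow> 'b::comm_ring_1) \<Rightarrow> (nat \<Rightarrow> 'b) \<Rightarrow> ('c \<Rightarrow> 'b) \<Rightarrow> nat \<Rightarrow> 'b" where
  "pt \<iota> a t i = (if i \<in> {1..n} then a i else if i \<in> {n+1..n+N}
     then \<Sum>\<theta>\<in>\<Theta>. \<iota> (poly.coeff (lag \<theta>) (i - n - 1)) * t \<theta> else 0)"

text \<open>The value at \<open>\<theta>\<close> of the polynomial of degree below \<open>N\<close>
  with indeterminate coefficients. Coefficients and not roots serve as coordinates, because those
  can be rational over K while roots are moved by Galois conjugation.\<close>

definition tau :: "'c \<Rightarrow> 'c mpoly" where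
  "tau \<theta> = (\<Sum>s<N. Const (\<theta> ^ s) * Var (n + 1 + s))"

definition pnt :: "('c \<Rightarrow> 'b::comm_ring_1) \<Rightarrow> (nat \<Rightarrow> 'b) \<Rightarrow> ('c \<Rightarrow> 'b) \<Rightarrow> 'c mpoly \<Rightarrow> 'b" where
  "pnt \<iota> a t = ev \<iota> (pt \<iota> a t)"

lemma is_hom_pnt: "is_hom \<iota> \<Longrightarrow> is_hom (pnt \<iota> a t)"
  unfolding pnt_def by (rule is_hom_ev)

lemma pnt_Const: "is_hom \<iota> \<Longrightarrow> pnt \<iota> a t (Const c) = \<iota> c"
  by (simp add: pnt_def ev_Const)

lemma pnt_Var: "is_hom \<iota> \<Longrightarrow> j \<in> {1..n} \<Longrightarrow> pnt \<iota> a t (Var j) = a j"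
  by (simp add: pnt_def ev_Var pt_def)

lemma pnt_tau:
  assumes h: "is_hom \<iota>" and \<theta>: "\<theta> \<in> \<Theta>"
  shows "pnt \<iota> a t (tau \<theta>) = t \<theta>"
proof -
  have "pnt \<iota> a t (tau \<theta>) = (\<Sum>s<N. \<iota> (\<theta> ^ s) * (\<Sum>\<eta>\<in>\<Theta>. \<iota> (poly.coeff (lag \<eta>) s) * t \<eta>))"
    unfolding pnt_def tau_def
    by (simp add: hom_sum[OF is_hom_ev[OF h]] hom_mult[OF is_hom_ev[OF h]] ev_Const[OF h] ev_Var[OF h] pt_def)
  also have "\<dots> = (\<Sum>\<eta>\<in>\<Theta>. \<iota> (\<Sum>s<N. poly.coeff (lag \<eta>) s * \<theta> ^ s) * t \<eta>)"
    unfolding sum_distrib_left hom_sum[OF h] hom_mult[OF h] sum_distrib_right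
    by (subst sum.swap) (simp add: mult_ac)
  also have "\<dots> = (\<Sum>\<eta>\<in>\<Theta>. if \<eta> = \<theta> then t \<eta> else 0)"
    using \<theta> by (intro sum.cong) (auto simp: coeff_lag hom_zero[OF h] hom_one[OF h] poly_lag simp flip: poly_eq_sum_lessThan)
  also have "\<dots> = t \<theta>" using \<theta> fin by simp
  finally show ?thesis .
qed

sublocale fibred Const "Var :: nat \<Rightarrow> 'c mpoly" tau w \<Theta> n
  by unfold_locales (use is_hom_Const n0 fin fibres in auto)

lemma Var_eq_tau:
  assumes s: "s < N"
  shows "Var (n + 1 + s) = (\<Sum>\<theta>\<in>\<Theta>. Const (poly.coeff (lag \<theta>) s) * tau \<theta>)"
proof -
  have "(\<Sum>\<theta>\<in>\<Theta>. Const (poly.coeff (lag \<theta>) s) * tau \<theta>)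
    = (\<Sum>s'<N. Const (\<Sum>\<theta>\<in>\<Theta>. poly.coeff (lag \<theta>) s * \<theta> ^ s') * Var (n + 1 + s'))"
    unfolding tau_def sum_distrib_left hom_sum[OF is_hom_Const] hom_mult[OF is_hom_Const] sum_distrib_right
    by (subst sum.swap) (simp add: mult_ac)
  also have "\<dots> = (\<Sum>s'<N. if s' = s then Var (n + 1 + s') else 0)"
    using s by (intro sum.cong) (auto simp: lag_dual hom_zero[OF is_hom_Const] hom_one[OF is_hom_Const])
  finally show ?thesis using s by simp
qed

lemma tau_in_mpolys: "tau \<theta> \<in> mpolys (n + N)"
  unfolding tau_def
  by (intro subring_sum[OF is_subring_mpolys] subring_mult[OF is_subring_mpolys] Const_in_mpolys Var_in_mpolys) auto

text \<open>Coordinates and roots differ by an invertible linear change over the closure. The former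
  are adapted to K, the latter to permutations.\<close>

lemma mpolys_eq_alg: "mpolys (n + N) = alg \<Theta>"
proof
  have "Var i \<in> alg \<Theta>" if i: "i \<in> {1..n+N}" for i
  proof (cases "i \<le> n")
    case False
    define s where "s = i - n - 1"
    have s: "s < N" "i = n + 1 + s" using i False by (auto simp: s_def)
    show ?thesis unfolding s(2) Var_eq_tau[OF s(1)]
      by (intro subring_sum[OF is_subring_alg] subring_mult[OF is_subring_alg]) (auto intro: subalg.intros)
  qed (use i in \<open>auto intro: subalg.gen\<close>)
  then show "mpolys (n + N) \<subseteq> alg \<Theta>"
    unfolding mpolys_eq_subalg by (intro subsetI, elim subalg_subset[rotated]) auto
  have "(Var j :: 'c mpoly) \<in> mpolys (n + N)" if "j \<in> {1..n}" for j using that by (intro Var_in_mpolys) auto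
  then show "alg \<Theta> \<subseteq> mpolys (n + N)"
    using tau_in_mpolys unfolding mpolys_eq_subalg by (intro subsetI, elim subalg_subset[rotated]) (auto simp del: One_nat_def)
qed

definition solves :: "('c \<Rightarrow> 'd::comm_ring_1) \<Rightarrow> (nat \<Rightarrow> 'd) \<Rightarrow> ('c \<Rightarrow> 'd) \<Rightarrow> bool" where
  "solves \<iota> a t \<longleftrightarrow> (\<forall>\<theta>\<in>\<Theta>. poly (gmon n a) (t \<theta>) = \<iota> (w \<theta>)) \<and> inj_on t \<Theta>"

lemma pnt_gmon:
  assumes h: "is_hom \<iota>" and \<theta>: "\<theta> \<in> \<Theta>"
  shows "pnt \<iota> a t (poly (gmon n Var) (tau \<theta>)) = poly (gmon n a) (t \<theta>)"
proof -
  have "pnt \<iota> a t (poly (gmon n Var) (tau \<theta>)) = poly (gmon n (\<lambda>j. pnt \<iota> a t (Var j))) (t \<theta>)"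
    by (simp add: pnt_tau[OF h \<theta>] map_poly_gmon[OF is_hom_pnt[OF h]] flip: poly_map_hom[OF is_hom_pnt[OF h]])
  also have "gmon n (\<lambda>j. pnt \<iota> a t (Var j)) = gmon n a"
    by (rule gmon_cong) (simp add: pnt_Var[OF h])
  finally show ?thesis .
qed

lemma good_kernel_pnt:
  fixes \<iota> :: "'c \<Rightarrow> 'd::idom"
  assumes h: "is_hom \<iota>" and s: "solves \<iota> a t"
  shows "good {x. pnt \<iota> a t x = 0}"
  unfolding good_def
proof (intro conjI ballI impI allI)
  show "is_ideal {x. pnt \<iota> a t x = 0}" by (rule is_ideal_kernel[OF is_hom_pnt[OF h]])
next
  fix \<theta> assume "\<theta> \<in> \<Theta>"
  then show "poly (gmon n Var) (tau \<theta>) - Const (w \<theta>) \<in> {x. pnt \<iota> a t x = 0}"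
    using s by (simp add: hom_diff[OF is_hom_pnt[OF h]] pnt_gmon[OF h] pnt_Const[OF h] solves_def)
next
  fix \<theta> \<eta> p assume "\<theta> \<in> \<Theta>" "\<eta> \<in> \<Theta>" "\<theta> \<noteq> \<eta>" "(tau \<theta> - tau \<eta>) * p \<in> {x. pnt \<iota> a t x = 0}"
  then have "(t \<theta> - t \<eta>) * pnt \<iota> a t p = 0"
    by (simp add: hom_diff[OF is_hom_pnt[OF h]] hom_mult[OF is_hom_pnt[OF h]] pnt_tau[OF h])
  moreover have "t \<theta> \<noteq> t \<eta>" using s \<open>\<theta> \<in> \<Theta>\<close> \<open>\<eta> \<in> \<Theta>\<close> \<open>\<theta> \<noteq> \<eta>\<close> by (auto simp: solves_def inj_on_def)
  ultimately show "p \<in> {x. pnt \<iota> a t x = 0}" by simp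
qed

text \<open>Relabelling the roots is a linear substitution in the coordinates; hence a
  specialisation remains one when both points are relabelled.\<close>

lemma pnt_permute:
  assumes h: "is_hom \<iota>" and \<gamma>: "\<And>\<theta>. \<theta> \<in> \<Theta> \<Longrightarrow> \<gamma> \<theta> \<in> \<Theta>"
  shows "pnt \<iota> a (\<lambda>\<theta>. t (\<gamma> \<theta>)) p = pnt \<iota> a t (pnt Const Var (\<lambda>\<theta>. tau (\<gamma> \<theta>)) p)"
proof -
  have "pnt \<iota> a t (pt Const Var (\<lambda>\<theta>. tau (\<gamma> \<theta>)) i) = pt \<iota> a (\<lambda>\<theta>. t (\<gamma> \<theta>)) i" for i
    by (auto simp: pt_def pnt_Var[OF h] hom_sum[OF is_hom_pnt[OF h]] hom_mult[OF is_hom_pnt[OF h]]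
        hom_zero[OF is_hom_pnt[OF h]] pnt_Const[OF h] pnt_tau[OF h \<gamma>] intro!: sum.cong)
  then show ?thesis unfolding pnt_def[of Const] unfolding pnt_def by (subst ev_subst[OF h]) (simp add: pnt_def)
qed

lemma permuted_in_mpolys: "pnt Const Var (\<lambda>\<theta>. tau (\<gamma> \<theta>)) p \<in> mpolys (n + N)"
proof -
  note S = is_subring_mpolys[of "n + N"]
  have "pt Const Var (\<lambda>\<theta>. tau (\<gamma> \<theta>)) i \<in> (mpolys (n + N) :: 'c mpoly set)" for i
    unfolding pt_def by (auto intro!: subring_intros[OF S] Var_in_mpolys Const_in_mpolys tau_in_mpolys)
  then show ?thesis
    unfolding pnt_def ev_def mono_eval_def by (intro subring_intros[OF S] Const_in_mpolys) auto
qed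

text \<open>No value of \<open>h0\<close> other than \<open>0\<close> is critical. Adding a constant
  \<open>c\<close> moves this exception to \<open>c\<close>, which is chosen outside the finitely
  many values of \<open>w\<close>.\<close>

lemma separable_member:
  "\<exists>a. \<forall>\<omega>\<in>w ` \<Theta>. \<forall>x. poly (gmon n a) x = \<omega> \<longrightarrow> poly (pderiv (gmon n a)) x \<noteq> 0"
proof -
  define eps where "eps = (if of_nat n = (0::'c) then 1 else 0 :: 'c)"
  define h0 where "h0 = [:0, 1:] ^ (n - 1) * [:- eps, 1:]"
  have "finite (w ` \<Theta>)" using fin by simp
  then obtain c where c: "c \<notin> w ` \<Theta>" using infinite_UNIV_alg_closed[where 'c = 'c] by (metis ex_new_if_finite)
  define h where "h = h0 + [:c:]"
  have d0: "degree h0 = n" "lead_coeff h0 = 1"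
  proof -
    show "degree h0 = n"
      using n0 by (simp add: h0_def degree_mult_eq degree_power_eq del: mult_pCons_right)
    show "lead_coeff h0 = 1"
      unfolding h0_def lead_coeff_mult lead_coeff_power by simp
  qed
  have dh: "degree h = n"
    unfolding h_def using d0 n0 by (subst degree_add_eq_left) auto
  have lh: "lead_coeff h = 1"
    using d0 dh n0 by (simp add: h_def coeff_pCons split: nat.splits)
  have "poly (pderiv h) x \<noteq> 0" if "\<omega> \<in> w ` \<Theta>" "poly h x = \<omega>" for \<omega> x
  proof -
    have "poly h0 x \<noteq> 0" using that c by (auto simp: h_def)
    then have "poly (pderiv h0) x \<noteq> 0"
      unfolding h0_def using one_critical_value[OF n0 eps_def char2] by blast
    then show ?thesis by (simp add: h_def pderiv_add pderiv_pCons)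
  qed
  then show ?thesis
    using gmon_coeffs[OF dh lh] by (intro exI[of _ "\<lambda>j. poly.coeff h (n - j)"]) auto
qed

text \<open>The line from a separable member to a point with \<open>q\<close> nonzero meets both bad
  sets in finitely many parameters. For any other parameter each value of \<open>w\<close> has
  exactly \<open>n\<close> preimages, which can be matched with the labels of its fibre.\<close>

lemma separable_solution:
  assumes q: "q \<in> mpolys n" "q \<noteq> 0"
  shows "\<exists>a t. solves (\<lambda>c. c) a t \<and> ev (\<lambda>c. c) a q \<noteq> 0"
proof -
  obtain a0 where a0: "\<And>\<omega> x. \<omega> \<in> w ` \<Theta> \<Longrightarrow> poly (gmon n a0) x = \<omega> \<Longrightarrow> poly (pderiv (gmon n a0)) x \<noteq> 0"
    using separable_member by blast
  obtain b where b: "ev (\<lambda>c. c) b q \<noteq> 0"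
    using mpoly_nonvanishing_point[OF infinite_UNIV_alg_closed q] by blast
  define u where "u = gmon n b - gmon n a0"
  define a where "a s = (\<lambda>j. a0 j + s * (b j - a0 j))" for s
  have ga: "gmon n (a s) = gmon n a0 + smult s u" for s
    by (rule poly_eqI) (auto simp: coeff_gmon a_def u_def)
  have "degree u \<le> n - 1"
    using n0 by (intro degree_le) (auto simp: u_def coeff_gmon)
  then have du: "degree u < n" using n0 by simp
  have "finite {s. \<exists>x. poly (gmon n (a s)) x = \<omega> \<and> poly (pderiv (gmon n (a s))) x = 0}" if "\<omega> \<in> w ` \<Theta>" for \<omega>
    unfolding ga using a0[OF that] du by (intro finite_singular_members) (auto simp: gmon_degree)
  then have "finite (\<Union>\<omega>\<in>w ` \<Theta>. {s. \<exists>x. poly (gmon n (a s)) x = \<omega> \<and> poly (pderiv (gmon n (a s))) x = 0})"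
    using fin by auto
  moreover have "finite {s. ev (\<lambda>c. c) (a s) q = 0}"
    unfolding a_def by (rule mpoly_line_nonvanishing[OF b])
  ultimately have "finite ((\<Union>\<omega>\<in>w ` \<Theta>. {s. \<exists>x. poly (gmon n (a s)) x = \<omega> \<and> poly (pderiv (gmon n (a s))) x = 0})
      \<union> {s. ev (\<lambda>c. c) (a s) q = 0})"
    by (rule finite_UnI)
  from ex_new_if_finite[OF infinite_UNIV_alg_closed this] obtain s where
    s: "s \<notin> (\<Union>\<omega>\<in>w ` \<Theta>. {s. \<exists>x. poly (gmon n (a s)) x = \<omega> \<and> poly (pderiv (gmon n (a s))) x = 0})
      \<union> {s. ev (\<lambda>c. c) (a s) q = 0}" by (elim exE)
  define A where "A = a s"
  have sep: "poly (pderiv (gmon n A)) x \<noteq> 0" if "\<omega> \<in> w ` \<Theta>" "poly (gmon n A) x = \<omega>" for \<omega> x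
    using s that by (auto simp: A_def)
  have "\<exists>f. bij_betw f {\<eta> \<in> \<Theta>. w \<eta> = \<omega>} {x. poly (gmon n A) x = \<omega>}" if \<omega>: "\<omega> \<in> w ` \<Theta>" for \<omega>
  proof -
    define p where "p = gmon n A - [:\<omega>:]"
    have dp: "degree p = n"
      unfolding p_def using n0 by (subst diff_conv_add_uminus, subst degree_add_eq_left) (auto simp: gmon_degree)
    have "card {x. poly p x = 0} = n"
      unfolding dp[symmetric] using dp n0 sep[OF \<omega>]
      by (intro card_roots_separable) (auto simp: p_def pderiv_diff pderiv_pCons)
    moreover have "{x. poly p x = 0} = {x. poly (gmon n A) x = \<omega>}" by (auto simp: p_def)
    moreover have "card {\<eta> \<in> \<Theta>. w \<eta> = \<omega>} = n" using \<omega> fibres by auto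
    ultimately show ?thesis
      using n0 fin by (intro finite_same_card_bij) (auto intro: card_ge_0_finite)
  qed
  then obtain f where f: "\<And>\<omega>. \<omega> \<in> w ` \<Theta> \<Longrightarrow> bij_betw (f \<omega>) {\<eta> \<in> \<Theta>. w \<eta> = \<omega>} {x. poly (gmon n A) x = \<omega>}"
    by metis
  define t where "t \<theta> = f (w \<theta>) \<theta>" for \<theta>
  have tr: "poly (gmon n A) (t \<theta>) = w \<theta>" if "\<theta> \<in> \<Theta>" for \<theta>
    using bij_betwE[OF f[of "w \<theta>"]] that by (auto simp: t_def)
  have "inj_on t \<Theta>"
  proof (rule inj_onI)
    fix x y assume xy: "x \<in> \<Theta>" "y \<in> \<Theta>" "t x = t y"
    then have wxy: "w x = w y" using tr by metis
    then show "x = y"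
      using bij_betw_imp_inj_on[OF f[of "w x"]] xy by (auto simp: inj_on_def t_def)
  qed
  then show ?thesis
    using tr s by (intro exI[of _ A] exI[of _ t]) (auto simp: solves_def A_def)
qed

text \<open>The solutions off \<open>P = 0\<close> detect membership in every good ideal. Any
  relabelling within fibres gives a solution again, so \<open>S0\<close> is empty and the base case
  concerns a polynomial in the coefficients alone: were it nonzero, some separable solution would
  avoid its zeros and those of \<open>P\<close>.\<close>

lemma vanishing_at_solutions:
  assumes P: "P \<in> mpolys n" "P \<noteq> 0" and J: "good J" and p: "p \<in> mpolys (n + N)"
    and van: "\<And>a t. solves (\<lambda>c. c) a t \<Longrightarrow> ev (\<lambda>c. c) a P \<noteq> 0 \<Longrightarrow> pnt (\<lambda>c. c) a t p = 0"
  shows "p \<in> J"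
proof -
  define F where "F = {pnt (\<lambda>c. c) a t | a t. solves (\<lambda>c. c) a t \<and> ev (\<lambda>c. c) a P \<noteq> 0}"
  show ?thesis
  proof (rule vanishing_imp_in_good_ideal[of F "{}"])
    fix \<phi> assume "\<phi> \<in> F"
    then show "is_hom \<phi> \<and> good {x. \<phi> x = 0}"
      by (auto simp: F_def is_hom_pnt is_hom_id good_kernel_pnt)
  next
    fix \<phi> \<theta> \<eta> assume \<phi>: "\<phi> \<in> F" and te: "\<theta> \<in> \<Theta> - {}" "\<eta> \<in> \<Theta> - {}" "w \<theta> = w \<eta>"
    obtain a t where at: "\<phi> = pnt (\<lambda>c. c) a t" "solves (\<lambda>c. c) a t" "ev (\<lambda>c. c) a P \<noteq> 0"
      using \<phi> by (auto simp: F_def)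
    define \<sigma> where "\<sigma> = transpose \<theta> \<eta>"
    have \<sigma>: "\<sigma> s \<in> \<Theta>" "w (\<sigma> s) = w s" if "s \<in> \<Theta>" for s
      using that te by (auto simp: \<sigma>_def transpose_def)
    have "solves (\<lambda>c. c) a (\<lambda>s. t (\<sigma> s))"
      using at(2) \<sigma> unfolding solves_def
      by (auto simp: inj_on_def \<sigma>_def dest: transpose_eq_imp_eq) (metis \<sigma>_def transpose_eq_iff \<sigma>)
    then have "pnt (\<lambda>c. c) a (\<lambda>s. t (\<sigma> s)) \<in> F" using at by (auto simp: F_def)
    then show "\<exists>\<phi>'\<in>F. (\<forall>c. \<phi>' (Const c) = \<phi> (Const c)) \<and> (\<forall>j\<in>{1..n}. \<phi>' (Var j) = \<phi> (Var j)) \<and>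
        (\<forall>s\<in>\<Theta>. \<phi>' (tau s) = \<phi> (tau (transpose \<theta> \<eta> s)))"
      using \<sigma> by (intro bexI) (auto simp: at(1) pnt_Const is_hom_id pnt_Var pnt_tau \<sigma>_def)
  next
    fix p assume p: "p \<in> alg {}" and v: "\<And>\<phi>. \<phi> \<in> F \<Longrightarrow> \<phi> p = 0"
    have pn: "p \<in> mpolys n" using p by (simp add: mpolys_eq_subalg)
    have "p = 0"
    proof (rule ccontr)
      assume "p \<noteq> 0"
      then have "p * P \<in> mpolys n" "p * P \<noteq> 0" using pn P by (auto intro: subring_mult[OF is_subring_mpolys])
      from separable_solution[OF this] obtain a t where
        at: "solves (\<lambda>c. c) a t" "ev (\<lambda>c. c) a (p * P) \<noteq> 0" by blast
      then have ne: "ev (\<lambda>c. c) a p \<noteq> 0" "ev (\<lambda>c. c) a P \<noteq> 0" by (auto simp: hom_mult[OF is_hom_ev[OF is_hom_id]])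
      then have "pnt (\<lambda>c. c) a t \<in> F" using at by (auto simp: F_def)
      from v[OF this] have "ev (\<lambda>c. c) a p = 0"
        unfolding pnt_def by (subst ev_cong[OF pn, of a]) (auto simp: pt_def)
      then show False using ne by simp
    qed
    then show "p \<in> J" using J by (simp add: good_def ideal_zero)
  next
    show "p \<in> alg \<Theta>" using p by (simp add: mpolys_eq_alg)
  qed (use J van in \<open>auto simp: F_def\<close>)
qed

end

section \<open>Generic points over power series rings\<close>

context cover
begin

definition fib :: "'c \<Rightarrow> 'c set" where
  "fib \<theta> = {\<eta> \<in> \<Theta>. w \<eta> = w \<theta>}"

abbreviation \<kappa> :: "'c \<Rightarrow> 'c mpoly fps" where
  "\<kappa> c \<equiv> fps_const (Const c)"

lemma is_hom_\<kappa>: "is_hom \<kappa>"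
  by (rule is_hom_comp[OF is_hom_fps_const is_hom_Const])

text \<open>Specialisation of points, expressed as containment of their prime ideals.\<close>

definition above :: "(nat \<Rightarrow> 'c mpoly fps) \<Rightarrow> ('c \<Rightarrow> 'c mpoly fps) \<Rightarrow> (nat \<Rightarrow> 'c mpoly fps) \<Rightarrow> ('c \<Rightarrow> 'c mpoly fps) \<Rightarrow> bool" where
  "above a t a' t' \<longleftrightarrow> (\<forall>p \<in> mpolys (n + N). pnt \<kappa> a t p = 0 \<longrightarrow> pnt \<kappa> a' t' p = 0)"

text \<open>Power series with polynomial coefficients serve as a function field. The second clause
  makes the roots of one fibre as independent as the equations permit; the third supplies one
  transposition in that fibre, which for \<open>n = 1\<close> has none.\<close>

definition generic_at :: "'c \<Rightarrow> (nat \<Rightarrow> 'c mpoly fps) \<Rightarrow> ('c \<Rightarrow> 'c mpoly fps) \<Rightarrow> bool" where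
  "generic_at \<theta> a t \<longleftrightarrow> solves \<kappa> a t \<and>
     (\<forall>p \<in> alg (fib \<theta>). pnt \<kappa> a t p = 0 \<longrightarrow> (\<forall>J. good J \<longrightarrow> p \<in> J)) \<and>
     (n \<ge> 2 \<longrightarrow> (\<exists>\<theta>1\<in>fib \<theta>. \<exists>\<theta>2\<in>fib \<theta>. \<theta>1 \<noteq> \<theta>2 \<and> above a t a (\<lambda>s. t (transpose \<theta>1 \<theta>2 s))))"

text \<open>With the coefficients of \<open>g\<close> eliminated, \<open>n\<close> generators are
  left, which can be sent to independent power series.\<close>

lemma alg_fibre_reduce:
  assumes \<theta>: "\<theta> \<in> \<Theta>" and "p \<in> alg (fib \<theta>)"
  shows "\<exists>p' \<in> subalg Const (tau ` fib \<theta>). \<forall>J. good J \<longrightarrow> p - p' \<in> J"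
proof -
  note S = is_subring_subalg[OF is_hom_Const, of "tau ` fib \<theta>"]
  obtain A where A: "\<And>j. j \<in> {1..n} \<Longrightarrow> A j \<in> subalg Const (tau ` fib \<theta>)"
    "\<And>J j. good J \<Longrightarrow> j \<in> {1..n} \<Longrightarrow> Var j - A j \<in> J"
    using coefficients_from_fibre[OF \<theta>] unfolding fib_def[symmetric] by blast
  show ?thesis using assms(2)
  proof (induction rule: subalg.induct)
    case (const c)
    show ?case by (intro bexI[of _ "Const c"]) (auto simp: good_def ideal_zero intro: subalg.const)
  next
    case (gen x)
    show ?case
    proof (cases "x \<in> tau ` fib \<theta>")
      case True
      then show ?thesis by (intro bexI[of _ x]) (auto simp: good_def ideal_zero intro: subalg.gen)
    next
      case False
      with gen obtain j where "j \<in> {1..n}" "x = Var j" by auto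
      then show ?thesis using A by (intro bexI[of _ "A j"]) auto
    qed
  next
    case (add x y)
    then obtain x' y' where *: "x' \<in> subalg Const (tau ` fib \<theta>)" "y' \<in> subalg Const (tau ` fib \<theta>)"
      "\<And>J. good J \<Longrightarrow> x - x' \<in> J" "\<And>J. good J \<Longrightarrow> y - y' \<in> J" by blast
    have "x + y - (x' + y') \<in> J" if "good J" for J
    proof -
      have "(x - x') + (y - y') \<in> J"
        using *(3,4)[OF that] that by (intro ideal_add) (auto simp: good_def)
      then show ?thesis by (simp add: algebra_simps)
    qed
    then show ?case using subring_add[OF S *(1,2)] by blast
  next
    case (mult x y)
    then obtain x' y' where *: "x' \<in> subalg Const (tau ` fib \<theta>)" "y' \<in> subalg Const (tau ` fib \<theta>)"
      "\<And>J. good J \<Longrightarrow> x - x' \<in> J" "\<And>J. good J \<Longrightarrow> y - y' \<in> J" by blast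
    have "x * y - (x' * y') \<in> J" if "good J" for J
    proof -
      have I: "is_ideal J" using that by (simp add: good_def)
      have "y * (x - x') + x' * (y - y') \<in> J"
        using *(3,4)[OF that] by (intro ideal_add[OF I] ideal_mult[OF I])
      then show ?thesis by (simp add: algebra_simps)
    qed
    then show ?case using subring_mult[OF S *(1,2)] by blast
  qed
qed

text \<open>A general series cannot be evaluated at \<open>1\<close>, but the image of
  \<open>q\<close> is a polynomial in \<open>fps_X\<close>. Its value at \<open>1\<close> is
  \<open>q\<close> with translated variables, and the opposite translation recovers
  \<open>q\<close>.\<close>

lemma linear_substitution_injective:
  assumes "ev \<kappa> (\<lambda>k. \<kappa> (e k) + fps_const (Var k) * fps_X) q = 0"
  shows "q = (0 :: 'c mpoly)"
proof -
  have hC: "is_hom (\<lambda>c::'c. [:Const c:])"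
    by (auto simp: is_hom_def one_pCons hom_one[OF is_hom_Const] hom_add[OF is_hom_Const] hom_mult[OF is_hom_Const])
  define r where "r = ev (\<lambda>c. [:Const c:]) (\<lambda>k. [:Const (e k), Var k:]) q"
  have "fps_of_poly r = ev (\<lambda>c. fps_of_poly [:Const c:]) (\<lambda>k. fps_of_poly [:Const (e k), Var k:]) q"
    unfolding r_def by (rule hom_ev[OF is_hom_fps_of_poly hC])
  also have "\<dots> = ev \<kappa> (\<lambda>k. \<kappa> (e k) + fps_const (Var k) * fps_X) q"
    by (simp add: fps_of_poly_const fps_of_poly_pCons algebra_simps)
  finally have "fps_of_poly r = fps_of_poly 0" using assms by simp
  then have "r = 0" by (simp only: fps_of_poly_eq_iff)
  then have "poly r 1 = 0" by simp
  then have *: "ev Const (\<lambda>k. Const (e k) + Var k) q = 0"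
    unfolding r_def by (subst (asm) hom_ev[OF is_hom_poly hC]) simp
  define sh where "sh = ev Const (\<lambda>k. Var k - Const (e k) :: 'c mpoly)"
  have hb: "is_hom sh" unfolding sh_def by (rule is_hom_ev[OF is_hom_Const])
  have "sh (ev Const (\<lambda>k. Const (e k) + Var k) q) = ev Const (\<lambda>k. sh (Const (e k) + Var k)) q"
    unfolding sh_def by (rule ev_subst[OF is_hom_Const])
  also have "(\<lambda>k. sh (Const (e k) + Var k)) = Var"
  proof
    fix k
    have "sh (Const (e k)) = Const (e k)" "sh (Var k) = Var k - Const (e k)"
      by (simp_all add: sh_def ev_Const[OF is_hom_Const] ev_Var[OF is_hom_Const])
    then show "sh (Const (e k) + Var k) = Var k" by (simp add: hom_add[OF hb])
  qed
  finally have "sh (ev Const (\<lambda>k. Const (e k) + Var k) q) = q" by (simp add: ev_Const_Var)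
  then show ?thesis using * by (simp add: hom_zero[OF hb])
qed

text \<open>Near the polynomial \<open>t ^ (n - 1) * (t - \<epsilon>) + w \<theta>0\<close> all roots outside the fibre of \<open>\<theta>0\<close> are
  distinct modulo \<open>fps_X\<close> and lift by Hensel's lemma, while the roots in the fibre can be taken
  algebraically independent; exchanging two of them with equal constant terms is induced by an
  automorphism of the power series ring fixing all other roots.\<close>

lemma generic_point_exists:
  assumes \<theta>0: "\<theta>0 \<in> \<Theta>"
  shows "\<exists>a t. generic_at \<theta>0 a t"
proof -
  note hk = is_hom_\<kappa> and h0 = is_hom_fps_nth_0
  define Fib where "Fib = fib \<theta>0"
  have finF: "finite Fib" and cardF: "card Fib = n" and FT: "Fib \<subseteq> \<Theta>"
    using fin fibres[OF \<theta>0] by (auto simp: Fib_def fib_def)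
  have inF: "\<eta> \<in> Fib \<longleftrightarrow> \<eta> \<in> \<Theta> \<and> w \<eta> = w \<theta>0" for \<eta> by (auto simp: Fib_def fib_def)
  obtain \<beta> where \<beta>: "bij_betw \<beta> Fib {1..n}"
    using finite_same_card_bij[OF finF, of "{1..n}"] cardF by auto
  have \<beta>inj: "inj_on \<beta> Fib" and \<beta>im: "\<beta> ` Fib = {1..n}" using \<beta> by (auto simp: bij_betw_def)
  define eps where "eps = (if of_nat n = (0::'c) then 1 else 0 :: 'c)"
  \<comment> \<open>Constant terms of the roots in the distinguished fibre, all \<open>0\<close>
    except possibly the last, so that the product of the \<open>X - e k\<close> is the polynomial of
    \<open>one_critical_value\<close>.\<close>
  define e where "e k = (if k = n then eps else 0)" for k
  define h where "h = [:0, 1:] ^ (n - 1) * [:- eps, 1:]"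
  have h_prod: "h = (\<Prod>k=1..n. [:- e k, 1:])"
  proof -
    have "(\<Prod>k=1..n. [:- e k, 1:]) = [:- e n, 1:] * (\<Prod>k\<in>{1..n} - {n}. [:- e k, 1:])"
      using n0 by (subst prod.remove[of _ n]) auto
    also have "(\<Prod>k\<in>{1..n} - {n}. [:- e k, 1:]) = (\<Prod>k\<in>{1..n} - {n}. [:0, 1:])"
      by (intro prod.cong) (auto simp: e_def)
    also have "\<dots> = [:0, 1:] ^ (n - 1)" using n0 by simp
    finally show ?thesis by (simp add: h_def e_def mult.commute del: mult_pCons_left mult_pCons_right)
  qed
  have dh: "degree h = n" unfolding h_prod by (subst degree_prod_eq_sum_degree) auto
  \<comment> \<open>A value \<open>\<omega> \<noteq> w \<theta>0\<close> corresponds to a nonzero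
    value of \<open>h\<close>, which is not critical; its \<open>n\<close> simple roots become the
    residues for the fibre over \<open>\<omega>\<close>.\<close>
  have lift_ex: "\<exists>g. bij_betw g {\<eta> \<in> \<Theta>. w \<eta> = \<omega>} {x. poly h x = \<omega> - w \<theta>0}"
    if \<omega>: "\<omega> \<in> w ` \<Theta> - {w \<theta>0}" for \<omega>
  proof -
    define p where "p = h - [:\<omega> - w \<theta>0:]"
    have dp: "degree p = n"
      unfolding p_def using n0 by (subst diff_conv_add_uminus, subst degree_add_eq_left) (auto simp: dh)
    have "card {x. poly p x = 0} = degree p"
    proof (rule card_roots_separable)
      show "p \<noteq> 0" using dp n0 by auto
      fix x assume "poly p x = 0"
      then have "poly h x \<noteq> 0" using \<omega> by (auto simp: p_def)
      then have "poly (pderiv h) x \<noteq> 0" unfolding h_def using one_critical_value[OF n0 eps_def char2] by blast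
      then show "poly (pderiv p) x \<noteq> 0" by (simp add: p_def pderiv_diff pderiv_pCons)
    qed
    then have "card {x. poly p x = 0} = n" using dp by simp
    moreover have "{x. poly p x = 0} = {x. poly h x = \<omega> - w \<theta>0}" by (auto simp: p_def)
    moreover have "card {\<eta> \<in> \<Theta>. w \<eta> = \<omega>} = n" using \<omega> fibres by auto
    ultimately show ?thesis
      using n0 fin by (intro finite_same_card_bij) (auto intro: card_ge_0_finite)
  qed
  then obtain g where g: "\<And>\<omega>. \<omega> \<in> w ` \<Theta> - {w \<theta>0} \<Longrightarrow> bij_betw (g \<omega>) {\<eta> \<in> \<Theta>. w \<eta> = \<omega>} {x. poly h x = \<omega> - w \<theta>0}"
    by metis
  define \<zeta> where "\<zeta> \<eta> = g (w \<eta>) \<eta>" for \<eta>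
  have \<zeta>_root: "poly h (\<zeta> \<eta>) = w \<eta> - w \<theta>0" if "\<eta> \<in> \<Theta> - Fib" for \<eta>
    using bij_betwE[OF g[of "w \<eta>"]] that by (auto simp: \<zeta>_def inF)
  have \<zeta>_inj: "\<eta> = \<eta>'" if "\<eta> \<in> \<Theta> - Fib" "\<eta>' \<in> \<Theta>" "w \<eta> = w \<eta>'" "\<zeta> \<eta> = \<zeta> \<eta>'" for \<eta> \<eta>'
  proof -
    have "w \<eta> \<in> w ` \<Theta> - {w \<theta>0}" using that by (auto simp: inF)
    from inj_onD[OF bij_betw_imp_inj_on[OF g[OF this]], of \<eta> \<eta>'] show ?thesis
      using that by (simp add: \<zeta>_def)
  qed
  \<comment> \<open>The linear coefficients are distinct variables, which keeps the roots distinct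
    and independent even when their constant terms coincide.\<close>
  define y where "y \<theta> = \<kappa> (e (\<beta> \<theta>)) + fps_const (Var (\<beta> \<theta>)) * fps_X" for \<theta>
  have y0: "fps_nth (y \<theta>) 0 = Const (e (\<beta> \<theta>))" and y1: "fps_nth (y \<theta>) 1 = Var (\<beta> \<theta>)" for \<theta>
    by (simp_all add: y_def)
  define G0 where "G0 = (\<Prod>\<theta>\<in>Fib. [:- y \<theta>, 1:])"
  have dG0: "degree G0 = n" unfolding G0_def using cardF by (subst degree_prod_eq_sum_degree) auto
  have lG0: "lead_coeff G0 = 1" unfolding G0_def by (simp add: lead_coeff_prod)
  \<comment> \<open>The monic polynomial that takes the value \<open>w \<theta>0\<close> exactly at
    the \<open>y \<theta>\<close>; its coefficients become \<open>a\<close>, which determines the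
    other fibres.\<close>
  define G where "G = G0 + [:\<kappa> (w \<theta>0):]"
  have dG: "degree G = n" unfolding G_def using dG0 n0 by (subst degree_add_eq_left) auto
  have lG: "lead_coeff G = 1" using dG dG0 lG0 n0 by (simp add: G_def coeff_pCons split: nat.splits)
  define a where "a j = poly.coeff G (n - j)" for j
  have ga: "gmon n a = G" unfolding a_def by (rule gmon_coeffs[OF dG lG])
  have G0_0: "map_poly (\<lambda>f. fps_nth f 0) G0 = map_poly Const h"
  proof -
    have "map_poly (\<lambda>f. fps_nth f 0) G0 = (\<Prod>\<theta>\<in>Fib. map_poly Const [:- e (\<beta> \<theta>), 1:])"
      unfolding G0_def hom_prod[OF is_hom_map_poly[OF h0]]
      by (intro prod.cong)
         (auto simp: map_hom_pCons[OF h0] map_hom_pCons[OF is_hom_Const] y0 hom_uminus[OF is_hom_Const] hom_one[OF is_hom_Const])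
    also have "\<dots> = (\<Prod>k=1..n. map_poly Const [:- e k, 1:])"
      using prod.reindex_bij_betw[OF \<beta>, of "\<lambda>k. map_poly Const [:- e k, 1:]"] by simp
    also have "\<dots> = map_poly Const h" unfolding h_prod hom_prod[OF is_hom_map_poly[OF is_hom_Const]] ..
    finally show ?thesis .
  qed
  define F where "F \<eta> = G - [:\<kappa> (w \<eta>):]" for \<eta>
  have F0: "map_poly (\<lambda>f. fps_nth f 0) (F \<eta>) = map_poly Const (h + [:w \<theta>0 - w \<eta>:])" for \<eta>
    unfolding F_def G_def
    by (simp add: hom_diff[OF is_hom_map_poly[OF h0]] hom_add[OF is_hom_map_poly[OF h0]] G0_0
        hom_add[OF is_hom_map_poly[OF is_hom_Const]] map_hom_pCons[OF h0] map_hom_pCons[OF is_hom_Const]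
        hom_diff[OF is_hom_Const])
  have F0_root: "poly (map_poly (\<lambda>f. fps_nth f 0) (F \<eta>)) (Const (\<zeta> \<eta>)) = 0" if "\<eta> \<in> \<Theta> - Fib" for \<eta>
    unfolding F0 poly_map_hom[OF is_hom_Const] using \<zeta>_root[OF that] by (simp add: hom_zero[OF is_hom_Const])
  \<comment> \<open>At a residue the derivative is a nonzero constant of the closure, hence
    invertible even among polynomials.\<close>
  have F0_unit: "\<exists>c. c * poly (pderiv (map_poly (\<lambda>f. fps_nth f 0) (F \<eta>))) (Const (\<zeta> \<eta>)) = 1" if "\<eta> \<in> \<Theta> - Fib" for \<eta>
  proof -
    have pd: "pderiv (map_poly Const q) = map_poly Const (pderiv q)" for q :: "'c poly"
    proof (rule poly_eqI)
      fix i
      have "Const (of_nat m :: 'c) = of_nat m" for m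
        by (induction m) (auto simp: hom_zero[OF is_hom_Const] hom_add[OF is_hom_Const] hom_one[OF is_hom_Const])
      then have "Const (of_nat (Suc i) * poly.coeff q (Suc i)) = of_nat (Suc i) * Const (poly.coeff q (Suc i))"
        by (simp only: hom_mult[OF is_hom_Const])
      then show "poly.coeff (pderiv (map_poly Const q)) i = poly.coeff (map_poly Const (pderiv q)) i"
        by (simp only: coeff_pderiv coeff_map_hom[OF is_hom_Const])
    qed
    define d where "d = poly (pderiv h) (\<zeta> \<eta>)"
    have "poly h (\<zeta> \<eta>) \<noteq> 0" using \<zeta>_root[OF that] that by (auto simp: inF)
    then have "d \<noteq> 0" unfolding h_def d_def using one_critical_value[OF n0 eps_def char2] by blast
    then have "Const (inverse d) * Const d = 1"
      by (simp add: hom_one[OF is_hom_Const] flip: hom_mult[OF is_hom_Const])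
    moreover have "poly (pderiv (map_poly (\<lambda>f. fps_nth f 0) (F \<eta>))) (Const (\<zeta> \<eta>)) = Const d"
      unfolding F0 pd poly_map_hom[OF is_hom_Const] by (simp add: d_def pderiv_add pderiv_pCons)
    ultimately show ?thesis by metis
  qed
  have "\<exists>z. poly (F \<eta>) z = 0 \<and> fps_nth z 0 = Const (\<zeta> \<eta>)" if "\<eta> \<in> \<Theta> - Fib" for \<eta>
    using F0_unit[OF that] hensel_root[OF F0_root[OF that]] by blast
  then obtain z where z: "\<And>\<eta>. \<eta> \<in> \<Theta> - Fib \<Longrightarrow> poly (F \<eta>) (z \<eta>) = 0" "\<And>\<eta>. \<eta> \<in> \<Theta> - Fib \<Longrightarrow> fps_nth (z \<eta>) 0 = Const (\<zeta> \<eta>)"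
    by metis
  define t where "t \<eta> = (if \<eta> \<in> Fib then y \<eta> else z \<eta>)" for \<eta>
  have roots: "poly (gmon n a) (t \<theta>) = \<kappa> (w \<theta>)" if "\<theta> \<in> \<Theta>" for \<theta>
  proof (cases "\<theta> \<in> Fib")
    case True
    then have "poly G0 (y \<theta>) = 0" unfolding G0_def poly_prod using finF by (intro prod_zero) auto
    then show ?thesis using True by (simp add: ga G_def t_def inF)
  next
    case False
    then show ?thesis using z(1)[of \<theta>] that by (simp add: ga t_def F_def)
  qed
  \<comment> \<open>Different fibres have different values. Within the distinguished fibre the
    linear coefficients differ, within any other the constant terms.\<close>
  have "inj_on t \<Theta>"
  proof (rule inj_onI)
    fix x x' assume x: "x \<in> \<Theta>" "x' \<in> \<Theta>" "t x = t x'"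
    have "\<kappa> (w x) = \<kappa> (w x')" using roots x by metis
    then have wx: "w x = w x'" by (simp add: Const_eq_iff)
    show "x = x'"
    proof (cases "x \<in> Fib")
      case True
      then have x': "x' \<in> Fib" using wx x by (simp add: inF)
      then have "y x = y x'" using True x by (simp add: t_def)
      then have "Var (\<beta> x) = (Var (\<beta> x') :: 'c mpoly)" by (metis y1)
      then show ?thesis using \<beta>inj True x' by (auto simp: Var_eq_iff inj_on_def)
    next
      case False
      then have x': "x' \<notin> Fib" using wx x by (simp add: inF)
      then have "Const (\<zeta> x) = Const (\<zeta> x')" using z(2)[of x] z(2)[of x'] False x by (simp add: t_def)
      then show ?thesis using \<zeta>_inj[of x x'] False x wx by (simp add: Const_eq_iff)
    qed
  qed
  with roots have sol: "solves \<kappa> a t" by (simp add: solves_def)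
  \<comment> \<open>Modulo good ideals the relation involves only the roots of the fibre, and
    substituting the series \<open>y\<close> for them is injective.\<close>
  have base: "p \<in> J" if p: "p \<in> alg (fib \<theta>0)" "pnt \<kappa> a t p = 0" and J: "good J" for p J
  proof -
    obtain p' where p': "p' \<in> subalg Const (tau ` Fib)" "\<And>J. good J \<Longrightarrow> p - p' \<in> J"
      using alg_fibre_reduce[OF \<theta>0 p(1)] by (auto simp: Fib_def)
    have "p - p' \<in> {x. pnt \<kappa> a t x = 0}" by (rule p'(2)[OF good_kernel_pnt[OF hk sol]])
    then have v: "pnt \<kappa> a t p' = 0" using p(2) by (simp add: hom_diff[OF is_hom_pnt[OF hk]])
    define \<beta>' where "\<beta>' = inv_into Fib \<beta>"
    have \<beta>': "\<beta>' k \<in> Fib" "\<beta> (\<beta>' k) = k" if "k \<in> {1..n}" for k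
      using that \<beta>im unfolding \<beta>'_def by (auto intro: inv_into_into f_inv_into_f)
    have "Fib = \<beta>' ` {1..n}" unfolding \<beta>'_def using \<beta>inj \<beta>im by (metis inv_into_image_cancel order_refl)
    then have "tau ` Fib = (\<lambda>k. tau (\<beta>' k)) ` {1..n}" by auto
    then obtain q where q: "q \<in> mpolys n" "p' = ev Const (\<lambda>k. tau (\<beta>' k)) q"
      using subalg_image_ev[of p' "\<lambda>k. tau (\<beta>' k)" n] p'(1) by metis
    have "pnt \<kappa> a t p' = ev \<kappa> (\<lambda>k. pnt \<kappa> a t (tau (\<beta>' k))) q"
      unfolding q(2) by (subst hom_ev[OF is_hom_pnt[OF hk] is_hom_Const]) (simp add: pnt_Const[OF hk])
    also have "\<dots> = ev \<kappa> (\<lambda>k. \<kappa> (e k) + fps_const (Var k) * fps_X) q"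
    proof (rule ev_cong[OF q(1)])
      fix k assume k: "k \<in> {1..n}"
      have "pnt \<kappa> a t (tau (\<beta>' k)) = t (\<beta>' k)" using \<beta>'(1)[OF k] FT by (intro pnt_tau[OF hk]) auto
      then show "pnt \<kappa> a t (tau (\<beta>' k)) = \<kappa> (e k) + fps_const (Var k) * fps_X"
        using \<beta>'[OF k] by (simp add: t_def y_def)
    qed
    finally have "q = 0" using v by (intro linear_substitution_injective[of e]) simp
    then have "p' = 0" by (simp add: q(2) ev_zero[OF is_hom_Const])
    then show ?thesis using p'(2)[OF J] by simp
  qed
  have swap: "\<exists>\<theta>1\<in>fib \<theta>0. \<exists>\<theta>2\<in>fib \<theta>0. \<theta>1 \<noteq> \<theta>2 \<and> above a t a (\<lambda>s. t (transpose \<theta>1 \<theta>2 s))" if n2: "n \<ge> 2"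
  proof -
    \<comment> \<open>The exchanged roots need equal constant terms. For \<open>n \<ge> 3\<close>
      both are \<open>0\<close>; for \<open>n = 2\<close> the second is \<open>eps\<close>, which is
      \<open>0\<close> because the characteristic is not \<open>2\<close>.\<close>
    have e12: "e 1 = e 2"
    proof (cases "n = 2")
      case True
      then have "of_nat n \<noteq> (0::'c)" using char2 by blast
      then show ?thesis by (auto simp: e_def eps_def)
    qed (use n2 in \<open>auto simp: e_def\<close>)
    have "1 \<in> \<beta> ` Fib" "2 \<in> \<beta> ` Fib" unfolding \<beta>im using n2 by auto
    then obtain \<theta>1 \<theta>2 where \<theta>1: "\<theta>1 \<in> Fib" "\<beta> \<theta>1 = 1" and \<theta>2: "\<theta>2 \<in> Fib" "\<beta> \<theta>2 = 2"
      by (elim imageE) metis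
    have ne: "\<theta>1 \<noteq> \<theta>2" using \<theta>1 \<theta>2 by auto
    define \<sigma> where "\<sigma> = transpose \<theta>1 \<theta>2"
    have \<sigma>F: "\<sigma> \<theta> \<in> Fib \<longleftrightarrow> \<theta> \<in> Fib" for \<theta> using \<theta>1 \<theta>2 by (auto simp: \<sigma>_def transpose_def)
    have \<sigma>other: "\<sigma> \<theta> = \<theta>" if "\<theta> \<notin> Fib" for \<theta> using that \<theta>1 \<theta>2 by (auto simp: \<sigma>_def transpose_def)
    have \<beta>\<sigma>: "\<beta> (\<sigma> \<theta>) = transpose 1 2 (\<beta> \<theta>)" if "\<theta> \<in> Fib" for \<theta>
    proof -
      consider "\<theta> = \<theta>1" | "\<theta> = \<theta>2" | "\<theta> \<noteq> \<theta>1" "\<theta> \<noteq> \<theta>2" by blast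
      then show ?thesis
      proof cases
        case 3
        then have "\<beta> \<theta> \<noteq> 1" "\<beta> \<theta> \<noteq> 2"
          using inj_onD[OF \<beta>inj, of \<theta> \<theta>1] inj_onD[OF \<beta>inj, of \<theta> \<theta>2] that \<theta>1 \<theta>2 by metis+
        then show ?thesis using 3 by (simp add: \<sigma>_def transpose_apply_other)
      qed (simp_all add: \<sigma>_def \<theta>1 \<theta>2)
    qed
    \<comment> \<open>Exchanges the first two indeterminates; applied to coefficients it becomes the
      endomorphism \<open>S\<close> of the power series ring.\<close>
    define sw :: "'c mpoly \<Rightarrow> 'c mpoly" where "sw = ev Const (\<lambda>i. Var (transpose 1 2 i))"
    have hsw: "is_hom sw" unfolding sw_def by (rule is_hom_ev[OF is_hom_Const])
    have swC: "sw (Const c) = Const c" and swV: "sw (Var i) = Var (transpose 1 2 i)" for c i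
      by (simp_all add: sw_def ev_Const[OF is_hom_Const] ev_Var[OF is_hom_Const])
    define S where "S = fps_map sw"
    have hS: "is_hom S" unfolding S_def by (rule is_hom_fps_map[OF hsw])
    have SC: "S (\<kappa> c) = \<kappa> c" for c by (simp add: S_def fps_map_const[OF hsw] swC)
    have Sy: "S (y \<theta>) = y (\<sigma> \<theta>)" if "\<theta> \<in> Fib" for \<theta>
    proof -
      have "e (transpose 1 2 k) = e k" for k using e12 by (auto simp: transpose_def)
      then show ?thesis
        unfolding y_def hom_add[OF hS] hom_mult[OF hS] SC
        by (simp add: S_def fps_map_const[OF hsw] fps_map_X[OF hsw] swV \<beta>\<sigma>[OF that])
    qed
    \<comment> \<open>\<open>S\<close> only permutes the linear factors of \<open>G0\<close>, so it
      fixes \<open>G0\<close> and with it the coefficients \<open>a\<close>.\<close>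
    have "map_poly S G0 = (\<Prod>\<theta>\<in>Fib. [:- y (\<sigma> \<theta>), 1:])"
      unfolding G0_def hom_prod[OF is_hom_map_poly[OF hS]]
      by (intro prod.cong) (auto simp: map_hom_pCons[OF hS] hom_uminus[OF hS] hom_one[OF hS] Sy)
    also have "\<dots> = G0"
      unfolding G0_def
    proof (rule prod.reindex_bij_betw)
      show "bij_betw \<sigma> Fib Fib"
        using \<sigma>F by (intro bij_betw_byWitness[of _ \<sigma>]) (auto simp: \<sigma>_def)
    qed
    finally have SG: "map_poly S G = G"
      by (simp add: G_def hom_add[OF is_hom_map_poly[OF hS]] map_hom_pCons[OF hS] SC)
    have Sa: "S (a j) = a j" for j
      unfolding a_def by (subst (2) SG[symmetric]) (simp add: coeff_map_hom[OF hS])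
    \<comment> \<open>The residues are constants, so \<open>S (z \<eta>)\<close> is a root of the
      same equation with the same residue.\<close>
    have Sz: "S (z \<eta>) = z \<eta>" if \<eta>: "\<eta> \<in> \<Theta> - Fib" for \<eta>
    proof -
      obtain c where c: "c * poly (pderiv (map_poly (\<lambda>f. fps_nth f 0) (F \<eta>))) (Const (\<zeta> \<eta>)) = 1"
        using F0_unit[OF \<eta>] by blast
      have SF: "map_poly S (F \<eta>) = F \<eta>"
        by (simp add: F_def hom_diff[OF is_hom_map_poly[OF hS]] map_hom_pCons[OF hS] SC SG)
      have "poly (F \<eta>) (S (z \<eta>)) = S (poly (F \<eta>) (z \<eta>))"
        by (subst SF[symmetric]) (rule poly_map_hom[OF hS])
      then have "poly (F \<eta>) (S (z \<eta>)) = 0" using z(1)[OF \<eta>] by (simp add: hom_zero[OF hS])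
      moreover have "fps_nth (S (z \<eta>)) 0 = Const (\<zeta> \<eta>)" using z(2)[OF \<eta>] by (simp add: S_def fps_map_def swC)
      ultimately show ?thesis using hensel_root_unique[OF c _ _ z[OF \<eta>]] by blast
    qed
    have St: "S (t \<theta>) = t (\<sigma> \<theta>)" if "\<theta> \<in> \<Theta>" for \<theta>
      using that Sy[of \<theta>] Sz[of \<theta>] \<sigma>F[of \<theta>] \<sigma>other[of \<theta>] by (cases "\<theta> \<in> Fib") (auto simp: t_def)
    have "S (pt \<kappa> a t i) = pt \<kappa> a (\<lambda>s. t (\<sigma> s)) i" for i
      by (auto simp: pt_def Sa hom_sum[OF hS] hom_mult[OF hS] SC St hom_zero[OF hS] intro!: sum.cong)
    then have "S (pnt \<kappa> a t p) = pnt \<kappa> a (\<lambda>s. t (\<sigma> s)) p" for p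
      unfolding pnt_def by (subst hom_ev[OF hS hk]) (simp add: SC)
    then have "above a t a (\<lambda>s. t (\<sigma> s))"
      unfolding above_def by (metis hom_zero[OF hS])
    then show ?thesis using \<theta>1 \<theta>2 ne by (auto simp: \<sigma>_def Fib_def)
  qed
  have "generic_at \<theta>0 a t"
    unfolding generic_at_def
  proof (intro conjI impI)
    show "\<forall>p\<in>alg (fib \<theta>0). pnt \<kappa> a t p = 0 \<longrightarrow> (\<forall>J. good J \<longrightarrow> p \<in> J)"
    proof (intro ballI impI allI)
      fix p J assume "p \<in> alg (fib \<theta>0)" "pnt \<kappa> a t p = 0" "good J"
      then show "p \<in> J" by (rule base)
    qed
  qed (fact sol, fact swap)
  then show ?thesis by blast
qed

end

section \<open>Permutations of the fibres and the monodromy group\<close>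

lemma permutes_finite_order:
  assumes "finite A" "\<pi> permutes A"
  shows "\<exists>m>0. \<pi> ^^ m = id"
  using permutation_is_nilpotent permutes_imp_permutation[OF assms] by metis

lemma conjugate_transpose:
  assumes "bij h"
  shows "h \<circ> transpose x y \<circ> inv_into UNIV h = transpose (h x) (h y)"
proof
  fix s
  obtain r where r: "s = h r" using assms by (metis bij_pointE)
  have i: "inv_into UNIV h (h r) = r" for r using assms by (simp add: bij_is_inj)
  have e: "h r = h q \<longleftrightarrow> r = q" for r q using assms by (auto simp: bij_def inj_eq)
  show "(h \<circ> transpose x y \<circ> inv_into UNIV h) s = transpose (h x) (h y) s"
    by (auto simp: r i e transpose_def)
qed

lemma two_point_permutation:
  assumes "x1 \<in> A" "x2 \<in> A" "y1 \<in> A" "y2 \<in> A" "x1 \<noteq> x2" "y1 \<noteq> y2"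
  shows "\<exists>\<rho>. \<rho> permutes A \<and> \<rho> x1 = y1 \<and> \<rho> x2 = y2"
proof -
  \<comment> \<open>The image of \<open>x2\<close> under the first transposition. It differs from
    \<open>y1\<close>, so the second transposition leaves \<open>y1\<close> alone.\<close>
  define z where "z = transpose x1 y1 x2"
  have z: "z \<in> A" "z \<noteq> y1" using assms by (auto simp: z_def transpose_def)
  have "transpose z y2 \<circ> transpose x1 y1 permutes A"
    using assms z by (intro permutes_compose permutes_swap_id)
  moreover have "(transpose z y2 \<circ> transpose x1 y1) x1 = y1"
    using assms z by (simp add: transpose_apply_other)
  moreover have "(transpose z y2 \<circ> transpose x1 y1) x2 = y2" by (simp add: z_def[symmetric])
  ultimately show ?thesis by blast
qed

context cover
begin

definition fibre_perms :: "('c \<Rightarrow> 'c) set" where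
  "fibre_perms = {\<gamma>. \<gamma> permutes \<Theta> \<and> (\<forall>s\<in>\<Theta>. w (\<gamma> s) = w s)}"

lemma fibre_permsD:
  assumes "\<gamma> \<in> fibre_perms"
  shows "\<gamma> permutes \<Theta>" "s \<in> \<Theta> \<Longrightarrow> \<gamma> s \<in> \<Theta>" "s \<in> \<Theta> \<Longrightarrow> w (\<gamma> s) = w s" "bij \<gamma>"
  using assms by (auto simp: fibre_perms_def permutes_in_image permutes_bij)

lemma finite_fibre_perms: "finite fibre_perms"
  unfolding fibre_perms_def using finite_permutations[OF fin] by auto

lemma fibre_perms_id: "id \<in> fibre_perms"
  by (auto simp: fibre_perms_def permutes_id)

lemma fibre_perms_comp: "\<gamma> \<in> fibre_perms \<Longrightarrow> \<delta> \<in> fibre_perms \<Longrightarrow> \<gamma> \<circ> \<delta> \<in> fibre_perms"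
  by (auto simp: fibre_perms_def permutes_compose permutes_in_image)

lemma fibre_perms_inv:
  assumes "\<gamma> \<in> fibre_perms"
  shows "inv_into UNIV \<gamma> \<in> fibre_perms"
proof -
  have p: "inv_into UNIV \<gamma> permutes \<Theta>" using fibre_permsD(1)[OF assms] by (rule permutes_inv)
  have "w (inv_into UNIV \<gamma> s) = w s" if "s \<in> \<Theta>" for s
  proof -
    have "inv_into UNIV \<gamma> s \<in> \<Theta>" using that p by (simp add: permutes_in_image)
    from fibre_permsD(3)[OF assms this] show ?thesis
      using fibre_permsD(1)[OF assms] by (simp add: permutes_inverses)
  qed
  with p show ?thesis by (auto simp: fibre_perms_def)
qed

lemma fibre_perms_transpose: "x \<in> fib \<theta> \<Longrightarrow> y \<in> fib \<theta> \<Longrightarrow> transpose x y \<in> fibre_perms"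
  unfolding fibre_perms_def by (auto simp: fib_def transpose_def intro!: permutes_swap_id)

lemma solves_permute:
  assumes "solves \<iota> a t" "\<gamma> \<in> fibre_perms"
  shows "solves \<iota> a (\<lambda>s. t (\<gamma> s))"
proof -
  have "inj_on (t \<circ> \<gamma>) \<Theta>"
    using assms fibre_permsD(1)[OF assms(2)]
    by (intro comp_inj_on) (auto simp: permutes_inj_on permutes_image solves_def)
  then show ?thesis
    using assms fibre_permsD[OF assms(2)] by (simp add: solves_def o_def)
qed

lemma above_refl: "above a t a t"
  by (simp add: above_def)

lemma above_trans: "above a t a' t' \<Longrightarrow> above a' t' a'' t'' \<Longrightarrow> above a t a'' t''"
  by (simp add: above_def)

lemma above_permute:
  assumes "above a t a' t'" "\<gamma> \<in> fibre_perms"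
  shows "above a (\<lambda>s. t (\<gamma> s)) a' (\<lambda>s. t' (\<gamma> s))"
  unfolding above_def
proof (intro ballI impI)
  fix p :: "'c mpoly" assume "p \<in> mpolys (n + N)" and v: "pnt \<kappa> a (\<lambda>s. t (\<gamma> s)) p = 0"
  note e = pnt_permute[OF is_hom_\<kappa>, of \<gamma>, OF fibre_permsD(2)[OF assms(2)]]
  have "pnt \<kappa> a t (pnt Const Var (\<lambda>\<theta>. tau (\<gamma> \<theta>)) p) = 0" using v by (simp add: e)
  then have "pnt \<kappa> a' t' (pnt Const Var (\<lambda>\<theta>. tau (\<gamma> \<theta>)) p) = 0"
    using assms(1) permuted_in_mpolys unfolding above_def by blast
  then show "pnt \<kappa> a' (\<lambda>s. t' (\<gamma> s)) p = 0" by (simp add: e)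
qed

lemma generic_at_base:
  "generic_at \<theta> a t \<Longrightarrow> p \<in> alg (fib \<theta>) \<Longrightarrow> pnt \<kappa> a t p = 0 \<Longrightarrow> good J \<Longrightarrow> p \<in> J"
  unfolding generic_at_def by blast

text \<open>Prime avoidance: every point lies in the closure of a conjugate of a generic point, and the
  conjugating permutation may be chosen trivial on the distinguished fibre.\<close>

lemma conjugate_above:
  assumes g: "generic_at \<theta> a t" and \<theta>: "\<theta> \<in> \<Theta>" and s': "solves \<kappa> a' t'"
  shows "\<exists>\<gamma>\<in>fibre_perms. (\<forall>s\<in>fib \<theta>. \<gamma> s = s) \<and> above a (\<lambda>s. t (\<gamma> s)) a' t'"
proof (rule ccontr)
  assume neg: "\<not> ?thesis"
  define G where "G = {\<gamma> \<in> fibre_perms. \<forall>s\<in>fib \<theta>. \<gamma> s = s}"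
  have finG: "finite G" using finite_fibre_perms by (simp add: G_def)
  have "\<forall>\<gamma>\<in>G. \<exists>p. p \<in> mpolys (n + N) \<and> pnt \<kappa> a (\<lambda>s. t (\<gamma> s)) p = 0 \<and> pnt \<kappa> a' t' p \<noteq> 0"
    using neg by (auto simp: G_def above_def)
  then obtain f where f: "\<And>\<gamma>. \<gamma> \<in> G \<Longrightarrow> f \<gamma> \<in> mpolys (n + N)"
    "\<And>\<gamma>. \<gamma> \<in> G \<Longrightarrow> pnt \<kappa> a (\<lambda>s. t (\<gamma> s)) (f \<gamma>) = 0" "\<And>\<gamma>. \<gamma> \<in> G \<Longrightarrow> pnt \<kappa> a' t' (f \<gamma>) \<noteq> 0"
    by metis
  \<comment> \<open>The \<open>f \<gamma>\<close> witness that no conjugate specialises to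
    \<open>(a', t')\<close>. Their product vanishes at every conjugate, so it would vanish at
    \<open>(a', t')\<close> too, where the values lie in a domain and no factor is zero.\<close>
  define q where "q = (\<Prod>\<gamma>\<in>G. f \<gamma>)"
  have q: "q \<in> mpolys (n + N)" unfolding q_def by (intro subring_prod[OF is_subring_mpolys] f)
  have sol: "solves \<kappa> a t" using g by (simp add: generic_at_def)
  define F where "F = (\<lambda>\<gamma>. pnt \<kappa> a (\<lambda>s. t (\<gamma> s))) ` G"
  have "q \<in> {x. pnt \<kappa> a' t' x = 0}"
  proof (rule vanishing_imp_in_good_ideal[of F "fib \<theta>"])
    fix \<phi> assume "\<phi> \<in> F"
    then obtain \<gamma> where "\<gamma> \<in> G" "\<phi> = pnt \<kappa> a (\<lambda>s. t (\<gamma> s))" by (auto simp: F_def)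
    then show "is_hom \<phi> \<and> good {x. \<phi> x = 0}"
      using is_hom_pnt[OF is_hom_\<kappa>] good_kernel_pnt[OF is_hom_\<kappa> solves_permute[OF sol, of \<gamma>]] by (auto simp: G_def)
  next
    fix \<phi> x y assume \<phi>: "\<phi> \<in> F" and xy: "x \<in> \<Theta> - fib \<theta>" "y \<in> \<Theta> - fib \<theta>" "w x = w y"
    then obtain \<gamma> where \<gamma>: "\<gamma> \<in> G" "\<phi> = pnt \<kappa> a (\<lambda>s. t (\<gamma> s))" by (auto simp: F_def)
    have tr: "transpose x y \<in> fibre_perms" using xy by (intro fibre_perms_transpose[of _ x]) (auto simp: fib_def)
    have "transpose x y s = s" if "s \<in> fib \<theta>" for s using that xy by (intro transpose_apply_other) auto
    then have "\<gamma> \<circ> transpose x y \<in> G" using \<gamma> tr fibre_perms_comp by (auto simp: G_def)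
    then have "pnt \<kappa> a (\<lambda>s. t ((\<gamma> \<circ> transpose x y) s)) \<in> F" unfolding F_def by (rule imageI)
    moreover have "transpose x y s \<in> \<Theta>" if "s \<in> \<Theta>" for s using fibre_permsD(2)[OF tr that] .
    ultimately show "\<exists>\<phi>'\<in>F. (\<forall>c. \<phi>' (Const c) = \<phi> (Const c)) \<and> (\<forall>j\<in>{1..n}. \<phi>' (Var j) = \<phi> (Var j)) \<and>
        (\<forall>s\<in>\<Theta>. \<phi>' (tau s) = \<phi> (tau (transpose x y s)))"
      by (intro bexI) (auto simp: \<gamma>(2) pnt_Const is_hom_\<kappa> pnt_Var pnt_tau)
  next
    show "good {x. pnt \<kappa> a' t' x = 0}" by (rule good_kernel_pnt[OF is_hom_\<kappa> s'])
  next
    fix p assume p: "p \<in> alg (fib \<theta>)" and v: "\<And>\<phi>. \<phi> \<in> F \<Longrightarrow> \<phi> p = 0"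
    \<comment> \<open>By genericity the point itself already detects all relations in the
      distinguished fibre.\<close>
    have "id \<in> G" using fibre_perms_id by (simp add: G_def)
    then have "pnt \<kappa> a (\<lambda>s. t (id s)) p = 0" unfolding F_def by (intro v[unfolded F_def] imageI)
    then show "p \<in> {x. pnt \<kappa> a' t' x = 0}"
      using generic_at_base[OF g p _ good_kernel_pnt[OF is_hom_\<kappa> s']] by simp
  next
    show "q \<in> alg \<Theta>" using q by (simp add: mpolys_eq_alg)
  next
    fix \<phi> assume "\<phi> \<in> F"
    then obtain \<gamma> where \<gamma>: "\<gamma> \<in> G" "\<phi> = pnt \<kappa> a (\<lambda>s. t (\<gamma> s))" by (auto simp: F_def)
    show "\<phi> q = 0"
      unfolding q_def \<gamma>(2) hom_prod[OF is_hom_pnt[OF is_hom_\<kappa>]] using finG \<gamma>(1) f(2)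
      by (intro prod_zero) auto
  qed (auto simp: fib_def)
  then have "(\<Prod>\<gamma>\<in>G. pnt \<kappa> a' t' (f \<gamma>)) = 0"
    by (simp add: q_def hom_prod[OF is_hom_pnt[OF is_hom_\<kappa>]])
  then show False using f(3) finG by (simp add: prod_zero_iff)
qed

text \<open>The monodromy group of the point, with specialisations in place of field automorphisms.
  Finite order of permutations makes the one-sided condition define a group.\<close>

definition stabilizer :: "(nat \<Rightarrow> 'c mpoly fps) \<Rightarrow> ('c \<Rightarrow> 'c mpoly fps) \<Rightarrow> ('c \<Rightarrow> 'c) set" where
  "stabilizer a t = {h \<in> fibre_perms. above a t a (\<lambda>s. t (h s))}"

lemma stabilizer_comp:
  assumes "h \<in> stabilizer a t" "k \<in> stabilizer a t"
  shows "h \<circ> k \<in> stabilizer a t"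
proof -
  have "above a (\<lambda>s. t (k s)) a (\<lambda>s. t (h (k s)))"
    using above_permute[of a t a "\<lambda>s. t (h s)" k] assms by (auto simp: stabilizer_def)
  then show ?thesis using assms above_trans fibre_perms_comp by (auto simp: stabilizer_def)
qed

lemma stabilizer_funpow: "h \<in> stabilizer a t \<Longrightarrow> h ^^ k \<in> stabilizer a t"
proof (induction k)
  case 0
  then show ?case using fibre_perms_id by (auto simp: stabilizer_def above_refl id_def)
next
  case (Suc k)
  then show ?case unfolding funpow.simps(2) by (intro stabilizer_comp)
qed

lemma stabilizer_inv:
  assumes "h \<in> stabilizer a t"
  shows "inv_into UNIV h \<in> stabilizer a t"
proof -
  have h: "h permutes \<Theta>" using assms fibre_permsD(1) by (auto simp: stabilizer_def)
  obtain m where m: "m > 0" "h ^^ m = id" using permutes_finite_order[OF fin h] by blast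
  have "h \<circ> h ^^ (m - 1) = id" using m by (metis Suc_pred' funpow.simps(2))
  then have "inv_into UNIV h = h ^^ (m - 1)"
    using permutes_bij[OF h] by (metis bij_is_inj comp_assoc inv_o_cancel comp_id id_comp)
  then show ?thesis using stabilizer_funpow[OF assms] by metis
qed

text \<open>As \<open>\<pi>\<close> has finite order, the chain of specialisations of its iterates closes up.\<close>

lemma above_conjugate_reverse:
  assumes \<pi>: "\<pi> \<in> fibre_perms" and ab: "above a (\<lambda>s. t (\<pi> s)) a t"
  shows "\<pi> \<in> stabilizer a t"
proof -
  have pow: "\<pi> ^^ k \<in> fibre_perms" for k
  proof (induction k)
    case (Suc k)
    then show ?case unfolding funpow.simps(2) by (rule fibre_perms_comp[OF \<pi>])
  qed (simp only: funpow.simps(1) fibre_perms_id)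
  have step: "above a (\<lambda>s. t ((\<pi> ^^ Suc k) s)) a (\<lambda>s. t ((\<pi> ^^ k) s))" for k
    using above_permute[OF ab pow[of k]] by simp
  have chain: "above a (\<lambda>s. t ((\<pi> ^^ (Suc k)) s)) a (\<lambda>s. t (\<pi> s))" for k
  proof (induction k)
    case 0
    show ?case by (simp add: above_refl)
  next
    case (Suc k)
    show ?case by (rule above_trans[OF step Suc])
  qed
  obtain m where m: "m > 0" "\<pi> ^^ m = id"
    using permutes_finite_order[OF fin fibre_permsD(1)[OF \<pi>]] by blast
  have "above a t a (\<lambda>s. t (\<pi> s))" using chain[of "m - 1"] m by simp
  with \<pi> show ?thesis by (simp add: stabilizer_def)
qed

text \<open>Generic points attached to different fibres are equivalent up to relabelling, so the
  transposition known at the fibre of \<open>\<theta>\<close> also acts on \<open>(a0, t0)\<close>.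
  Since independence lets prime avoidance choose relabellings trivial on this fibre, the stabilizer
  induces every permutation of it, and conjugation yields the required transposition.\<close>

lemma transpositions_stabilize:
  assumes g0: "generic_at \<theta>0 a0 t0" and \<theta>0: "\<theta>0 \<in> \<Theta>" and \<theta>: "\<theta> \<in> \<Theta>"
    and x: "x \<in> fib \<theta>" and y: "y \<in> fib \<theta>"
  shows "transpose x y \<in> stabilizer a0 t0"
proof (cases "x = y")
  case True
  then show ?thesis using fibre_perms_id by (simp add: stabilizer_def above_refl)
next
  case ne: False
  have "card {x, y} \<le> card (fib \<theta>)" using x y fin by (intro card_mono) (auto simp: fib_def)
  then have n2: "n \<ge> 2" using ne fibres[OF \<theta>] by (simp add: fib_def)
  have sol0: "solves \<kappa> a0 t0" using g0 by (simp add: generic_at_def)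
  obtain a1 t1 where g1: "generic_at \<theta> a1 t1" using generic_point_exists[OF \<theta>] by blast
  have sol1: "solves \<kappa> a1 t1" using g1 by (simp add: generic_at_def)
  obtain \<theta>1 \<theta>2 where th: "\<theta>1 \<in> fib \<theta>" "\<theta>2 \<in> fib \<theta>" "\<theta>1 \<noteq> \<theta>2"
    and sw: "above a1 t1 a1 (\<lambda>s. t1 (transpose \<theta>1 \<theta>2 s))"
    using g1 n2 unfolding generic_at_def by blast
  define \<sigma> where "\<sigma> = transpose \<theta>1 \<theta>2"
  have \<sigma>: "\<sigma> \<in> fibre_perms" unfolding \<sigma>_def by (rule fibre_perms_transpose[OF th(1,2)])
  obtain \<gamma> where \<gamma>: "\<gamma> \<in> fibre_perms" "\<And>s. s \<in> fib \<theta> \<Longrightarrow> \<gamma> s = s" "above a1 (\<lambda>s. t1 (\<gamma> s)) a0 t0"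
    using conjugate_above[OF g1 \<theta> sol0] by blast
  obtain \<delta> where \<delta>: "\<delta> \<in> fibre_perms" "above a0 (\<lambda>s. t0 (\<delta> s)) a1 t1"
    using conjugate_above[OF g0 \<theta>0 sol1] by blast
  have d\<gamma>: "above a0 (\<lambda>s. t0 (\<delta> (\<gamma> s))) a1 (\<lambda>s. t1 (\<gamma> s))" using above_permute[OF \<delta>(2) \<gamma>(1)] .
  \<comment> \<open>The two specialisations compose to one from a relabelling of
    \<open>(a0, t0)\<close> to itself. By finite order this can be reversed, and so can the
    specialisation given by \<open>\<gamma>\<close>.\<close>
  have "\<delta> \<circ> \<gamma> \<in> stabilizer a0 t0"
    using above_trans[OF d\<gamma> \<gamma>(3)] by (intro above_conjugate_reverse fibre_perms_comp \<delta> \<gamma>) simp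
  then have eq: "above a0 t0 a1 (\<lambda>s. t1 (\<gamma> s))"
    using d\<gamma> above_trans by (auto simp: stabilizer_def)
  have "\<sigma> \<in> stabilizer a0 t0"
  proof -
    \<comment> \<open>\<open>\<gamma>\<close> fixes the fibre pointwise and preserves its
      complement, where \<open>\<sigma>\<close> is trivial.\<close>
    have comm: "\<sigma> (\<gamma> s) = \<gamma> (\<sigma> s)" for s
    proof (cases "s \<in> fib \<theta>")
      case True
      then have "\<sigma> s \<in> fib \<theta>" using th by (auto simp: \<sigma>_def transpose_def)
      then show ?thesis using \<gamma>(2) True by simp
    next
      case False
      have "\<gamma> s \<notin> fib \<theta>"
      proof
        assume a: "\<gamma> s \<in> fib \<theta>"
        then have "\<gamma> (\<gamma> s) = \<gamma> s" by (rule \<gamma>(2))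
        then have "\<gamma> s = s" using fibre_permsD(4)[OF \<gamma>(1)] by (metis bij_is_inj injD)
        then show False using a False by simp
      qed
      then show ?thesis using False th by (auto simp: \<sigma>_def transpose_def)
    qed
    have "above a1 (\<lambda>s. t1 (\<gamma> s)) a1 (\<lambda>s. t1 (\<gamma> (\<sigma> s)))"
      using above_permute[OF sw[folded \<sigma>_def] \<gamma>(1)] by (simp add: comm)
    moreover have "above a1 (\<lambda>s. t1 (\<gamma> (\<sigma> s))) a0 (\<lambda>s. t0 (\<sigma> s))" by (rule above_permute[OF \<gamma>(3) \<sigma>])
    ultimately show ?thesis using eq above_trans \<sigma> unfolding stabilizer_def by blast
  qed
  \<comment> \<open>Prime avoidance towards the point relabelled by \<open>\<rho>\<close> will give
    a correction \<open>k\<close> that is trivial on the fibre, so that \<open>\<rho>\<close>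
    composed with the inverse of \<open>k\<close> stabilizes and still acts as \<open>\<rho>\<close>
    there.\<close>
  obtain \<rho> where \<rho>: "\<rho> permutes fib \<theta>" "\<rho> \<theta>1 = x" "\<rho> \<theta>2 = y"
    using two_point_permutation[OF th(1,2) x y th(3) ne] by blast
  have \<rho>P: "\<rho> \<in> fibre_perms"
  proof -
    have "\<rho> permutes \<Theta>" using \<rho>(1) by (rule permutes_subset) (auto simp: fib_def)
    moreover have "w (\<rho> s) = w s" for s
      using \<rho>(1) permutes_in_image[OF \<rho>(1), of s] by (cases "s \<in> fib \<theta>") (auto simp: fib_def permutes_not_in)
    ultimately show ?thesis by (simp add: fibre_perms_def)
  qed
  obtain \<gamma>' where \<gamma>': "\<gamma>' \<in> fibre_perms" "\<And>s. s \<in> fib \<theta> \<Longrightarrow> \<gamma>' s = s" "above a1 (\<lambda>s. t1 (\<gamma>' s)) a0 (\<lambda>s. t0 (\<rho> s))"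
    using conjugate_above[OF g1 \<theta> solves_permute[OF sol0 \<rho>P]] by blast
  define k where "k = inv_into UNIV \<gamma> \<circ> \<gamma>'"
  have k: "k \<in> fibre_perms" unfolding k_def by (intro fibre_perms_comp fibre_perms_inv \<gamma> \<gamma>')
  have kfix: "k s = s" if "s \<in> fib \<theta>" for s
    using inv_f_eq[OF bij_is_inj[OF fibre_permsD(4)[OF \<gamma>(1)]] \<gamma>(2)[OF that]] \<gamma>'(2)[OF that] by (simp add: k_def)
  have "above a0 (\<lambda>s. t0 (k s)) a1 (\<lambda>s. t1 (\<gamma> (k s)))" by (rule above_permute[OF eq k])
  moreover have "\<gamma> (k s) = \<gamma>' s" for s
    using fibre_permsD(4)[OF \<gamma>(1)] by (simp add: k_def bij_is_surj surj_f_inv_f)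
  ultimately have "above a0 (\<lambda>s. t0 (k s)) a0 (\<lambda>s. t0 (\<rho> s))" using \<gamma>'(3) above_trans by simp
  from above_permute[OF this fibre_perms_inv[OF k]]
  have "above a0 t0 a0 (\<lambda>s. t0 (\<rho> (inv_into UNIV k s)))"
    using fibre_permsD(4)[OF k] by (simp add: bij_is_surj surj_f_inv_f)
  then have hS: "\<rho> \<circ> inv_into UNIV k \<in> stabilizer a0 t0"
    using fibre_perms_comp[OF \<rho>P fibre_perms_inv[OF k]] by (simp add: stabilizer_def)
  define h where "h = \<rho> \<circ> inv_into UNIV k"
  have hb: "bij h" using hS fibre_permsD(4) by (auto simp: h_def stabilizer_def)
  have inv_k: "inv_into UNIV k s = s" if "s \<in> fib \<theta>" for s
    by (rule inv_f_eq[OF bij_is_inj[OF fibre_permsD(4)[OF k]] kfix[OF that]])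
  have "h \<theta>1 = x" "h \<theta>2 = y" using \<rho> th inv_k by (auto simp: h_def)
  then have "transpose x y = h \<circ> \<sigma> \<circ> inv_into UNIV h" using conjugate_transpose[OF hb, of \<theta>1 \<theta>2] by (simp add: \<sigma>_def)
  moreover have "h \<circ> \<sigma> \<circ> inv_into UNIV h \<in> stabilizer a0 t0"
    using hS \<open>\<sigma> \<in> stabilizer a0 t0\<close> by (intro stabilizer_comp stabilizer_inv) (auto simp: h_def)
  ultimately show ?thesis by simp
qed

text \<open>The product vanishes at the generic point, whose coordinates lie in a domain, so one
  factor does. With the transpositions in the stabilizer, the relabelled generic points are
  symmetric enough to carry this over to every solution, including those on
  \<open>P = 0\<close>.\<close>

lemma solutions_irreducible:
  assumes P: "P \<in> mpolys n" "P \<noteq> 0" and p: "p \<in> mpolys (n + N)" and q: "q \<in> mpolys (n + N)"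
    and van: "\<And>a t. solves (\<lambda>c. c) a t \<Longrightarrow> ev (\<lambda>c. c) a P \<noteq> 0 \<Longrightarrow> pnt (\<lambda>c. c) a t (p * q) = 0"
  shows "(\<forall>a t. solves (\<lambda>c. c) a t \<longrightarrow> pnt (\<lambda>c. c) a t p = 0) \<or> (\<forall>a t. solves (\<lambda>c. c) a t \<longrightarrow> pnt (\<lambda>c. c) a t q = 0)"
proof -
  have pq: "p * q \<in> mpolys (n + N)" by (rule subring_mult[OF is_subring_mpolys p q])
  show ?thesis
  proof (cases "\<Theta> = {}")
    case True
    \<comment> \<open>Without labels all conditions on roots are void and the zero ideal is
      good.\<close>
    have "good {0}" unfolding good_def using True by (auto simp: is_ideal_def)
    then have "p * q \<in> {0}" by (rule vanishing_at_solutions[OF P _ pq van])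
    then have "p = 0 \<or> q = 0" by simp
    then show ?thesis by (auto simp: hom_zero[OF is_hom_pnt[OF is_hom_id]])
  next
    case False
    then obtain \<theta>0 where \<theta>0: "\<theta>0 \<in> \<Theta>" by blast
    obtain a0 t0 where g0: "generic_at \<theta>0 a0 t0" using generic_point_exists[OF \<theta>0] by blast
    have sol0: "solves \<kappa> a0 t0" using g0 by (simp add: generic_at_def)
    have "p * q \<in> {x. pnt \<kappa> a0 t0 x = 0}"
      by (rule vanishing_at_solutions[OF P good_kernel_pnt[OF is_hom_\<kappa> sol0] pq van])
    then have "pnt \<kappa> a0 t0 p = 0 \<or> pnt \<kappa> a0 t0 q = 0"
      by (simp add: hom_mult[OF is_hom_pnt[OF is_hom_\<kappa>]])
    moreover have "pnt (\<lambda>c. c) a t r = 0"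
      if r: "r \<in> mpolys (n + N)" and r0: "pnt \<kappa> a0 t0 r = 0" and sol: "solves (\<lambda>c. c) a t" for r a t
    proof -
      define F where "F = (\<lambda>h. pnt \<kappa> a0 (\<lambda>s. t0 (h s))) ` stabilizer a0 t0"
      have "r \<in> {x. pnt (\<lambda>c. c) a t x = 0}"
      proof (rule vanishing_imp_in_good_ideal[of F "fib \<theta>0"])
        fix \<phi> assume "\<phi> \<in> F"
        then obtain h where "h \<in> fibre_perms" "\<phi> = pnt \<kappa> a0 (\<lambda>s. t0 (h s))" by (auto simp: F_def stabilizer_def)
        then show "is_hom \<phi> \<and> good {x. \<phi> x = 0}"
          using is_hom_pnt[OF is_hom_\<kappa>] good_kernel_pnt[OF is_hom_\<kappa> solves_permute[OF sol0, of h]] by auto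
      next
        fix \<phi> x y assume \<phi>: "\<phi> \<in> F" and xy: "x \<in> \<Theta> - fib \<theta>0" "y \<in> \<Theta> - fib \<theta>0" "w x = w y"
        then obtain h where h: "h \<in> stabilizer a0 t0" "\<phi> = pnt \<kappa> a0 (\<lambda>s. t0 (h s))" by (auto simp: F_def)
        have xf: "x \<in> fib x" "y \<in> fib x" "x \<in> \<Theta>" using xy by (auto simp: fib_def)
        have tr: "transpose x y \<in> stabilizer a0 t0" by (rule transpositions_stabilize[OF g0 \<theta>0 xf(3) xf(1,2)])
        have "pnt \<kappa> a0 (\<lambda>s. t0 ((h \<circ> transpose x y) s)) \<in> F"
          using stabilizer_comp[OF h(1) tr] unfolding F_def by (rule imageI)
        moreover have "transpose x y s \<in> \<Theta>" if "s \<in> \<Theta>" for s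
          using fibre_permsD(2)[OF _ that, of "transpose x y"] tr by (simp add: stabilizer_def)
        ultimately show "\<exists>\<phi>'\<in>F. (\<forall>c. \<phi>' (Const c) = \<phi> (Const c)) \<and> (\<forall>j\<in>{1..n}. \<phi>' (Var j) = \<phi> (Var j)) \<and>
            (\<forall>s\<in>\<Theta>. \<phi>' (tau s) = \<phi> (tau (transpose x y s)))"
          by (intro bexI) (auto simp: h(2) pnt_Const is_hom_\<kappa> pnt_Var pnt_tau)
      next
        show gd: "good {x. pnt (\<lambda>c. c) a t x = 0}" by (rule good_kernel_pnt[OF is_hom_id sol])
        fix p assume p: "p \<in> alg (fib \<theta>0)" and v: "\<And>\<phi>. \<phi> \<in> F \<Longrightarrow> \<phi> p = 0"
        have "id \<in> stabilizer a0 t0" using fibre_perms_id by (simp add: stabilizer_def above_refl)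
        then have "pnt \<kappa> a0 (\<lambda>s. t0 (id s)) p = 0" by (intro v[unfolded F_def] imageI)
        then show "p \<in> {x. pnt (\<lambda>c. c) a t x = 0}"
          using generic_at_base[OF g0 p _ gd] by simp
      next
        show "r \<in> alg \<Theta>" using r by (simp add: mpolys_eq_alg)
        fix \<phi> assume "\<phi> \<in> F"
        then obtain h where h: "h \<in> stabilizer a0 t0" "\<phi> = pnt \<kappa> a0 (\<lambda>s. t0 (h s))" by (auto simp: F_def)
        then show "\<phi> r = 0" using r r0 by (simp add: stabilizer_def above_def)
      qed (auto simp: fib_def)
      then show ?thesis by simp
    qed
    ultimately show ?thesis using p q by blast
  qed
qed

end

subsection \<open>Points over pseudo algebraically closed fields\<close>

definition K_coeffs :: "'k::field alg_closure mpoly set" where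
  "K_coeffs = {p. \<forall>m. Poly_Mapping.lookup p m \<in> range to_ac}"

lemma is_subring_range_to_ac: "is_subring (range to_ac)"
  unfolding is_subring_def
  by (auto simp flip: to_ac_1 to_ac_diff to_ac_mult)

lemma is_subring_K_coeffs: "is_subring (K_coeffs :: 'k::field alg_closure mpoly set)"
  unfolding is_subring_def
proof (intro conjI ballI)
  note R = is_subring_range_to_ac
  show "1 \<in> (K_coeffs :: 'k alg_closure mpoly set)"
    unfolding K_coeffs_def by (auto simp: lookup_one when_def subring_zero[OF R] subring_one[OF R])
  fix p q :: "'k alg_closure mpoly" assume p: "p \<in> K_coeffs" and q: "q \<in> K_coeffs"
  show "p - q \<in> K_coeffs"
    using p q unfolding K_coeffs_def by (auto simp: lookup_minus intro!: subring_diff[OF R])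
  have "p * q = (\<Sum>m\<in>Poly_Mapping.keys p. \<Sum>m'\<in>Poly_Mapping.keys q.
      Poly_Mapping.single (m + m') (Poly_Mapping.lookup p m * Poly_Mapping.lookup q m'))"
    by (subst (1) mpoly_sum_singles[of p], subst (1) mpoly_sum_singles[of q])
       (simp only: sum_product mult_single)
  then show "p * q \<in> K_coeffs"
    using p q unfolding K_coeffs_def
    by (auto simp: lookup_sum lookup_single when_def subring_zero[OF R]
        intro!: subring_sum[OF R] subring_mult[OF R])
qed

lemma K_mpolys_eq: "K_mpolys n = mpolys n \<inter> K_coeffs"
  by (auto simp: K_mpolys_def K_coeffs_def)

lemma is_subring_K_mpolys: "is_subring (K_mpolys n)"
  using is_subring_K_coeffs is_subring_mpolys unfolding K_mpolys_eq is_subring_def by auto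

lemma Const_to_ac_K_mpolys: "Const (to_ac c) \<in> K_mpolys n"
proof -
  have "Const (to_ac c) \<in> K_coeffs"
    using subring_zero[OF is_subring_range_to_ac]
    by (auto simp: K_coeffs_def Const_def lookup_single when_def)
  then show ?thesis by (simp add: K_mpolys_eq Const_in_mpolys)
qed

lemma Var_K_mpolys: "i \<in> {1..n} \<Longrightarrow> Var i \<in> K_mpolys n"
proof -
  assume i: "i \<in> {1..n}"
  have "Var i \<in> K_coeffs"
    using subring_zero[OF is_subring_range_to_ac] subring_one[OF is_subring_range_to_ac]
    by (auto simp: K_coeffs_def Var_def lookup_single when_def)
  then show ?thesis by (simp only: K_mpolys_eq Var_in_mpolys[OF i] Int_iff simp_thms)
qed

lemma K_mpolys_mono: "n \<le> k \<Longrightarrow> K_mpolys n \<subseteq> K_mpolys k"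
  using mpolys_mono by (auto simp: K_mpolys_eq)

text \<open>The multipliers may involve variables beyond the first \<open>m\<close>; setting these
  to \<open>0\<close> repairs them without changing \<open>p\<close> or the generators.\<close>

lemma ideal_gen_imp_mpoly_ideal:
  fixes p :: "'a::comm_ring_1 mpoly"
  assumes "p \<in> ideal_gen E" "p \<in> mpolys m" "E \<subseteq> mpolys m"
  shows "p \<in> mpoly_ideal m E"
proof -
  define tr :: "'a mpoly \<Rightarrow> 'a mpoly" where "tr = ev Const (\<lambda>i. if i \<in> {1..m} then Var i else 0)"
  have h: "is_hom tr" unfolding tr_def by (rule is_hom_ev[OF is_hom_Const])
  have fix_tr: "tr q = q" if "q \<in> mpolys m" for q
    unfolding tr_def by (subst ev_cong[OF that, of _ Var]) (auto simp: ev_Const_Var)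
  have tr_in: "tr q \<in> mpolys m" for q
  proof -
    note S = is_subring_mpolys[of m]
    have "(if i \<in> {1..m} then Var i else 0) \<in> (mpolys m :: 'a mpoly set)" for i
      using Var_in_mpolys[of i m, where 'a = 'a] subring_zero[OF S] by (auto simp del: One_nat_def)
    then show ?thesis
      unfolding tr_def ev_def mono_eval_def by (intro subring_intros[OF S] Const_in_mpolys)
  qed
  obtain F q where F: "finite F" "F \<subseteq> E" "p = (\<Sum>s\<in>F. q s * s)"
    using ideal_gen_explicit[OF assms(1)] by blast
  have "p = tr (\<Sum>s\<in>F. q s * s)" using fix_tr[OF assms(2)] F(3) by simp
  also have "\<dots> = (\<Sum>s\<in>F. tr (q s) * s)"
    unfolding hom_sum[OF h] hom_mult[OF h] using F(2) assms(3) fix_tr by (intro sum.cong) auto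
  finally show ?thesis
    unfolding mpoly_ideal_def using F tr_in by (intro CollectI exI[of _ F] exI[of _ "\<lambda>s. tr (q s)"]) auto
qed

text \<open>\<open>prime\<close> is geometric irreducibility in terms of polynomials.
  \<open>radical\<close> says that the equations over K generate the whole vanishing ideal, as being
  defined over K demands.\<close>

lemma pac_point:
  fixes E :: "'k::field alg_closure mpoly set"
  assumes pac: "pac_field TYPE('k)" and E: "E \<subseteq> K_mpolys m"
    and V: "V = {x \<in> affine_space m. \<forall>p\<in>E. ev (\<lambda>c. c) x p = 0}" and ne: "V \<noteq> {}"
    and radical: "\<And>p. p \<in> mpolys m \<Longrightarrow> (\<And>x. x \<in> V \<Longrightarrow> ev (\<lambda>c. c) x p = 0) \<Longrightarrow> p \<in> ideal_gen E"
    and prime: "\<And>p q. p \<in> mpolys m \<Longrightarrow> q \<in> mpolys m \<Longrightarrow> (\<And>x. x \<in> V \<Longrightarrow> ev (\<lambda>c. c) x (p * q) = 0) \<Longrightarrow>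
      (\<forall>x\<in>V. ev (\<lambda>c. c) x p = 0) \<or> (\<forall>x\<in>V. ev (\<lambda>c. c) x q = 0)"
  shows "\<exists>x\<in>V. \<forall>i. x i \<in> range to_ac"
proof -
  have Em: "E \<subseteq> mpolys m" using E by (auto simp: K_mpolys_eq)
  note h = is_hom_ev[OF is_hom_id]
  have "zariski_closed m V"
    unfolding zariski_closed_def mpoly_eval_ev using Em V by blast
  moreover have "defined_over_K m V"
    unfolding defined_over_K_def
  proof
    have EI: "E \<subseteq> vanishing_ideal m V \<inter> K_mpolys m"
      using E Em V by (auto simp: vanishing_ideal_def mpoly_eval_ev)
    show "vanishing_ideal m V \<subseteq> mpoly_ideal m (vanishing_ideal m V \<inter> K_mpolys m)"
    proof
      fix p assume "p \<in> vanishing_ideal m V"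
      then have "p \<in> mpolys m" "p \<in> ideal_gen E"
        using radical by (auto simp: vanishing_ideal_def mpoly_eval_ev)
      then have "p \<in> mpoly_ideal m E" using Em by (intro ideal_gen_imp_mpoly_ideal)
      then show "p \<in> mpoly_ideal m (vanishing_ideal m V \<inter> K_mpolys m)"
        using EI unfolding mpoly_ideal_def by blast
    qed
    show "mpoly_ideal m (vanishing_ideal m V \<inter> K_mpolys m) \<subseteq> vanishing_ideal m V"
    proof
      fix p assume "p \<in> mpoly_ideal m (vanishing_ideal m V \<inter> K_mpolys m)"
      then obtain F q where F: "finite F" "F \<subseteq> vanishing_ideal m V" "\<And>s. s \<in> F \<Longrightarrow> q s \<in> mpolys m"
        "p = (\<Sum>s\<in>F. q s * s)" unfolding mpoly_ideal_def by blast
      have "p \<in> mpolys m"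
        unfolding F(4) using F by (intro subring_sum[OF is_subring_mpolys] subring_mult[OF is_subring_mpolys]) (auto simp: vanishing_ideal_def)
      moreover have "ev (\<lambda>c. c) x p = 0" if "x \<in> V" for x
        unfolding F(4) hom_sum[OF h] hom_mult[OF h] using F(2) that
        by (intro sum.neutral) (auto simp: vanishing_ideal_def mpoly_eval_ev)
      ultimately show "p \<in> vanishing_ideal m V" by (auto simp: vanishing_ideal_def mpoly_eval_ev)
    qed
  qed
  moreover have "zariski_irreducible m V"
    unfolding zariski_irreducible_def
  proof (intro allI impI, elim conjE)
    fix A B assume A: "zariski_closed m A" and B: "zariski_closed m B" and AB: "V \<subseteq> A \<union> B"
    have VA: "V \<subseteq> affine_space m" by (simp add: V)
    obtain S where S: "S \<subseteq> mpolys m" "A = {x \<in> affine_space m. \<forall>p\<in>S. ev (\<lambda>c. c) x p = 0}"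
      using A unfolding zariski_closed_def mpoly_eval_ev by blast
    obtain T where T: "T \<subseteq> mpolys m" "B = {x \<in> affine_space m. \<forall>p\<in>T. ev (\<lambda>c. c) x p = 0}"
      using B unfolding zariski_closed_def mpoly_eval_ev by blast
    show "V \<subseteq> A \<or> V \<subseteq> B"
    proof (rule ccontr)
      assume "\<not> ?thesis"
      then obtain x y where x: "x \<in> V" "x \<notin> A" and y: "y \<in> V" "y \<notin> B" by blast
      then obtain p q where p: "p \<in> S" "ev (\<lambda>c. c) x p \<noteq> 0" and q: "q \<in> T" "ev (\<lambda>c. c) y q \<noteq> 0"
        using S T VA by blast
      have "ev (\<lambda>c. c) v (p * q) = 0" if "v \<in> V" for v
      proof -
        have "v \<in> A \<or> v \<in> B" using AB that by blast
        then have "ev (\<lambda>c. c) v p = 0 \<or> ev (\<lambda>c. c) v q = 0" using S T p q by blast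
        then show ?thesis by (auto simp: hom_mult[OF h])
      qed
      then have "(\<forall>x\<in>V. ev (\<lambda>c. c) x p = 0) \<or> (\<forall>x\<in>V. ev (\<lambda>c. c) x q = 0)"
        using p q S T by (intro prime) auto
      then show False using x y p q by blast
    qed
  qed
  ultimately have "K_points V \<noteq> {}"
    using pac ne unfolding pac_field_def abs_irreducible_K_variety_def by blast
  then show ?thesis by (auto simp: K_points_def)
qed

lemma interpolation_exists:
  fixes t :: "'i \<Rightarrow> 'c::field"
  assumes "finite A" "inj_on t A"
  shows "\<exists>v. (\<forall>i \<ge> card A. poly.coeff v i = 0) \<and> (\<forall>x\<in>A. poly v (t x) = f x)"
  using assms
proof (induction A rule: finite_induct)
  case empty
  show ?case by (intro exI[of _ 0]) auto
next
  case (insert x A)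
  then obtain v where v: "\<And>i. i \<ge> card A \<Longrightarrow> poly.coeff v i = 0" "\<And>y. y \<in> A \<Longrightarrow> poly v (t y) = f y" by auto
  define d where "d = (\<Prod>y\<in>A. [:- t y, 1:])"
  have dd: "degree d = card A" unfolding d_def by (subst degree_prod_eq_sum_degree) auto
  have d0: "poly d (t y) = 0" if "y \<in> A" for y
    unfolding d_def poly_prod using that insert by (intro prod_zero) auto
  have dx: "poly d (t x) \<noteq> 0"
    using insert by (auto simp: d_def poly_prod prod_zero_iff inj_on_def)
  define v' where "v' = v + smult ((f x - poly v (t x)) / poly d (t x)) d"
  have "poly v' (t y) = f y" if "y \<in> insert x A" for y
    using that v d0 dx by (auto simp: v'_def)
  moreover have "poly.coeff v' i = 0" if "i \<ge> card (insert x A)" for i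
    using that v insert dd by (auto simp: v'_def coeff_eq_0)
  ultimately show ?case by blast
qed

lemma poly_zero_if_many_roots:
  fixes p :: "'a::idom poly"
  assumes "finite A" "inj_on t A" "\<And>i. i \<ge> card A \<Longrightarrow> poly.coeff p i = 0" "\<And>x. x \<in> A \<Longrightarrow> poly p (t x) = 0"
  shows "p = 0"
proof (rule ccontr)
  assume nz: "p \<noteq> 0"
  have "card A = card (t ` A)" using assms(2) by (simp add: card_image)
  also have "\<dots> \<le> card {x. poly p x = 0}"
    using assms(4) by (intro card_mono poly_roots_finite[OF nz]) auto
  also have "\<dots> \<le> degree p" by (rule card_poly_roots_bound[OF nz])
  finally have "lead_coeff p = 0" using assms(3) by blast
  with nz show False by simp
qed

text \<open>Adds the field of definition. Having as many roots as its degree makes \<open>M\<close>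
  separable, and \<open>w\<close> is given by a polynomial over K.\<close>

locale K_cover = cover \<Theta> w n for \<Theta> :: "'k::field alg_closure set" and w n +
  fixes M W :: "'k poly" and P :: "'k alg_closure mpoly"
  assumes M_monic: "lead_coeff M = 1"
    and roots_M: "\<Theta> = {\<theta>. poly (map_poly to_ac M) \<theta> = 0}" and card_roots: "card \<Theta> = degree M"
    and w_W: "\<And>\<theta>. \<theta> \<in> \<Theta> \<Longrightarrow> w \<theta> = poly (map_poly to_ac W) \<theta>"
    and P: "P \<in> K_mpolys n" "P \<noteq> 0"
begin

lemma P_mpolys: "P \<in> mpolys n" using P by (simp add: K_mpolys_eq)

text \<open>Coordinates for the \<open>n\<close> coefficients of \<open>g\<close>, the
  \<open>N\<close> coefficients of \<open>XR\<close>, the \<open>N\<close> coefficients of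
  \<open>VR\<close>, and \<open>z\<close>.\<close>

definition m :: nat where "m = n + 2 * N + 1"

definition z :: "'k alg_closure mpoly" where "z = Var m"

definition XR :: "'k alg_closure mpoly poly" where
  "XR = (\<Sum>s<N. Polynomial.monom (Var (n + 1 + s)) s)"

definition VR :: "'k alg_closure mpoly poly" where
  "VR = (\<Sum>s<N. Polynomial.monom (Var (n + N + 1 + s)) s)"

definition MR :: "'k alg_closure mpoly poly" where
  "MR = map_poly (\<lambda>c. Const (to_ac c)) M"

definition WR :: "'k alg_closure mpoly poly" where
  "WR = map_poly (\<lambda>c. Const (to_ac c)) W"

lemma is_hom_Cto: "is_hom (\<lambda>c::'k. Const (to_ac c))"
  by (rule is_hom_comp[OF is_hom_Const is_hom_to_ac])

lemma map_Cto: "map_poly (\<lambda>c::'k. Const (to_ac c)) p = map_poly Const (map_poly to_ac p)"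
  by (rule poly_eqI) (simp add: coeff_map_hom[OF is_hom_Cto] coeff_map_hom[OF is_hom_Const] coeff_map_hom[OF is_hom_to_ac])

lemma poly_MR: "\<theta> \<in> \<Theta> \<Longrightarrow> poly MR (Const \<theta>) = 0"
  unfolding MR_def map_Cto poly_map_hom[OF is_hom_Const] by (simp add: roots_M hom_zero[OF is_hom_Const])

lemma poly_WR: "\<theta> \<in> \<Theta> \<Longrightarrow> poly WR (Const \<theta>) = Const (w \<theta>)"
  unfolding WR_def map_Cto poly_map_hom[OF is_hom_Const] by (simp add: w_W)

lemma poly_XR: "poly XR (Const \<theta>) = tau \<theta>"
  by (simp add: XR_def tau_def poly_sum poly_monom hom_power[OF is_hom_Const] mult.commute)

lemma degree_MR: "degree MR = N" and MR_monic: "lead_coeff MR = 1"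
  unfolding MR_def using lead_coeff_monic_map_hom[OF is_hom_Cto M_monic] card_roots by (auto simp: N_def)

lemma over_K:
  "MR \<in> polys_over (K_mpolys m)" "WR \<in> polys_over (K_mpolys m)"
  "XR \<in> polys_over (K_mpolys m)" "VR \<in> polys_over (K_mpolys m)"
  "(gmon n Var :: 'k alg_closure mpoly poly) \<in> polys_over (K_mpolys m)"
  "([:0, 1:] :: 'k alg_closure mpoly poly) \<in> polys_over (K_mpolys m)"
proof -
  note S = is_subring_K_mpolys[of m, where 'a = 'k] and SP = is_subring_polys_over[OF is_subring_K_mpolys[of m, where 'a = 'k]]
  show "MR \<in> polys_over (K_mpolys m)" "WR \<in> polys_over (K_mpolys m)"
    by (auto simp: polys_over_def MR_def WR_def coeff_map_hom[OF is_hom_Cto] Const_to_ac_K_mpolys)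
  show "XR \<in> polys_over (K_mpolys m)" "VR \<in> polys_over (K_mpolys m)"
    unfolding XR_def VR_def
    by (intro subring_sum[OF SP] polys_over_monom[OF S] Var_K_mpolys; simp add: m_def)+
  show "(gmon n Var :: 'k alg_closure mpoly poly) \<in> polys_over (K_mpolys m)"
    by (intro gmon_polys_over[OF S] Var_K_mpolys) (simp add: m_def)
  show "([:0, 1:] :: 'k alg_closure mpoly poly) \<in> polys_over (K_mpolys m)"
    using subring_zero[OF S] subring_one[OF S] polys_over_0[OF S] by (simp add: polys_over_pCons)
qed

text \<open>The shape of a remainder modulo \<open>M\<close>: with degree below \<open>N\<close>,
  its coefficients vanish at a geometric point as soon as its values at the \<open>N\<close> roots
  of \<open>M\<close> do.\<close>

definition weak_equation :: "'k alg_closure mpoly poly \<Rightarrow> bool" where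
  "weak_equation r \<longleftrightarrow> r \<in> polys_over (K_mpolys m) \<and> (\<forall>i \<ge> N. poly.coeff r i = 0)"

text \<open>Reduction modulo \<open>MR\<close> preserves the values at the roots of \<open>M\<close>
  and keeps the coefficients over K. This is restriction of scalars along
  \<open>K[X]/(M)\<close>.\<close>

lemma reduced_equation:
  assumes "G \<in> polys_over (K_mpolys m)"
  shows "\<exists>r. weak_equation r \<and> (\<forall>\<theta>\<in>\<Theta>. poly r (Const \<theta>) = poly G (Const \<theta>))"
proof -
  obtain q r where "r \<in> polys_over (K_mpolys m)" "G = q * MR + r" "\<forall>i \<ge> N. poly.coeff r i = 0"
    using monic_division[OF is_subring_K_mpolys over_K(1) MR_monic assms] degree_MR by auto
  then show ?thesis
    using poly_MR unfolding weak_equation_def by (intro exI[of _ r]) auto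
qed

definition fibre_equation :: "'k alg_closure mpoly poly" where
  "fibre_equation = (SOME r. weak_equation r \<and> (\<forall>\<theta>\<in>\<Theta>. poly r (Const \<theta>) = poly (pcompose (gmon n Var) XR - WR) (Const \<theta>)))"

definition inverse_equation :: "'k alg_closure mpoly poly" where
  "inverse_equation = (SOME r. weak_equation r \<and> (\<forall>\<theta>\<in>\<Theta>. poly r (Const \<theta>) = poly (pcompose VR XR - [:0, 1:]) (Const \<theta>)))"

lemma fibre_equation: "weak_equation fibre_equation" "\<theta> \<in> \<Theta> \<Longrightarrow> poly fibre_equation (Const \<theta>) = poly (gmon n Var) (tau \<theta>) - Const (w \<theta>)"
proof -
  note S = is_subring_K_mpolys[of m, where 'a = 'k]
  have "pcompose (gmon n Var) XR - WR \<in> polys_over (K_mpolys m)"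
    by (intro subring_diff[OF is_subring_polys_over[OF S]] pcompose_polys_over[OF S] over_K)
  from someI_ex[OF reduced_equation[OF this], folded fibre_equation_def]
  show "weak_equation fibre_equation" "\<theta> \<in> \<Theta> \<Longrightarrow> poly fibre_equation (Const \<theta>) = poly (gmon n Var) (tau \<theta>) - Const (w \<theta>)"
    by (auto simp: poly_pcompose poly_XR poly_WR)
qed

lemma inverse_equation: "weak_equation inverse_equation" "\<theta> \<in> \<Theta> \<Longrightarrow> poly inverse_equation (Const \<theta>) = poly VR (tau \<theta>) - Const \<theta>"
proof -
  note S = is_subring_K_mpolys[of m, where 'a = 'k]
  have "pcompose VR XR - [:0, 1:] \<in> polys_over (K_mpolys m)"
    by (intro subring_diff[OF is_subring_polys_over[OF S]] pcompose_polys_over[OF S] over_K)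
  from someI_ex[OF reduced_equation[OF this], folded inverse_equation_def]
  show "weak_equation inverse_equation" "\<theta> \<in> \<Theta> \<Longrightarrow> poly inverse_equation (Const \<theta>) = poly VR (tau \<theta>) - Const \<theta>"
    by (auto simp: poly_pcompose poly_XR)
qed

text \<open>The tuples \<open>\<theta> \<mapsto> \<tau> \<theta>\<close> become a variety over \<open>K\<close> when they are replaced by their interpolation
  polynomials \<open>XR\<close> at the roots of \<open>M\<close> and the conditions on the roots by remainders modulo \<open>M\<close>.  The
  polynomial \<open>VR\<close>, with \<open>VR (\<tau> \<theta>) = \<theta>\<close>, witnesses that the \<open>\<tau> \<theta>\<close> are distinct, and \<open>z\<close> that \<open>P\<close>
  does not vanish.\<close>

definition E :: "'k alg_closure mpoly set" where
  "E = range (poly.coeff fibre_equation) \<union> range (poly.coeff inverse_equation) \<union> {z * P - 1}"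

definition J :: "'k alg_closure mpoly set" where "J = ideal_gen E"

definition V :: "(nat \<Rightarrow> 'k alg_closure) set" where
  "V = {x \<in> affine_space m. \<forall>p\<in>E. ev (\<lambda>c. c) x p = 0}"

lemma E_K: "E \<subseteq> K_mpolys m"
proof -
  note S = is_subring_K_mpolys[of m, where 'a = 'k]
  have "z \<in> K_mpolys m" unfolding z_def by (intro Var_K_mpolys) (simp add: m_def)
  moreover have "P \<in> K_mpolys m" using P K_mpolys_mono[of n m] by (auto simp: m_def)
  ultimately have "z * P - 1 \<in> K_mpolys m" by (intro subring_intros[OF S])
  then show ?thesis using fibre_equation(1) inverse_equation(1) by (auto simp: E_def weak_equation_def polys_over_def)
qed

lemma ideal_J: "is_ideal J" unfolding J_def by (rule is_ideal_ideal_gen)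

lemma E_J: "e \<in> E \<Longrightarrow> e \<in> J" unfolding J_def by (rule ideal_gen_base)

lemma r_in_J: "fibre_equation \<in> polys_over J" "inverse_equation \<in> polys_over J"
  using E_J by (auto simp: polys_over_def E_def)

lemma J_root: "\<theta> \<in> \<Theta> \<Longrightarrow> poly (gmon n Var) (tau \<theta>) - Const (w \<theta>) \<in> J"
  using poly_in_ideal[OF ideal_J r_in_J(1)] fibre_equation(2) by metis

lemma J_inverse: "\<theta> \<in> \<Theta> \<Longrightarrow> poly VR (tau \<theta>) - Const \<theta> \<in> J"
  using poly_in_ideal[OF ideal_J r_in_J(2)] inverse_equation(2) by metis

text \<open>Modulo \<open>J\<close> the difference of the values of \<open>VR\<close> at
  \<open>tau \<theta>\<close> and \<open>tau \<eta>\<close> is the nonzero constant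
  \<open>\<theta> - \<eta>\<close>. As it is a multiple of \<open>tau \<theta> - tau \<eta>\<close>,
  the latter is invertible modulo \<open>J\<close> and can be cancelled.\<close>

lemma good_J: "good J"
  unfolding good_def
proof (intro conjI ballI impI allI)
  fix \<theta> \<eta> p assume th: "\<theta> \<in> \<Theta>" "\<eta> \<in> \<Theta>" "\<theta> \<noteq> \<eta>" and p: "(tau \<theta> - tau \<eta>) * p \<in> J"
  note I = ideal_J
  obtain k where k: "poly VR (tau \<theta>) - poly VR (tau \<eta>) = (tau \<theta> - tau \<eta>) * k"
    using poly_diff_dvd by blast
  have k': "k * ((tau \<theta> - tau \<eta>) * p) = (poly VR (tau \<theta>) - poly VR (tau \<eta>)) * p"
    unfolding k by (simp only: mult_ac)
  have "Const (\<theta> - \<eta>) * p = k * ((tau \<theta> - tau \<eta>) * p) - (poly VR (tau \<theta>) - Const \<theta>) * p + (poly VR (tau \<eta>) - Const \<eta>) * p"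
    unfolding k' by (simp add: hom_diff[OF is_hom_Const] algebra_simps)
  also have "\<dots> \<in> J"
    by (rule ideal_add[OF I ideal_diff[OF I ideal_mult[OF I p] ideal_mult2[OF I J_inverse[OF th(1)]]]
          ideal_mult2[OF I J_inverse[OF th(2)]]])
  finally have "Const (inverse (\<theta> - \<eta>)) * (Const (\<theta> - \<eta>) * p) \<in> J" by (rule ideal_mult[OF I])
  moreover have "Const (inverse (\<theta> - \<eta>)) * Const (\<theta> - \<eta>) = 1"
    using th(3) by (simp add: hom_one[OF is_hom_Const] flip: hom_mult[OF is_hom_Const])
  ultimately show "p \<in> J" by (simp flip: mult.assoc)
qed (use ideal_J J_root in auto)

end

lemma prod_cancel:
  assumes "finite A" "\<And>x p. x \<in> A \<Longrightarrow> f x * p \<in> J \<Longrightarrow> p \<in> J" "(\<Prod>x\<in>A. f x) * p \<in> (J :: 'a::comm_monoid_mult set)"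
  shows "p \<in> J"
  using assms
proof (induction A arbitrary: p rule: finite_induct)
  case (insert x A)
  have "f x * ((\<Prod>x\<in>A. f x) * p) \<in> J" using insert by (simp add: mult.assoc)
  then have "(\<Prod>x\<in>A. f x) * p \<in> J" using insert.prems(1)[of x] by simp
  then show ?case using insert.IH insert.prems(1) by blast
qed simp

context K_cover
begin

definition diffs :: "'k alg_closure \<Rightarrow> 'k alg_closure mpoly" where
  "diffs \<theta> = (\<Prod>\<eta>\<in>\<Theta> - {\<theta>}. tau \<theta> - tau \<eta>)"

definition delta :: "'k alg_closure mpoly" where "delta = (\<Prod>\<theta>\<in>\<Theta>. diffs \<theta>)"

text \<open>A common denominator: modulo \<open>J\<close> the coefficients of \<open>VR\<close> have
  denominator \<open>delta\<close>, and \<open>z\<close> has denominator \<open>P\<close>.\<close>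

definition D :: "'k alg_closure mpoly" where "D = P * delta"

lemma diffs_mpolys: "diffs \<theta> \<in> mpolys (n + N)"
  unfolding diffs_def by (intro subring_prod[OF is_subring_mpolys] subring_diff[OF is_subring_mpolys] tau_in_mpolys)

lemma delta_mpolys: "delta \<in> mpolys (n + N)"
  unfolding delta_def by (intro subring_prod[OF is_subring_mpolys] diffs_mpolys)

lemma P_mpolys': "P \<in> mpolys (n + N)"
  using P_mpolys mpolys_mono[of n "n + N"] by auto

lemma D_mpolys: "D \<in> mpolys (n + N)"
  unfolding D_def by (intro subring_mult[OF is_subring_mpolys] delta_mpolys P_mpolys')

lemma zP_J: "z * P - 1 \<in> J"
  by (intro E_J) (simp add: E_def)

lemma J_cancel: "\<theta> \<in> \<Theta> \<Longrightarrow> \<eta> \<in> \<Theta> \<Longrightarrow> \<theta> \<noteq> \<eta> \<Longrightarrow> (tau \<theta> - tau \<eta>) * p \<in> J \<Longrightarrow> p \<in> J"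
  using good_J unfolding good_def by blast

lemma diffs_cancel:
  assumes "\<theta> \<in> \<Theta>" "diffs \<theta> * p \<in> J"
  shows "p \<in> J"
proof (rule prod_cancel[OF _ _ assms(2)[unfolded diffs_def]])
  fix \<eta> p assume "\<eta> \<in> \<Theta> - {\<theta>}" "(tau \<theta> - tau \<eta>) * p \<in> J"
  then show "p \<in> J" using J_cancel[of \<theta> \<eta>] assms(1) by auto
qed (use fin in auto)

lemma delta_cancel:
  assumes "delta * p \<in> J"
  shows "p \<in> J"
  by (rule prod_cancel[OF fin _ assms[unfolded delta_def]]) (rule diffs_cancel)

lemma D_cancel:
  assumes "D * p \<in> J"
  shows "p \<in> J"
proof -
  have "delta * (P * p) \<in> J" using assms by (simp add: D_def mult_ac)
  then have "P * p \<in> J" by (rule delta_cancel)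
  then have "z * (P * p) - (z * P - 1) * p \<in> J"
    by (intro ideal_diff[OF ideal_J] ideal_mult[OF ideal_J, of "P * p"] ideal_mult2[OF ideal_J zP_J])
  then show ?thesis by (simp add: algebra_simps)
qed

lemma D_power_cancel: "D ^ e * p \<in> J \<Longrightarrow> p \<in> J"
proof (induction e)
  case (Suc e)
  then have "D * (D ^ e * p) \<in> J" by (simp add: mult.assoc)
  then show ?case using D_cancel Suc.IH by blast
qed simp

text \<open>\<open>VR\<close> interpolates the values \<open>\<theta>\<close> at the nodes
  \<open>tau \<theta>\<close>. Lagrange's formula, with denominators cleared by
  \<open>delta\<close>, expresses its coefficients by the roots, and uniqueness of interpolation
  modulo \<open>J\<close> justifies this.\<close>

lemma inverse_coeff_elim:
  assumes s: "s < N"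
  shows "\<exists>l \<in> mpolys (n + N). delta * Var (n + N + 1 + s) - l \<in> J"
proof -
  note S = is_subring_mpolys[of "n + N", where 'a = "'k alg_closure"] and SP = is_subring_polys_over[OF is_subring_mpolys[of "n + N", where 'a = "'k alg_closure"]]
  define B where "B \<theta> = (\<Prod>\<eta>\<in>\<Theta> - {\<theta>}. [:- tau \<eta>, 1:])" for \<theta>
  \<comment> \<open>The prescribed value \<open>\<theta>\<close> times \<open>delta\<close> divided
    by \<open>diffs \<theta>\<close>, where \<open>diffs \<theta>\<close> is the value of
    \<open>B \<theta>\<close> at its own node.\<close>
  define c where "c \<theta> = Const \<theta> * (\<Prod>\<eta>\<in>\<Theta> - {\<theta>}. diffs \<eta>)" for \<theta>
  define L where "L = (\<Sum>\<theta>\<in>\<Theta>. smult (c \<theta>) (B \<theta>))"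
  define U where "U = smult delta VR - L"
  have dB: "poly.coeff (B \<theta>) i = 0" if "\<theta> \<in> \<Theta>" "i \<ge> N" for \<theta> i
  proof (rule coeff_eq_0)
    have "degree (B \<theta>) = card (\<Theta> - {\<theta>})"
      unfolding B_def by (subst degree_prod_eq_sum_degree) auto
    also have "\<dots> < N" unfolding N_def using that fin by (intro card_Diff1_less)
    finally show "degree (B \<theta>) < i" using that by simp
  qed
  have BP: "B \<theta> \<in> polys_over (mpolys (n + N))" for \<theta>
    unfolding B_def
    by (intro subring_prod[OF SP])
       (auto simp: polys_over_pCons polys_over_0[OF S] subring_one[OF S] intro!: subring_uminus[OF S] tau_in_mpolys)
  have "c \<theta> \<in> mpolys (n + N)" for \<theta>
    unfolding c_def by (intro subring_mult[OF S] subring_prod[OF S] diffs_mpolys Const_in_mpolys)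
  then have LP: "poly.coeff L i \<in> mpolys (n + N)" for i
    unfolding L_def coeff_sum coeff_smult using BP
    by (intro subring_sum[OF S] subring_mult[OF S]) (auto simp: polys_over_def)
  have poly_L: "poly L (tau \<theta>) = Const \<theta> * delta" if th: "\<theta> \<in> \<Theta>" for \<theta>
  proof -
    have "poly (B \<eta>) (tau \<theta>) = 0" if "\<eta> \<in> \<Theta>" "\<eta> \<noteq> \<theta>" for \<eta>
      unfolding B_def poly_prod using that th fin by (intro prod_zero) auto
    then have "poly L (tau \<theta>) = (\<Sum>\<eta>\<in>\<Theta>. if \<eta> = \<theta> then c \<theta> * poly (B \<theta>) (tau \<theta>) else 0)"
      unfolding L_def poly_sum poly_smult by (intro sum.cong) auto
    also have "\<dots> = c \<theta> * poly (B \<theta>) (tau \<theta>)" using th fin by simp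
    also have "poly (B \<theta>) (tau \<theta>) = diffs \<theta>" by (simp add: B_def poly_prod diffs_def)
    also have "c \<theta> * diffs \<theta> = Const \<theta> * delta"
      unfolding c_def delta_def using prod.remove[OF fin th, of diffs] by (simp add: mult_ac)
    finally show ?thesis .
  qed
  have "U \<in> polys_over J"
  proof (rule interpolation_unique[OF good_J fin order.refl])
    fix i assume i: "i \<ge> card \<Theta>"
    have "poly.coeff VR i = 0" using i by (auto simp: VR_def coeff_sum N_def intro!: sum.neutral)
    moreover have "poly.coeff L i = 0" using i dB by (auto simp: L_def coeff_sum N_def intro!: sum.neutral)
    ultimately show "poly.coeff U i = 0" by (simp add: U_def)
  next
    fix \<theta> assume th: "\<theta> \<in> \<Theta>"
    have "poly U (tau \<theta>) = delta * (poly VR (tau \<theta>) - Const \<theta>)"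
      using poly_L[OF th] by (simp add: U_def algebra_simps)
    also have "\<dots> \<in> J" by (intro ideal_mult[OF ideal_J] J_inverse[OF th])
    finally show "poly U (tau \<theta>) \<in> J" .
  qed
  then have "poly.coeff U s \<in> J" by (simp add: polys_over_def)
  moreover have "poly.coeff VR s = Var (n + N + 1 + s)"
  proof -
    have "poly.coeff VR s = (\<Sum>s'<N. if s' = s then Var (n + N + 1 + s') else 0)"
      unfolding VR_def coeff_sum by (intro sum.cong) auto
    then show ?thesis using s by simp
  qed
  ultimately have "delta * Var (n + N + 1 + s) - poly.coeff L s \<in> J" by (simp add: U_def)
  then show ?thesis using LP by blast
qed

text \<open>The quotient by \<open>J\<close> behaves like a localisation at \<open>D\<close> of a
  ring in the first \<open>n + N\<close> variables, so questions about \<open>J\<close> reduce to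
  polynomials in the coefficients and roots.\<close>

lemma elimination:
  assumes "p \<in> mpolys m"
  shows "\<exists>e. \<exists>p0 \<in> mpolys (n + N). D ^ e * p - p0 \<in> J"
  using assms unfolding mpolys_eq_subalg[of m]
proof (induction rule: subalg.induct)
  note S = is_subring_mpolys[of "n + N", where 'a = "'k alg_closure"]
  note I = ideal_J
  have triv: "\<exists>e. \<exists>p0 \<in> mpolys (n + N). D ^ e * p - p0 \<in> J" if "p \<in> mpolys (n + N)" for p
    using that ideal_zero[OF I] by (intro exI[of _ 0] bexI[of _ p]) auto
  {
    case (const c)
    show ?case by (intro triv Const_in_mpolys)
  next
    case (gen x)
    then obtain i where i: "i \<in> {1..m}" "x = Var i" by auto
    consider "i \<in> {1..n + N}" | "i = m" | "n + N < i" "i < m" using i by force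
    then show ?case
    proof cases
      case 1
      then show ?thesis unfolding i by (intro triv Var_in_mpolys)
    next
      case 2
      have "D ^ 1 * x - delta = delta * (z * P - 1)" by (simp add: D_def i 2 z_def algebra_simps)
      also have "\<dots> \<in> J" by (rule ideal_mult[OF I zP_J])
      finally show ?thesis using delta_mpolys by blast
    next
      case 3
      define s where "s = i - n - N - 1"
      have s: "s < N" "i = n + N + 1 + s" using 3 by (auto simp: s_def m_def)
      from inverse_coeff_elim[OF s(1)] obtain l where l: "l \<in> mpolys (n + N)" "delta * x - l \<in> J"
        unfolding i(2) s(2)[symmetric] by blast
      have "D ^ 1 * x - P * l = P * (delta * x - l)" by (simp add: D_def algebra_simps)
      also have "\<dots> \<in> J" by (rule ideal_mult[OF I l(2)])
      finally show ?thesis using subring_mult[OF S P_mpolys' l(1)] by blast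
    qed
  next
    case (add x y)
    then obtain e f x0 y0 where x: "x0 \<in> mpolys (n + N)" "D ^ e * x - x0 \<in> J"
      and y: "y0 \<in> mpolys (n + N)" "D ^ f * y - y0 \<in> J" by blast
    have "D ^ (e + f) * (x + y) - (D ^ f * x0 + D ^ e * y0) = D ^ f * (D ^ e * x - x0) + D ^ e * (D ^ f * y - y0)"
      by (simp add: power_add algebra_simps)
    also have "\<dots> \<in> J" by (rule ideal_add[OF I ideal_mult[OF I x(2)] ideal_mult[OF I y(2)]])
    finally show ?case
      using x(1) y(1) D_mpolys by (intro exI[of _ "e + f"] bexI[of _ "D ^ f * x0 + D ^ e * y0"]) (auto intro!: subring_intros[OF S])
  next
    case (mult x y)
    then obtain e f x0 y0 where x: "x0 \<in> mpolys (n + N)" "D ^ e * x - x0 \<in> J"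
      and y: "y0 \<in> mpolys (n + N)" "D ^ f * y - y0 \<in> J" by blast
    have "D ^ (e + f) * (x * y) - x0 * y0 = (D ^ e * x) * (D ^ f * y - y0) + y0 * (D ^ e * x - x0)"
      by (simp add: power_add algebra_simps)
    also have "\<dots> \<in> J" by (rule ideal_add[OF I ideal_mult[OF I y(2)] ideal_mult[OF I x(2)]])
    finally show ?case using subring_mult[OF S x(1) y(1)] by blast
  }
qed

lemma J_vanishes: "x \<in> V \<Longrightarrow> p \<in> J \<Longrightarrow> ev (\<lambda>c. c) x p = 0"
  unfolding J_def
proof (rotate_tac, induction rule: ideal_gen.induct)
  case zero
  then show ?case by (simp add: ev_zero[OF is_hom_id])
next
  case (step q s r)
  then show ?case by (auto simp: V_def hom_add[OF is_hom_ev[OF is_hom_id]] hom_mult[OF is_hom_ev[OF is_hom_id]])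
qed

abbreviation roots_at :: "(nat \<Rightarrow> 'k alg_closure) \<Rightarrow> 'k alg_closure \<Rightarrow> 'k alg_closure" where
  "roots_at x \<theta> \<equiv> ev (\<lambda>c. c) x (tau \<theta>)"

lemma point_solves:
  assumes x: "x \<in> V"
  shows "solves (\<lambda>c. c) x (roots_at x)" "ev (\<lambda>c. c) x P \<noteq> 0"
    "p \<in> mpolys (n + N) \<Longrightarrow> pnt (\<lambda>c. c) x (roots_at x) p = ev (\<lambda>c. c) x p"
proof -
  note h = is_hom_ev[OF is_hom_id, of x]
  note vJ = J_vanishes[OF x]
  have hg: "ev (\<lambda>c. c) x (poly (gmon n Var) (tau \<theta>)) = poly (gmon n x) (roots_at x \<theta>)" for \<theta>
    by (simp add: map_poly_gmon[OF h] ev_Var[OF is_hom_id] flip: poly_map_hom[OF h])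
  have root: "poly (gmon n x) (roots_at x \<theta>) = w \<theta>" if "\<theta> \<in> \<Theta>" for \<theta>
    using vJ[OF J_root[OF that]] by (simp add: hom_diff[OF h] hg ev_Const[OF is_hom_id])
  have v: "poly (map_poly (ev (\<lambda>c. c) x) VR) (roots_at x \<theta>) = \<theta>" if "\<theta> \<in> \<Theta>" for \<theta>
    using vJ[OF J_inverse[OF that]] by (simp add: hom_diff[OF h] ev_Const[OF is_hom_id] poly_map_hom[OF h])
  have "inj_on (roots_at x) \<Theta>" using v by (rule inj_on_inverseI)
  then show "solves (\<lambda>c. c) x (roots_at x)" using root by (simp add: solves_def)
  have "ev (\<lambda>c. c) x z * ev (\<lambda>c. c) x P = 1"
    using vJ[OF zP_J] by (simp add: hom_diff[OF h] hom_mult[OF h] hom_one[OF h])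
  then show "ev (\<lambda>c. c) x P \<noteq> 0" by auto
  show "pnt (\<lambda>c. c) x (roots_at x) p = ev (\<lambda>c. c) x p" if "p \<in> mpolys (n + N)"
    using that unfolding mpolys_eq_alg
    by (rule subalg_hom_cong[OF _ is_hom_pnt[OF is_hom_id] h])
       (auto simp: pnt_Const is_hom_id ev_Const pnt_Var ev_Var pnt_tau)
qed

text \<open>The auxiliary coordinates are forced: those of \<open>VR\<close> interpolate the inverse
  of \<open>t\<close>, and \<open>z\<close> inverts the value of \<open>P\<close>.\<close>

lemma solution_point:
  assumes sol: "solves (\<lambda>c. c) a t" and aP: "ev (\<lambda>c. c) a P \<noteq> 0"
  shows "\<exists>x\<in>V. \<forall>p\<in>mpolys (n + N). ev (\<lambda>c. c) x p = pnt (\<lambda>c. c) a t p"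
proof -
  have inj: "inj_on t \<Theta>" and root: "\<And>\<theta>. \<theta> \<in> \<Theta> \<Longrightarrow> poly (gmon n a) (t \<theta>) = w \<theta>"
    using sol by (auto simp: solves_def)
  obtain v where v: "\<And>i. i \<ge> N \<Longrightarrow> poly.coeff v i = 0" "\<And>\<theta>. \<theta> \<in> \<Theta> \<Longrightarrow> poly v (t \<theta>) = \<theta>"
    using interpolation_exists[OF fin inj, of "\<lambda>\<theta>. \<theta>"] by (auto simp: N_def)
  define x where "x i = (if i \<le> n + N then pt (\<lambda>c. c) a t i else if i < m then poly.coeff v (i - n - N - 1)
     else if i = m then inverse (ev (\<lambda>c. c) a P) else 0)" for i
  note h = is_hom_ev[OF is_hom_id, of x]
  have agree: "ev (\<lambda>c. c) x p = pnt (\<lambda>c. c) a t p" if "p \<in> mpolys (n + N)" for p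
    unfolding pnt_def by (rule ev_cong[OF that]) (auto simp: x_def)
  have htau: "ev (\<lambda>c. c) x (tau \<theta>) = t \<theta>" if "\<theta> \<in> \<Theta>" for \<theta>
    using agree[OF tau_in_mpolys] pnt_tau[OF is_hom_id that] by simp
  have xa: "x j = a j" if "j \<in> {1..n}" for j using that by (auto simp: x_def pt_def)
  have hP: "ev (\<lambda>c. c) x P = ev (\<lambda>c. c) a P" using xa by (intro ev_cong[OF P_mpolys]) auto
  have hVR: "map_poly (ev (\<lambda>c. c) x) VR = v"
  proof (rule poly_eqI)
    fix i
    have "poly.coeff (map_poly (ev (\<lambda>c. c) x) VR) i = (\<Sum>s<N. if s = i then x (n + N + 1 + s) else 0)"
      unfolding VR_def coeff_map_hom[OF h] coeff_sum hom_sum[OF h]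
      by (intro sum.cong) (auto simp: ev_Var[OF is_hom_id] hom_zero[OF h])
    then show "poly.coeff (map_poly (ev (\<lambda>c. c) x) VR) i = poly.coeff v i"
      using v(1)[of i] by (auto simp: x_def m_def)
  qed
  \<comment> \<open>A reduced equation has degree below \<open>N\<close>, so vanishing at the
    \<open>N\<close> distinct elements of \<open>\<Theta>\<close> kills all its
    coefficients.\<close>
  have zero: "ev (\<lambda>c. c) x (poly.coeff r i) = 0"
    if r: "weak_equation r" and r0: "\<And>\<theta>. \<theta> \<in> \<Theta> \<Longrightarrow> ev (\<lambda>c. c) x (poly r (Const \<theta>)) = 0" for r i
  proof -
    have "map_poly (ev (\<lambda>c. c) x) r = 0"
    proof (rule poly_zero_if_many_roots[OF fin, of "\<lambda>\<theta>. \<theta>"])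
      fix \<theta> assume "\<theta> \<in> \<Theta>"
      then show "poly (map_poly (ev (\<lambda>c. c) x) r) \<theta> = 0"
        using r0 poly_map_hom[OF h, of r "Const \<theta>"] by (simp add: ev_Const[OF is_hom_id])
    qed (use r in \<open>auto simp: weak_equation_def coeff_map_hom[OF h] hom_zero[OF h] N_def\<close>)
    then show ?thesis by (metis coeff_0 coeff_map_hom[OF h])
  qed
  have "ev (\<lambda>c. c) x (poly.coeff fibre_equation i) = 0" for i
  proof (rule zero[OF fibre_equation(1)])
    fix \<theta> assume th: "\<theta> \<in> \<Theta>"
    have "ev (\<lambda>c. c) x (poly (gmon n Var) (tau \<theta>)) = poly (gmon n x) (t \<theta>)"
      by (simp add: map_poly_gmon[OF h] ev_Var[OF is_hom_id] htau[OF th] flip: poly_map_hom[OF h])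
    also have "gmon n x = gmon n a" using xa by (intro gmon_cong)
    finally show "ev (\<lambda>c. c) x (poly fibre_equation (Const \<theta>)) = 0"
      using root[OF th] by (simp add: fibre_equation(2)[OF th] hom_diff[OF h] ev_Const[OF is_hom_id])
  qed
  moreover have "ev (\<lambda>c. c) x (poly.coeff inverse_equation i) = 0" for i
  proof (rule zero[OF inverse_equation(1)])
    fix \<theta> assume th: "\<theta> \<in> \<Theta>"
    have "ev (\<lambda>c. c) x (poly VR (tau \<theta>)) = \<theta>"
      using v(2)[OF th] by (simp add: hVR htau[OF th] flip: poly_map_hom[OF h])
    then show "ev (\<lambda>c. c) x (poly inverse_equation (Const \<theta>)) = 0"
      by (simp add: inverse_equation(2)[OF th] hom_diff[OF h] ev_Const[OF is_hom_id])
  qed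
  moreover have "ev (\<lambda>c. c) x (z * P - 1) = 0"
    using aP by (simp add: hom_diff[OF h] hom_mult[OF h] hom_one[OF h] hP z_def ev_Var[OF is_hom_id] x_def m_def)
  moreover have "x \<in> affine_space m"
    by (auto simp: affine_space_def x_def pt_def m_def)
  ultimately have "x \<in> V" by (auto simp: V_def E_def)
  then show ?thesis using agree by blast
qed

lemma D_nonzero:
  assumes x: "x \<in> V"
  shows "ev (\<lambda>c. c) x D \<noteq> 0"
proof -
  note h = is_hom_ev[OF is_hom_id, of x]
  have "inj_on (roots_at x) \<Theta>" using point_solves(1)[OF x] by (simp add: solves_def)
  then have "ev (\<lambda>c. c) x delta \<noteq> 0"
    unfolding delta_def diffs_def hom_prod[OF h] hom_diff[OF h] using fin
    by (auto simp: prod_zero_iff inj_on_def)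
  then show ?thesis using point_solves(2)[OF x] by (simp add: D_def hom_mult[OF h])
qed

lemma elimination_at_point:
  assumes "D ^ e * p - p0 \<in> J" "x \<in> V"
  shows "ev (\<lambda>c. c) x p0 = 0 \<longleftrightarrow> ev (\<lambda>c. c) x p = 0"
proof -
  note h = is_hom_ev[OF is_hom_id, of x]
  have "ev (\<lambda>c. c) x D ^ e * ev (\<lambda>c. c) x p = ev (\<lambda>c. c) x p0"
    using J_vanishes[OF assms(2,1)] by (simp add: hom_diff[OF h] hom_mult[OF h] hom_power[OF h])
  then show ?thesis using D_nonzero[OF assms(2)] by (metis mult_eq_0_iff power_not_zero)
qed

text \<open>Elimination replaces polynomials in all \<open>m\<close> variables by ones in the first
  \<open>n + N\<close>. There \<open>vanishing_at_solutions\<close> applied to the good ideal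
  \<open>J\<close> gives radicality, and \<open>solutions_irreducible\<close> gives primality;
  \<open>D\<close> is then cancelled.\<close>

theorem K_rational_point:
  assumes pac: "pac_field TYPE('k)"
  shows "\<exists>x\<in>V. \<forall>i. x i \<in> range to_ac"
proof (rule pac_point[OF pac E_K V_def])
  show "V \<noteq> {}"
    using separable_solution[OF P_mpolys P(2)] solution_point by blast
next
  fix p assume p: "p \<in> mpolys m" and v: "\<And>x. x \<in> V \<Longrightarrow> ev (\<lambda>c. c) x p = 0"
  obtain e p0 where e: "p0 \<in> mpolys (n + N)" "D ^ e * p - p0 \<in> J" using elimination[OF p] by blast
  have "p0 \<in> J"
  proof (rule vanishing_at_solutions[OF P_mpolys P(2) good_J e(1)])
    fix a t assume "solves (\<lambda>c. c) a t" "ev (\<lambda>c. c) a P \<noteq> 0"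
    then obtain x where x: "x \<in> V" "ev (\<lambda>c. c) x p0 = pnt (\<lambda>c. c) a t p0" using solution_point e(1) by blast
    then show "pnt (\<lambda>c. c) a t p0 = 0" using elimination_at_point[OF e(2) x(1)] v[OF x(1)] by simp
  qed
  then have "(D ^ e * p - p0) + p0 \<in> J" using e(2) by (intro ideal_add[OF ideal_J])
  then have "D ^ e * p \<in> J" by simp
  then show "p \<in> ideal_gen E" unfolding J_def[symmetric] by (rule D_power_cancel)
next
  fix p q assume p: "p \<in> mpolys m" and q: "q \<in> mpolys m" and v: "\<And>x. x \<in> V \<Longrightarrow> ev (\<lambda>c. c) x (p * q) = 0"
  obtain e p0 where e: "p0 \<in> mpolys (n + N)" "D ^ e * p - p0 \<in> J" using elimination[OF p] by blast
  obtain f q0 where f: "q0 \<in> mpolys (n + N)" "D ^ f * q - q0 \<in> J" using elimination[OF q] by blast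
  have "pnt (\<lambda>c. c) a t (p0 * q0) = 0" if sol: "solves (\<lambda>c. c) a t" "ev (\<lambda>c. c) a P \<noteq> 0" for a t
  proof -
    have pq: "p0 * q0 \<in> mpolys (n + N)" by (rule subring_mult[OF is_subring_mpolys e(1) f(1)])
    then obtain x where x: "x \<in> V" "ev (\<lambda>c. c) x (p0 * q0) = pnt (\<lambda>c. c) a t (p0 * q0)"
      using solution_point[OF sol] by blast
    have "ev (\<lambda>c. c) x p = 0 \<or> ev (\<lambda>c. c) x q = 0"
      using v[OF x(1)] by (simp add: hom_mult[OF is_hom_ev[OF is_hom_id]])
    then have "ev (\<lambda>c. c) x p0 = 0 \<or> ev (\<lambda>c. c) x q0 = 0"
      using elimination_at_point[OF e(2) x(1)] elimination_at_point[OF f(2) x(1)] by simp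
    then show ?thesis using x(2) by (auto simp: hom_mult[OF is_hom_ev[OF is_hom_id]])
  qed
  from solutions_irreducible[OF P_mpolys P(2) e(1) f(1) this]
  show "(\<forall>x\<in>V. ev (\<lambda>c. c) x p = 0) \<or> (\<forall>x\<in>V. ev (\<lambda>c. c) x q = 0)"
  proof
    assume a: "\<forall>a t. solves (\<lambda>c. c) a t \<longrightarrow> pnt (\<lambda>c. c) a t p0 = 0"
    have "ev (\<lambda>c. c) x p = 0" if "x \<in> V" for x
      using a point_solves[OF that] e(1) elimination_at_point[OF e(2) that] by metis
    then show ?thesis by blast
  next
    assume a: "\<forall>a t. solves (\<lambda>c. c) a t \<longrightarrow> pnt (\<lambda>c. c) a t q0 = 0"
    have "ev (\<lambda>c. c) x q = 0" if "x \<in> V" for x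
      using a point_solves[OF that] f(1) elimination_at_point[OF f(2) that] by metis
    then show ?thesis by blast
  qed
qed

end

text \<open>A K-point of the variety provides both answers: its first \<open>n\<close> coordinates
  are the coefficients of \<open>g\<close>, the next \<open>N\<close> those of \<open>Q\<close>, and
  \<open>Q\<close> takes the root \<open>tau \<theta>\<close> as its value at
  \<open>\<theta>\<close>.\<close>

theorem pac_simultaneous_solution:
  fixes M W :: "'k::field poly"
  assumes pac: "pac_field TYPE('k)" and M: "lead_coeff M = 1"
    and card: "card {\<theta>. poly (map_poly to_ac M) \<theta> = 0} = degree M"
    and fibres: "\<And>\<theta>. poly (map_poly to_ac M) \<theta> = 0 \<Longrightarrow>
      card {\<eta>. poly (map_poly to_ac M) \<eta> = 0 \<and> poly (map_poly to_ac W) \<eta> = poly (map_poly to_ac W) \<theta>} = n"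
    and n: "n > 0" "CHAR('k) = 2 \<longrightarrow> odd n"
    and P: "P \<in> K_mpolys n" "P \<noteq> 0"
  shows "\<exists>a Q. ev (\<lambda>c. c) (\<lambda>i. to_ac (a i)) P \<noteq> 0 \<and>
    (\<forall>\<theta>. poly (map_poly to_ac M) \<theta> = 0 \<longrightarrow>
      poly (gmon n (\<lambda>i. to_ac (a i))) (poly (map_poly to_ac Q) \<theta>) = poly (map_poly to_ac W) \<theta>) \<and>
    inj_on (poly (map_poly to_ac Q)) {\<theta>. poly (map_poly to_ac M) \<theta> = 0}"
proof -
  define \<Theta> where "\<Theta> = {\<theta>. poly (map_poly to_ac M) \<theta> = 0}"
  have "map_poly to_ac M \<noteq> 0"
    using lead_coeff_monic_map_hom(2)[OF is_hom_to_ac M] by auto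
  then have "finite \<Theta>" unfolding \<Theta>_def by (rule poly_roots_finite)
  have char2: "\<not> (n = 2 \<and> of_nat n = (0 :: 'k alg_closure))"
  proof
    assume a: "n = 2 \<and> of_nat n = (0 :: 'k alg_closure)"
    then have "CHAR('k) dvd 2" by (metis CHAR_alg_closure of_nat_eq_0_iff_char_dvd)
    then have "CHAR('k) \<in> {1, 2}" using prime_nat_iff two_is_prime_nat by blast
    moreover have "CHAR('k) \<noteq> 1" by simp
    ultimately show False using a n by auto
  qed
  interpret K_cover \<Theta> "poly (map_poly to_ac W)" n M W P
  proof unfold_locales
    fix \<theta> assume "\<theta> \<in> \<Theta>"
    then show "card {\<eta> \<in> \<Theta>. poly (map_poly to_ac W) \<eta> = poly (map_poly to_ac W) \<theta>} = n"
      using fibres[of \<theta>] by (simp add: \<Theta>_def)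
  qed (use \<open>finite \<Theta>\<close> n char2 M card P in \<open>auto simp: \<Theta>_def\<close>)
  obtain x where x: "x \<in> V" "\<And>i. x i \<in> range to_ac" using K_rational_point[OF pac] by blast
  define a where "a i = of_ac (x i)" for i
  have a: "to_ac (a i) = x i" for i using x(2)[of i] by (simp add: a_def to_ac_of_ac)
  define Q where "Q = (\<Sum>s<N. Polynomial.monom (a (n + 1 + s)) s)"
  have Q: "poly (map_poly to_ac Q) \<theta> = roots_at x \<theta>" for \<theta>
  proof -
    note h = is_hom_ev[OF is_hom_id, of x]
    have "map_poly to_ac Q = (\<Sum>s<N. Polynomial.monom (x (n + 1 + s)) s)"
      unfolding Q_def hom_sum[OF is_hom_map_poly[OF is_hom_to_ac]] by (simp add: map_hom_monom[OF is_hom_to_ac] a)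
    then show ?thesis
      by (simp add: tau_def hom_sum[OF h] hom_mult[OF h] ev_Const[OF is_hom_id] ev_Var[OF is_hom_id] poly_sum poly_monom mult.commute)
  qed
  have "solves (\<lambda>c. c) x (roots_at x)" "ev (\<lambda>c. c) x P \<noteq> 0" using point_solves[OF x(1)] by auto
  then have "\<forall>\<theta>. \<theta> \<in> \<Theta> \<longrightarrow> poly (gmon n x) (poly (map_poly to_ac Q) \<theta>) = poly (map_poly to_ac W) \<theta>"
    "inj_on (poly (map_poly to_ac Q)) \<Theta>" "ev (\<lambda>c. c) x P \<noteq> 0"
    by (auto simp: solves_def Q inj_on_def)
  then show ?thesis
    by (intro exI[of _ a] exI[of _ Q] conjI) (simp_all add: a \<Theta>_def)
qed

subsection \<open>Minimal polynomials\<close>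

abbreviation acp :: "'k::field poly \<Rightarrow> 'k alg_closure poly" where
  "acp \<equiv> map_poly to_ac"

lemmas acp_hom = is_hom_map_poly[OF is_hom_to_ac]

lemmas acp_simps = hom_add[OF acp_hom] hom_mult[OF acp_hom] hom_diff[OF acp_hom] hom_sum[OF acp_hom]
  hom_power[OF acp_hom] map_hom_pCons[OF is_hom_to_ac] map_hom_pcompose[OF is_hom_to_ac]
  map_hom_monom[OF is_hom_to_ac] coeff_map_hom[OF is_hom_to_ac]

lemma acp_eq_0_iff: "acp p = 0 \<longleftrightarrow> p = 0"
  by (auto simp: poly_eq_iff acp_simps)

lemma degree_acp: "degree (acp p) = degree p"
  by (intro degree_map_poly) auto

lemma pderiv_acp: "pderiv (acp p) = acp (pderiv p)"
  by (rule poly_eqI) (simp add: coeff_pderiv acp_simps)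

lemma polys_over_range_to_ac: "p \<in> polys_over (range to_ac) \<longleftrightarrow> (\<exists>q. p = acp q)"
proof
  assume "p \<in> polys_over (range to_ac)"
  then have "p = acp (map_poly of_ac p)"
    by (intro poly_eqI) (auto simp: acp_simps coeff_map_poly polys_over_def to_ac_of_ac)
  then show "\<exists>q. p = acp q" ..
qed (auto simp: polys_over_def acp_simps)

text \<open>Everything in the closure is algebraic over K, so a polynomial relation of least degree
  has nonzero constant term and can be solved for the inverse.\<close>

lemma algebraic_inverse_in_subring:
  fixes x :: "'k::field alg_closure"
  assumes E: "is_subring E" and K: "range to_ac \<subseteq> E" and x: "x \<in> E"
  shows "inverse x \<in> E"
proof (cases "x = 0")
  case True
  then show ?thesis using subring_zero[OF E] by simp
next
  case False
  define Q where "Q p \<longleftrightarrow> p \<noteq> 0 \<and> poly (acp p) x = 0" for p :: "'k poly"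
  have "\<exists>p. Q p" using alg_closure_algebraic[of x] unfolding Q_def by blast
  then obtain p where p: "Q p" "\<And>q. Q q \<Longrightarrow> degree p \<le> degree q"
    using ex_has_least_nat[of Q _ degree] by blast
  obtain c q where pq: "p = pCons c q" by (cases p)
  \<comment> \<open>Otherwise the relation could be divided by the nonzero \<open>x\<close>.\<close>
  have "c \<noteq> 0"
  proof
    assume c: "c = 0"
    then have "q \<noteq> 0" "poly (acp q) x = 0" using p(1) False by (auto simp: Q_def pq acp_simps)
    then have "degree p \<le> degree q" by (intro p(2)) (simp add: Q_def)
    then show False using \<open>q \<noteq> 0\<close> by (simp add: pq)
  qed
  have "to_ac c + x * poly (acp q) x = 0" using p(1) by (simp add: Q_def pq acp_simps)
  then have "x * poly (acp q) x = - to_ac c" by (simp add: eq_neg_iff_add_eq_0 add.commute)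
  moreover have "x * (- poly (acp q) x * to_ac (inverse c)) = - (x * poly (acp q) x) * to_ac (inverse c)" by simp
  ultimately have "x * (- poly (acp q) x * to_ac (inverse c)) = 1"
    using \<open>c \<noteq> 0\<close> by simp
  then have "inverse x = - poly (acp q) x * to_ac (inverse c)"
    by (metis inverse_unique)
  moreover have "acp q \<in> polys_over E" using K by (auto simp: polys_over_def acp_simps)
  ultimately show ?thesis
    using K by (auto intro!: subring_mult[OF E] subring_uminus[OF E] poly_in_subring[OF E _ x] simp del: to_ac_inverse)
qed

lemma minimal_polynomial_exists:
  fixes x :: "'k::field alg_closure"
  assumes E: "is_subring E" and K: "range to_ac \<subseteq> E"
  shows "\<exists>h \<in> polys_over E. lead_coeff h = 1 \<and> poly h x = 0 \<and>
    (\<forall>q \<in> polys_over E. poly q x = 0 \<longrightarrow> (\<exists>Q \<in> polys_over E. q = Q * h))"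
proof -
  define A where "A h \<longleftrightarrow> h \<in> polys_over E \<and> h \<noteq> 0 \<and> poly h x = 0" for h
  obtain p :: "'k poly" where "p \<noteq> 0" "poly (acp p) x = 0" using alg_closure_algebraic[of x] by blast
  then have "A (acp p)" using K by (auto simp: A_def acp_eq_0_iff polys_over_def acp_simps)
  then obtain g where g: "A g" "\<And>q. A q \<Longrightarrow> degree g \<le> degree q"
    using ex_has_least_nat[of A _ degree] by blast
  define h where "h = smult (inverse (lead_coeff g)) g"
  have l: "lead_coeff g \<noteq> 0" using g(1) by (auto simp: A_def)
  have "inverse (lead_coeff g) \<in> E"
    using g(1) by (intro algebraic_inverse_in_subring[OF E K]) (auto simp: A_def polys_over_def)
  then have hE: "h \<in> polys_over E" using g(1) by (auto simp: h_def A_def polys_over_def intro!: subring_mult[OF E])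
  have h: "lead_coeff h = 1" "poly h x = 0" "degree h = degree g"
    using l g(1) by (auto simp: h_def A_def)
  have "\<exists>Q \<in> polys_over E. q = Q * h" if q: "q \<in> polys_over E" "poly q x = 0" for q
  proof -
    obtain Q r where Q: "Q \<in> polys_over E" "r \<in> polys_over E" "q = Q * h + r" "\<And>i. i \<ge> degree h \<Longrightarrow> poly.coeff r i = 0"
      using monic_division[OF E hE h(1) q(1)] by blast
    have "r = 0"
    proof (rule ccontr)
      assume nz: "r \<noteq> 0"
      have "poly r x = 0" using Q(3) q(2) h(2) by simp
      then have "degree g \<le> degree r" using nz Q(2) by (intro g(2)) (simp add: A_def)
      then have "lead_coeff r = 0" using Q(4) h(3) by simp
      with nz show False by simp
    qed
    then show ?thesis using Q by auto
  qed
  then show ?thesis using hE h by blast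
qed

lemma minimal_polynomial_over_K:
  fixes x :: "'k::field alg_closure"
  shows "\<exists>M. lead_coeff M = 1 \<and> poly (acp M) x = 0 \<and> (\<forall>q. poly (acp q) x = 0 \<longrightarrow> M dvd q)"
proof -
  obtain h where h: "h \<in> polys_over (range to_ac)" "lead_coeff h = 1" "poly h x = 0"
    "\<And>q. q \<in> polys_over (range to_ac) \<Longrightarrow> poly q x = 0 \<Longrightarrow> \<exists>Q \<in> polys_over (range to_ac). q = Q * h"
    using minimal_polynomial_exists[OF is_subring_range_to_ac order.refl, of x] by blast
  obtain M where M: "h = acp M" using h(1) unfolding polys_over_range_to_ac by blast
  have "M dvd q" if "poly (acp q) x = 0" for q
  proof -
    have "acp q \<in> polys_over (range to_ac)" unfolding polys_over_range_to_ac by blast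
    from h(4)[OF this that] obtain Q' where Q': "Q' \<in> polys_over (range to_ac)" "acp q = Q' * acp M"
      unfolding M by blast
    then obtain Q where "acp q = acp Q * acp M" unfolding polys_over_range_to_ac by blast
    then have "acp (q - Q * M) = 0" by (simp add: acp_simps)
    then have "q = Q * M" by (simp add: acp_eq_0_iff)
    then show ?thesis by simp
  qed
  moreover have "lead_coeff M = 1"
    using h(2) by (simp add: M degree_acp acp_simps flip: to_ac_1)
  ultimately show ?thesis using h(3) M by blast
qed

lemma rsquarefree_iff_simple_roots:
  fixes p :: "'a::idom poly"
  shows "rsquarefree p \<longleftrightarrow> p \<noteq> 0 \<and> (\<forall>x. poly p x = 0 \<longrightarrow> poly (pderiv p) x \<noteq> 0)"
proof (cases "p = 0")
  case False
  have "order x p \<ge> 2 \<longleftrightarrow> poly p x = 0 \<and> poly (pderiv p) x = 0" for x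
  proof
    assume "order x p \<ge> 2"
    then have "[:- x, 1:] ^ 2 dvd p" using order_divides[of x 2 p] by simp
    then obtain q where "p = [:- x, 1:] ^ 2 * q" by (elim dvdE)
    then have q: "p = [:- x, 1:] * ([:- x, 1:] * q)" by (simp only: power2_eq_square mult.assoc)
    show "poly p x = 0 \<and> poly (pderiv p) x = 0"
      unfolding q pderiv_mult by simp
  next
    assume x: "poly p x = 0 \<and> poly (pderiv p) x = 0"
    then obtain q where q: "p = [:- x, 1:] * q" by (metis poly_eq_0_iff_dvd dvdE)
    have "poly q x = 0" using x unfolding q pderiv_mult by (simp add: pderiv_pCons)
    then obtain r where "q = [:- x, 1:] * r" by (metis poly_eq_0_iff_dvd dvdE)
    then have "[:- x, 1:] ^ 2 dvd p" unfolding q power2_eq_square by (simp only: mult.assoc[symmetric] dvd_triv_left)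
    then show "order x p \<ge> 2" using order_divides[of x 2 p] False by simp
  qed
  moreover have "rsquarefree p \<longleftrightarrow> (\<forall>x. \<not> order x p \<ge> 2)"
    using False unfolding rsquarefree_def by (metis One_nat_def le_neq_implies_less less_2_cases_iff not_le numeral_2_eq_2)
  ultimately show ?thesis using False by blast
qed (simp add: rsquarefree_def)

text \<open>The minimal polynomial of \<open>\<beta>\<close> over \<open>E\<close> divides both
  \<open>p\<close> and \<open>q\<close>; it is separable with no root besides
  \<open>\<beta>\<close>, hence linear.\<close>

lemma unique_common_root_in_subring:
  fixes \<beta> :: "'k::field alg_closure"
  assumes E: "is_subring E" and K: "range to_ac \<subseteq> E"
    and p: "p \<in> polys_over E" "poly p \<beta> = 0" "rsquarefree p" and q: "q \<in> polys_over E" "poly q \<beta> = 0"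
    and uniq: "\<And>x. poly p x = 0 \<Longrightarrow> poly q x = 0 \<Longrightarrow> x = \<beta>"
  shows "\<beta> \<in> E"
proof -
  obtain h where h: "h \<in> polys_over E" "lead_coeff h = 1" "poly h \<beta> = 0"
    "\<And>q. q \<in> polys_over E \<Longrightarrow> poly q \<beta> = 0 \<Longrightarrow> \<exists>Q \<in> polys_over E. q = Q * h"
    using minimal_polynomial_exists[OF E K, of \<beta>] by blast
  obtain P where P: "p = P * h" using h(4)[OF p(1,2)] by blast
  obtain Q where Q: "q = Q * h" using h(4)[OF q] by blast
  have hz: "h \<noteq> 0" using h(2) by auto
  have sq: "\<not> (poly (P * h) x = 0 \<and> poly (pderiv (P * h)) x = 0)" for x
    using p(3) unfolding rsquarefree_iff_simple_roots P by blast
  have "poly (pderiv h) x \<noteq> 0" if "poly h x = 0" for x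
    using sq[of x] that by (auto simp: pderiv_mult)
  then have "card {x. poly h x = 0} = degree h" by (intro card_roots_separable hz)
  moreover have "{x. poly h x = 0} = {\<beta>}" using uniq P Q h(3) by auto
  ultimately have d: "degree h = 1" by simp
  define c where "c = poly.coeff h 0"
  have c: "h = [:c, 1:]"
    using d h(2) by (intro poly_eqI) (auto simp: c_def coeff_pCons coeff_eq_0 split: nat.splits)
  have "poly [:c, 1:] \<beta> = 0" using h(3) c by metis
  then have "\<beta> = - c" by (simp add: eq_neg_iff_add_eq_0 add.commute)
  moreover have "c \<in> E" using h(1) unfolding c by (simp add: polys_over_pCons)
  ultimately show ?thesis by (simp add: subring_uminus[OF E])
qed

text \<open>The argument of the primitive element theorem: for all but finitely many
  \<open>c\<close>, the only common root of \<open>\<mu>\<close> and of \<open>\<nu>\<close> at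
  \<open>\<theta> + c \<beta> - c t\<close>, as a polynomial in \<open>t\<close>, is
  \<open>\<beta>\<close>. Separability is required of \<open>\<beta>\<close> only.\<close>

lemma two_generators:
  fixes \<theta> \<beta> :: "'k::field alg_closure"
  assumes \<mu>: "poly \<mu> \<beta> = 0" "rsquarefree \<mu>" and \<nu>: "poly \<nu> \<theta> = 0" "\<nu> \<noteq> 0"
  shows "\<exists>B. finite B \<and> (\<forall>c E. c \<notin> B \<longrightarrow> is_subring E \<longrightarrow> range to_ac \<subseteq> E \<longrightarrow>
    \<mu> \<in> polys_over E \<longrightarrow> \<nu> \<in> polys_over E \<longrightarrow> c \<in> E \<longrightarrow> \<theta> + c * \<beta> \<in> E \<longrightarrow> \<beta> \<in> E)"
proof -
  \<comment> \<open>Contains every \<open>c\<close> for which a root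
    \<open>t \<noteq> \<beta>\<close> of \<open>\<mu>\<close> is also a root of the second
    polynomial. It does not mention \<open>E\<close>, so \<open>c\<close> can be chosen before the
    field that depends on it.\<close>
  define B where "B = (\<lambda>(t, s). (s - \<theta>) / (\<beta> - t)) ` ({t. poly \<mu> t = 0} \<times> {s. poly \<nu> s = 0})"
  have "\<mu> \<noteq> 0" using \<mu>(2) by (auto simp: rsquarefree_def)
  then have "finite B" unfolding B_def using poly_roots_finite \<nu>(2) by (intro finite_imageI finite_cartesian_product) auto
  moreover have "\<beta> \<in> E" if c: "c \<notin> B" and E: "is_subring E" and K: "range to_ac \<subseteq> E"
    and mE: "\<mu> \<in> polys_over E" and nE: "\<nu> \<in> polys_over E" and cE: "c \<in> E" and y: "\<theta> + c * \<beta> \<in> E" for c E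
  proof -
    define q where "q = pcompose \<nu> [:\<theta> + c * \<beta>, - c:]"
    have q: "poly q t = poly \<nu> (\<theta> + c * \<beta> - c * t)" for t
      by (simp add: q_def poly_pcompose mult.commute)
    show ?thesis
    proof (rule unique_common_root_in_subring[OF E K mE \<mu>])
      show "q \<in> polys_over E"
        unfolding q_def using cE y by (intro pcompose_polys_over[OF E nE])
          (auto simp: polys_over_pCons polys_over_0[OF E] intro: subring_uminus[OF E])
      show "poly q \<beta> = 0" by (simp add: q \<nu>)
      fix t assume t: "poly \<mu> t = 0" "poly q t = 0"
      show "t = \<beta>"
      proof (rule ccontr)
        assume ne: "t \<noteq> \<beta>"
        define s where "s = \<theta> + c * \<beta> - c * t"
        have "c = (s - \<theta>) / (\<beta> - t)" using ne by (simp add: s_def field_simps)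
        moreover have "poly \<nu> s = 0" using t(2) by (simp add: q s_def)
        ultimately have "c \<in> B" using t(1) unfolding B_def by (intro image_eqI[of _ _ "(t, s)"]) auto
        with c show False by simp
      qed
    qed
  qed
  ultimately show ?thesis by blast
qed

subsection \<open>Linear algebra over the ground field\<close>

text \<open>Indexed families let powers and products be used without knowing that they are
  distinct.\<close>

definition K_span :: "'i set \<Rightarrow> ('i \<Rightarrow> 'k::field alg_closure) \<Rightarrow> 'k alg_closure set" where
  "K_span I b = range (\<lambda>u. \<Sum>i\<in>I. to_ac (u i) * b i)"

lemma K_spanI: "(\<Sum>i\<in>I. to_ac (u i) * b i) \<in> K_span I b"
  unfolding K_span_def by (rule rangeI)

definition K_indep :: "'i set \<Rightarrow> ('i \<Rightarrow> 'k::field alg_closure) \<Rightarrow> bool" where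
  "K_indep I b \<longleftrightarrow> (\<forall>u. (\<Sum>i\<in>I. to_ac (u i) * b i) = 0 \<longrightarrow> (\<forall>i\<in>I. u i = 0))"

interpretation Kvs: vector_space "\<lambda>(c::'k::field) x. to_ac c * (x :: 'k alg_closure)"
  by unfold_locales (auto simp: algebra_simps)

lemma K_indep_inj:
  fixes b :: "'i \<Rightarrow> 'k::field alg_closure"
  assumes "finite I" "K_indep I b"
  shows "inj_on b I"
proof (rule inj_onI, rule ccontr)
  fix i j assume ij: "i \<in> I" "j \<in> I" "b i = b j" "i \<noteq> j"
  define u :: "'i \<Rightarrow> 'k" where "u k = (if k = i then 1 else if k = j then -1 else 0)" for k
  have "(\<Sum>k\<in>I. to_ac (u k) * b k) = (\<Sum>k\<in>{i, j}. to_ac (u k) * b k)"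
    by (rule sum.mono_neutral_right) (use assms ij in \<open>auto simp: u_def\<close>)
  also have "\<dots> = 0" using ij by (simp add: u_def)
  finally have "u i = 0" using assms(2) ij unfolding K_indep_def by blast
  then show False by (simp add: u_def)
qed

lemma K_indep_independent:
  assumes "finite I" "K_indep I b"
  shows "Kvs.independent (b ` I)"
proof (rule Kvs.independent_if_scalars_zero)
  fix g x assume g: "(\<Sum>x\<in>b ` I. to_ac (g x) * x) = 0" "x \<in> b ` I"
  then have "(\<Sum>i\<in>I. to_ac (g (b i)) * b i) = 0"
    by (simp add: sum.reindex[OF K_indep_inj[OF assms]])
  then have "\<forall>i\<in>I. g (b i) = 0" using assms(2) unfolding K_indep_def by (elim allE[of _ "\<lambda>i. g (b i)"]) auto
  then show "g x = 0" using g(2) by auto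
qed (use assms in simp)

lemma K_span_subset_span: "K_span I b \<subseteq> Kvs.span (b ` I)"
proof
  fix x assume "x \<in> K_span I b"
  then obtain u where x: "x = (\<Sum>i\<in>I. to_ac (u i) * b i)" unfolding K_span_def by blast
  show "x \<in> Kvs.span (b ` I)"
    unfolding x by (rule Kvs.span_sum, rule Kvs.span_scale, rule Kvs.span_base) (rule imageI)
qed

lemma K_dim_bound:
  assumes "finite I" "finite J" "K_indep I b" "\<And>i. i \<in> I \<Longrightarrow> b i \<in> K_span J c"
  shows "card I \<le> card J"
proof -
  have "b ` I \<subseteq> Kvs.span (c ` J)" using assms(4) K_span_subset_span[of J c] by auto
  then have "card (b ` I) \<le> card (c ` J)"
    using Kvs.independent_span_bound[OF _ K_indep_independent[OF assms(1,3)], of "c ` J"] assms(2) by auto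
  also have "\<dots> \<le> card J" by (rule card_image_le[OF assms(2)])
  finally show ?thesis by (simp add: card_image[OF K_indep_inj[OF assms(1,3)]])
qed

text \<open>A vector outside the span of \<open>b\<close> would enlarge \<open>b\<close> to an
  independent family with more members than \<open>c\<close>.\<close>

lemma K_dim_eq_span:
  assumes "finite I" "finite J" "K_indep I b" "\<And>i. i \<in> I \<Longrightarrow> b i \<in> K_span J c" "card J \<le> card I"
  shows "K_span J c \<subseteq> K_span I b"
proof
  fix x assume x: "x \<in> K_span J c"
  show "x \<in> K_span I b"
  proof (rule ccontr)
    assume nx: "x \<notin> K_span I b"
    define b' where "b' k = (case k of None \<Rightarrow> x | Some i \<Rightarrow> b i)" for k
    define I' where "I' = insert None (Some ` I)"
    have "finite I'" and cI': "card I' = Suc (card I)"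
      using assms(1) by (auto simp: I'_def card_image)
    have sum': "(\<Sum>k\<in>I'. to_ac (u k) * b' k) = to_ac (u None) * x + (\<Sum>i\<in>I. to_ac (u (Some i)) * b i)" for u
      using assms(1) by (simp add: I'_def b'_def sum.reindex)
    have "K_indep I' b'"
      unfolding K_indep_def sum'
    proof (intro allI impI)
      fix u assume s: "to_ac (u None) * x + (\<Sum>i\<in>I. to_ac (u (Some i)) * b i) = 0"
      have u0: "u None = 0"
      proof (rule ccontr)
        assume nz: "u None \<noteq> 0"
        have "to_ac (u None) * x = - (\<Sum>i\<in>I. to_ac (u (Some i)) * b i)" using s by (simp add: eq_neg_iff_add_eq_0)
        then have "x = to_ac (- inverse (u None)) * (\<Sum>i\<in>I. to_ac (u (Some i)) * b i)"
          using nz by (simp add: field_simps)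
        also have "\<dots> = (\<Sum>i\<in>I. to_ac (- inverse (u None) * u (Some i)) * b i)"
          by (simp add: sum_distrib_left mult.assoc)
        finally have "x \<in> K_span I b" by (simp only: K_spanI)
        with nx show False ..
      qed
      then have "\<forall>i\<in>I. u (Some i) = 0" using s assms(3) unfolding K_indep_def by (elim allE[of _ "\<lambda>i. u (Some i)"]) auto
      then show "\<forall>k\<in>I'. u k = 0" using u0 by (auto simp: I'_def)
    qed
    then have "card I' \<le> card J"
      by (rule K_dim_bound[OF \<open>finite I'\<close> assms(2)]) (use x assms(4) in \<open>auto simp: I'_def b'_def\<close>)
    then show False using cI' assms(5) by simp
  qed
qed

definition K_adj :: "'k::field alg_closure \<Rightarrow> 'k alg_closure set" where
  "K_adj x = range (\<lambda>q. poly (acp q) x)"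

lemma K_adj: "is_subring (K_adj x)" "range to_ac \<subseteq> K_adj x" "x \<in> K_adj x"
proof -
  show "is_subring (K_adj x)"
    unfolding is_subring_def K_adj_def
  proof (intro conjI ballI)
    show "1 \<in> range (\<lambda>q. poly (acp q) x)" by (rule image_eqI[of _ _ 1]) auto
  next
    fix y z assume "y \<in> range (\<lambda>q. poly (acp q) x)" "z \<in> range (\<lambda>q. poly (acp q) x)"
    then obtain p q where "y = poly (acp p) x" "z = poly (acp q) x" by blast
    then have "y - z = poly (acp (p - q)) x" "y * z = poly (acp (p * q)) x" by (simp_all add: acp_simps)
    then show "y - z \<in> range (\<lambda>q. poly (acp q) x)" "y * z \<in> range (\<lambda>q. poly (acp q) x)" by blast+
  qed
  show "range to_ac \<subseteq> K_adj x"
  proof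
    fix y :: "'a alg_closure" assume "y \<in> range to_ac"
    then obtain c where "y = to_ac c" by blast
    then have "y = poly (acp [:c:]) x" by (simp add: acp_simps)
    then show "y \<in> K_adj x" unfolding K_adj_def by blast
  qed
  have "x = poly (acp [:0, 1:]) x" by (simp add: acp_simps)
  then show "x \<in> K_adj x" unfolding K_adj_def by blast
qed

lemma K_adj_subset:
  assumes "is_subring E" "range to_ac \<subseteq> E" "x \<in> E"
  shows "K_adj x \<subseteq> E"
  using assms by (auto simp: K_adj_def polys_over_def acp_simps image_subset_iff intro!: poly_in_subring)

lemma K_adj_basis:
  assumes M: "lead_coeff M = 1" "poly (acp M) x = 0" "\<And>q. poly (acp q) x = 0 \<Longrightarrow> M dvd q"
  shows "K_indep {..<degree M} (\<lambda>i. x ^ i)" "K_adj x = K_span {..<degree M} (\<lambda>i. x ^ i)"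
proof -
  have ps: "(\<Sum>i<degree M. to_ac (u i) * x ^ i) = poly (acp (\<Sum>i<degree M. Polynomial.monom (u i) i)) x" for u
    by (simp add: acp_simps poly_sum poly_monom)
  show "K_indep {..<degree M} (\<lambda>i. x ^ i)"
    unfolding K_indep_def ps
  proof (intro allI impI ballI)
    fix u i assume z: "poly (acp (\<Sum>i<degree M. Polynomial.monom (u i) i)) x = 0" and i: "i \<in> {..<degree M}"
    define q where "q = (\<Sum>i<degree M. Polynomial.monom (u i) i)"
    have cq: "poly.coeff q j = (if j < degree M then u j else 0)" for j by (simp add: q_def coeff_sum)
    have "M dvd q" using z M(3) by (simp add: q_def)
    have "q = 0"
    proof (rule ccontr)
      assume nz: "q \<noteq> 0"
      then have "degree M \<le> degree q" using \<open>M dvd q\<close> by (rule dvd_imp_degree_le[rotated])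
      then have "lead_coeff q = 0" by (simp add: cq)
      with nz show False by simp
    qed
    then show "u i = 0" using cq[of i] i by simp
  qed
  show "K_adj x = K_span {..<degree M} (\<lambda>i. x ^ i)"
  proof
    show "K_span {..<degree M} (\<lambda>i. x ^ i) \<subseteq> K_adj x"
      unfolding K_span_def K_adj_def ps by blast
    show "K_adj x \<subseteq> K_span {..<degree M} (\<lambda>i. x ^ i)"
    proof
      fix y assume "y \<in> K_adj x"
      then obtain p where p: "y = poly (acp p) x" unfolding K_adj_def by blast
      have US: "is_subring (UNIV :: 'a set)" by (auto simp: is_subring_def)
      obtain Q r where Q: "p = Q * M + r" "\<And>i. i \<ge> degree M \<Longrightarrow> poly.coeff r i = 0"
        using monic_division[OF US _ M(1), of p] by (auto simp: polys_over_def)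
      have "y = poly (acp r) x" using M(2) by (simp add: p Q(1) acp_simps)
      also have "\<dots> = (\<Sum>i<degree M. to_ac (poly.coeff r i) * x ^ i)"
        by (subst poly_eq_sum_lessThan[of "degree M"]) (use Q(2) in \<open>auto simp: acp_simps\<close>)
      finally show "y \<in> K_span {..<degree M} (\<lambda>i. x ^ i)" unfolding K_span_def by blast
    qed
  qed
qed

text \<open>The half of the degree formula that bounds dimensions from below: products of
  independent families are independent.\<close>

lemma K_indep_tower:
  assumes c: "finite I" "K_indep I c" "K_span I c \<subseteq> F" and "finite J"
    and b: "\<And>u. (\<And>j. j \<in> J \<Longrightarrow> u j \<in> F) \<Longrightarrow> (\<Sum>j\<in>J. u j * b j) = 0 \<Longrightarrow> (\<forall>j\<in>J. u j = 0)"
  shows "K_indep (I \<times> J) (\<lambda>(i, j). c i * b j)"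
  unfolding K_indep_def
proof (intro allI impI)
  fix u assume z: "(\<Sum>x\<in>I \<times> J. to_ac (u x) * (case x of (i, j) \<Rightarrow> c i * b j)) = 0"
  define v where "v j = (\<Sum>i\<in>I. to_ac (u (i, j)) * c i)" for j
  have "(\<Sum>x\<in>I \<times> J. to_ac (u x) * (case x of (i, j) \<Rightarrow> c i * b j)) = (\<Sum>i\<in>I. \<Sum>j\<in>J. to_ac (u (i, j)) * (c i * b j))"
    by (simp add: sum.cartesian_product case_prod_unfold)
  also have "\<dots> = (\<Sum>j\<in>J. v j * b j)"
    unfolding v_def sum_distrib_right by (subst sum.swap) (simp add: mult.assoc)
  finally have "(\<Sum>j\<in>J. v j * b j) = 0" using z by simp
  moreover have "v j \<in> F" for j unfolding v_def by (rule subsetD[OF c(3) K_spanI])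
  ultimately have "\<forall>j\<in>J. v j = 0" using b[of v] by blast
  then have "u (i, j) = 0" if "i \<in> I" "j \<in> J" for i j
    using c(2) that unfolding K_indep_def v_def by (elim allE[of _ "\<lambda>i. u (i, j)"]) auto
  then show "\<forall>x\<in>I \<times> J. u x = 0" by auto
qed

lemma Kbar_simps:
  "carrier Kbar = UNIV" "x \<otimes>\<^bsub>Kbar\<^esub> y = x * y" "x \<oplus>\<^bsub>Kbar\<^esub> y = x + y" "\<one>\<^bsub>Kbar\<^esub> = 1" "\<zero>\<^bsub>Kbar\<^esub> = 0"
  by (simp_all add: ring_of_type_algebra_def)

lemma Kbar_field: "field Kbar"
  by (rule field_from_type_algebra)

lemma Kbar_ring: "ring Kbar"
  by (rule ring_from_type_algebra)

lemma Kbar_a_inv: "\<ominus>\<^bsub>Kbar\<^esub> x = - x"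
  by (rule abelian_group.minus_equality[OF ring.is_abelian_group[OF Kbar_ring]]) (auto simp: Kbar_simps)

lemma Kbar_m_inv: "x \<noteq> 0 \<Longrightarrow> inv\<^bsub>Kbar\<^esub> x = inverse x"
  by (rule monoid.inv_char[OF ring.is_monoid[OF Kbar_ring]]) (auto simp: Kbar_simps)

lemma is_subring_subfield:
  assumes "subfield L Kbar"
  shows "is_subring L"
proof -
  have s: "subring L Kbar" by (rule subfieldE(1)[OF assms])
  show ?thesis
    unfolding is_subring_def
  proof (intro conjI ballI)
    show "1 \<in> L" using subringE(3)[OF s] by (simp add: Kbar_simps)
    fix x y assume x: "x \<in> L" and y: "y \<in> L"
    have "x + - y \<in> L"
      using subringE(7)[OF s x subringE(5)[OF s y]] by (simp add: Kbar_simps Kbar_a_inv)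
    then show "x - y \<in> L" by simp
    show "x * y \<in> L" using subringE(6)[OF s x y] by (simp add: Kbar_simps)
  qed
qed

text \<open>Polynomial expressions in an algebraic element already form a field.\<close>

lemma K_adjoin_eq: "K_adjoin x = K_adj x"
proof
  show "K_adjoin x \<subseteq> K_adj x"
  proof
    fix y assume "y \<in> K_adjoin x"
    then show "y \<in> K_adj x"
      unfolding K_adjoin_def
    proof (induction rule: generate_field.induct)
      case one
      then show ?case using subring_one[OF K_adj(1)] by (simp add: Kbar_simps)
    next
      case (incl h)
      then show ?case using K_adj(2,3)[of x] by auto
    next
      case (a_inv h)
      then show ?case using subring_uminus[OF K_adj(1)] by (simp add: Kbar_a_inv)
    next
      case (m_inv h)
      then show ?case
        using algebraic_inverse_in_subring[OF K_adj(1,2)] by (simp add: Kbar_m_inv Kbar_simps)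
    next
      case (eng_add h1 h2)
      then show ?case using subring_add[OF K_adj(1)] by (simp add: Kbar_simps)
    next
      case (eng_mult h1 h2)
      then show ?case using subring_mult[OF K_adj(1)] by (simp add: Kbar_simps)
    qed
  qed
  have "subfield (K_adjoin x) Kbar"
    unfolding K_adjoin_def by (rule field.generate_field_is_subfield[OF Kbar_field]) (simp add: Kbar_simps)
  then show "K_adj x \<subseteq> K_adjoin x"
    by (intro K_adj_subset is_subring_subfield) (auto simp: K_adjoin_def intro: generate_field.incl)
qed

lemma combine_eq_sum:
  "length Ks = length Us \<Longrightarrow> ring.combine Kbar Ks Us = (\<Sum>i<length Us. Ks ! i * Us ! i)"
proof (induction Ks Us rule: list_induct2)
  case Nil
  then show ?case by (simp add: ring.combine.simps[OF Kbar_ring] Kbar_simps)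
next
  case (Cons k Ks u Us)
  then show ?case
    by (simp add: ring.combine.simps[OF Kbar_ring] Kbar_simps sum.lessThan_Suc_shift del: sum.lessThan_Suc)
qed

lemma dimension_basis:
  assumes F: "subfield F Kbar" and dim: "ring.dimension Kbar n F L"
  shows "\<exists>b. (\<forall>x\<in>L. \<exists>u. (\<forall>k<n. u k \<in> F) \<and> x = (\<Sum>k<n. u k * b k)) \<and> (\<forall>k<n. b k \<in> L) \<and>
    (\<forall>u. (\<forall>k<n. u k \<in> F) \<longrightarrow> (\<Sum>k<n. u k * b k) = 0 \<longrightarrow> (\<forall>k<n. u k = 0))"
proof -
  obtain Vs where Vs: "set Vs \<subseteq> carrier Kbar" "ring.independent Kbar F Vs" "length Vs = n" "ring.Span Kbar F Vs = L"
    using ring.exists_base[OF Kbar_ring F dim] by blast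
  have L: "L = {ring.combine Kbar Ks Vs | Ks. length Ks = length Vs \<and> set Ks \<subseteq> F}"
    using ring.Span_eq_combine_set_length_version[OF Kbar_ring F Vs(1)] Vs(4) by simp
  have L': "x \<in> L \<longleftrightarrow> (\<exists>u. (\<forall>k<n. u k \<in> F) \<and> x = (\<Sum>k<n. u k * Vs ! k))" for x
  proof
    assume "x \<in> L"
    then obtain Ks where "length Ks = n" "set Ks \<subseteq> F" "x = (\<Sum>k<n. Ks ! k * Vs ! k)"
      unfolding L using Vs(3) combine_eq_sum by auto
    then show "\<exists>u. (\<forall>k<n. u k \<in> F) \<and> x = (\<Sum>k<n. u k * Vs ! k)" by (intro exI[of _ "\<lambda>k. Ks ! k"]) auto
  next
    assume "\<exists>u. (\<forall>k<n. u k \<in> F) \<and> x = (\<Sum>k<n. u k * Vs ! k)"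
    then obtain u where u: "\<forall>k<n. u k \<in> F" "x = (\<Sum>k<n. u k * Vs ! k)" by blast
    have "x = ring.combine Kbar (map u [0..<n]) Vs"
      using u(2) Vs(3) by (subst combine_eq_sum) auto
    then show "x \<in> L" unfolding L using u(1) Vs(3) by (intro CollectI exI[of _ "map u [0..<n]"]) auto
  qed
  have zF: "0 \<in> F" "1 \<in> F" using is_subring_subfield[OF F] subring_zero subring_one by auto
  have "Vs ! k \<in> L" if "k < n" for k
  proof -
    have "(\<Sum>i<n. (if i = k then 1 else 0) * Vs ! i) = Vs ! k" using that by (simp add: if_distrib[of "\<lambda>c. c * _"] cong: if_cong)
    then show ?thesis unfolding L' using zF by (intro exI[of _ "\<lambda>i. if i = k then 1 else 0"]) auto
  qed
  moreover have "\<forall>k<n. u k = 0" if u: "\<forall>k<n. u k \<in> F" "(\<Sum>k<n. u k * Vs ! k) = 0" for u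
  proof -
    have "ring.combine Kbar (map u [0..<n]) Vs = \<zero>\<^bsub>Kbar\<^esub>"
      using u(2) Vs(3) by (subst combine_eq_sum) (auto simp: Kbar_simps)
    moreover have "set (map u [0..<n]) \<subseteq> F" using u(1) by auto
    ultimately have "set (take (length Vs) (map u [0..<n])) \<subseteq> {\<zero>\<^bsub>Kbar\<^esub>}"
      by (intro ring.independent_imp_trivial_combine[OF Kbar_ring F Vs(2)])
    then show ?thesis using Vs(3) by (auto simp: Kbar_simps image_subset_iff)
  qed
  ultimately show ?thesis using L' by (intro exI[of _ "\<lambda>k. Vs ! k"]) blast
qed

lemma irreducible_minimal_polynomial:
  fixes f :: "'k::field poly"
  assumes "Factorial_Ring.irreducible f" "poly (acp f) x = 0"
  shows "\<exists>M. lead_coeff M = 1 \<and> poly (acp M) x = 0 \<and> (\<forall>q. poly (acp q) x = 0 \<longrightarrow> M dvd q) \<and> degree M = degree f"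
proof -
  obtain M where M: "lead_coeff M = 1" "poly (acp M) x = 0" "\<And>q. poly (acp q) x = 0 \<Longrightarrow> M dvd q"
    using minimal_polynomial_over_K by blast
  obtain g where g: "f = M * g" using M(3)[OF assms(2)] by (elim dvdE)
  have f0: "f \<noteq> 0" using assms(1) by auto
  have "\<not> is_unit M"
  proof
    assume "is_unit M"
    then obtain h where "1 = M * h" by (elim dvdE)
    then have "poly (acp 1) x = 0" using M(2) by (metis hom_mult[OF acp_hom] mult_zero_left poly_mult)
    then show False by simp
  qed
  then have "is_unit g" using assms(1) g Factorial_Ring.irreducibleD by blast
  then have "degree g = 0" using g f0 by (simp add: is_unit_iff_degree)
  then have "degree M = degree f" using g f0 by (auto simp: degree_mult_eq)
  then show ?thesis using M by blast
qed

lemma pderiv_sum': "pderiv (sum g A) = (\<Sum>i\<in>A. pderiv (g i :: 'a::idom poly))"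
  by (induction A rule: infinite_finite_induct) (auto simp: pderiv_add)

text \<open>\<open>M\<close> is the minimal polynomial over K of a primitive element
  \<open>\<theta>\<close> of the given extension, and \<open>W\<close> expresses
  \<open>\<omega>\<close> through it. The roots of \<open>M\<close> above a value \<open>c\<close>
  are roots of the minimal polynomial of \<open>\<theta>\<close> over \<open>K(\<omega>)\<close>
  with \<open>\<omega>\<close> replaced by \<open>c\<close>. This bounds the fibres by
  \<open>n\<close>; equality will follow by counting.\<close>

theorem separable_extension_polynomial:
  fixes f :: "'k::field poly"
  assumes inf: "infinite (UNIV :: 'k set)" and irr: "Factorial_Ring.irreducible f" and sep: "separable_poly f"
    and root: "poly (acp f) \<omega> = 0" and n: "n > 0"
    and ext: "has_separable_extension_of_degree (K_adjoin \<omega>) n"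
  shows "\<exists>M W. lead_coeff M = 1 \<and> degree M = n * degree f \<and>
    (\<forall>x. poly (acp M) x = 0 \<longrightarrow> poly (pderiv (acp M)) x \<noteq> 0) \<and>
    (\<forall>x. poly (acp M) x = 0 \<longrightarrow> poly (acp f) (poly (acp W) x) = 0) \<and>
    (\<forall>c. card {x. poly (acp M) x = 0 \<and> poly (acp W) x = c} \<le> n) \<and>
    (\<forall>x q. poly (acp M) x = 0 \<longrightarrow> poly (acp q) x = 0 \<longrightarrow> M dvd q)"
proof -
  define F where "F = K_adj \<omega>"
  define d where "d = degree f"
  obtain L where L: "subfield L Kbar" "F \<subseteq> L" "ring.dimension Kbar n F L" "\<And>x. x \<in> L \<Longrightarrow> separable_over F x"
    using ext unfolding has_separable_extension_of_degree_def K_adjoin_eq F_def by blast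
  have Fsub: "subfield F Kbar"
    unfolding F_def K_adjoin_eq[symmetric] K_adjoin_def
    by (rule field.generate_field_is_subfield[OF Kbar_field]) (simp add: Kbar_simps)
  note RL = is_subring_subfield[OF L(1)] and RF = is_subring_subfield[OF Fsub]
  have KF: "range to_ac \<subseteq> F" and \<omega>F: "\<omega> \<in> F" unfolding F_def using K_adj by auto
  have KL: "range to_ac \<subseteq> L" using KF L(2) by auto
  obtain f0 where f0: "lead_coeff f0 = 1" "poly (acp f0) \<omega> = 0" "\<And>q. poly (acp q) \<omega> = 0 \<Longrightarrow> f0 dvd q" "degree f0 = d"
    using irreducible_minimal_polynomial[OF irr root] unfolding d_def by blast
  have \<omega>_indep: "K_indep {..<d} (\<lambda>i. \<omega> ^ i)" and F_span: "F = K_span {..<d} (\<lambda>i. \<omega> ^ i)"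
    using K_adj_basis[OF f0(1-3)] by (simp_all add: F_def f0(4))
  have d0: "d > 0"
  proof (rule ccontr)
    assume "\<not> d > 0"
    then have "f0 = 1" using f0(1,4) by (metis degree_eq_zeroE gr0I lead_coeff_pCons(2) one_pCons lead_coeff_pCons(1) pCons_0_0)
    then show False using f0(2) by simp
  qed
  obtain b where b: "\<And>x. x \<in> L \<Longrightarrow> \<exists>u. (\<forall>k<n. u k \<in> F) \<and> x = (\<Sum>k<n. u k * b k)" "\<And>k. k < n \<Longrightarrow> b k \<in> L"
    "\<And>u. (\<And>k. k < n \<Longrightarrow> u k \<in> F) \<Longrightarrow> (\<Sum>k<n. u k * b k) = 0 \<Longrightarrow> \<forall>k<n. u k = 0"
    using dimension_basis[OF Fsub L(3)] by blast
  define I where "I = {..<d} \<times> {..<n}"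
  define B where "B = (\<lambda>(i, j). \<omega> ^ i * b j)"
  have finI: "finite I" and cardI: "card I = d * n" by (simp_all add: I_def)
  have B_indep: "K_indep I B"
    unfolding I_def B_def by (rule K_indep_tower[OF _ \<omega>_indep _ _ ]) (use F_span b(3) in auto)
  have L_span: "L \<subseteq> K_span I B"
  proof
    fix x assume "x \<in> L"
    then obtain u where u: "\<forall>k<n. u k \<in> F" "x = (\<Sum>k<n. u k * b k)" using b(1) by blast
    then have "\<forall>k\<in>{..<n}. \<exists>v. u k = (\<Sum>i<d. to_ac (v i) * \<omega> ^ i)" unfolding F_span K_span_def by auto
    then obtain v where v: "\<And>k. k < n \<Longrightarrow> u k = (\<Sum>i<d. to_ac (v k i) * \<omega> ^ i)" by (metis lessThan_iff)
    have "x = (\<Sum>k<n. \<Sum>i<d. to_ac (v k i) * (\<omega> ^ i * b k))"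
      unfolding u(2) by (intro sum.cong) (auto simp: v sum_distrib_right mult.assoc)
    also have "\<dots> = (\<Sum>i<d. \<Sum>k<n. to_ac (v k i) * (\<omega> ^ i * b k))" by (rule sum.swap)
    also have "\<dots> = (\<Sum>ij\<in>I. to_ac (case ij of (i, k) \<Rightarrow> v k i) * B ij)"
      by (simp add: I_def B_def sum.cartesian_product case_prod_unfold)
    finally show "x \<in> K_span I B" by (simp only: K_spanI)
  qed
  have B_L: "B ij \<in> L" if "ij \<in> I" for ij
    using that \<omega>F L(2) b(2) by (auto simp: I_def B_def intro!: subring_mult[OF RL] subring_power[OF RL])
  have span_L: "K_span J c \<subseteq> L" if "\<And>j. j \<in> J \<Longrightarrow> c j \<in> L" for c and J :: "nat set"
    using that KL unfolding K_span_def
    by (auto intro!: subring_sum[OF RL] subring_mult[OF RL] simp: image_subset_iff)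
  define mp where "mp x M \<longleftrightarrow> lead_coeff M = 1 \<and> poly (acp M) x = 0 \<and> (\<forall>q. poly (acp q) x = 0 \<longrightarrow> M dvd q)"
    for x and M :: "'k poly"
  have mp_ex: "\<exists>M. mp x M" for x unfolding mp_def by (rule minimal_polynomial_over_K)
  have mp_basis: "K_indep {..<degree M} (\<lambda>i. x ^ i)" "K_adj x = K_span {..<degree M} (\<lambda>i. x ^ i)" if "mp x M" for x M
    using that K_adj_basis[of M x] unfolding mp_def by blast+
  have deg_bound: "degree M \<le> d * n" if "x \<in> L" "mp x M" for x M
  proof -
    have "x ^ i \<in> K_span I B" for i using subring_power[OF RL that(1)] L_span by blast
    then have "card {..<degree M} \<le> card I" by (intro K_dim_bound[OF _ finI mp_basis(1)[OF that(2)]]) auto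
    then show ?thesis by (simp add: cardI)
  qed
  \<comment> \<open>An element of largest degree over K is going to be primitive; the dimension of
    \<open>L\<close> bounds these degrees.\<close>
  define Pd where "Pd k \<longleftrightarrow> (\<exists>x\<in>L. \<exists>M. mp x M \<and> degree M = k)" for k
  have "\<exists>k. Pd k" unfolding Pd_def using mp_ex \<omega>F L(2) by blast
  then obtain k1 where "Pd k1" by blast
  moreover have "\<forall>k. Pd k \<longrightarrow> k \<le> d * n" unfolding Pd_def using deg_bound by blast
  ultimately obtain k0 where k0: "Pd k0" "\<And>k. Pd k \<Longrightarrow> k \<le> k0"
    using Nat.ex_has_greatest_nat[of Pd k1 "d * n"] by blast
  then obtain \<theta> M where \<theta>: "\<theta> \<in> L" "mp \<theta> M" "degree M = k0" unfolding Pd_def by blast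
  \<comment> \<open>If \<open>K(y)\<close> contains \<open>\<theta>\<close>, maximality of the
    degree forces the two fields to coincide.\<close>
  have max: "K_adj y \<subseteq> K_adj \<theta>" if y: "y \<in> L" and th: "\<theta> \<in> K_adj y" for y
  proof -
    obtain M' where M': "mp y M'" using mp_ex by blast
    then have "degree M' \<le> degree M" using k0(2) y \<theta>(3) unfolding Pd_def by blast
    moreover have "\<theta> ^ i \<in> K_span {..<degree M'} (\<lambda>i. y ^ i)" for i
      using subring_power[OF K_adj(1) th] mp_basis(2)[OF M'] by simp
    ultimately show ?thesis
      unfolding mp_basis(2)[OF M'] mp_basis(2)[OF \<theta>(2)]
      by (intro K_dim_eq_span[OF _ _ mp_basis(1)[OF \<theta>(2)]]) auto
  qed
  have acp_over: "acp q \<in> polys_over E" if "range to_ac \<subseteq> E" for E and q :: "'k poly"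
    using that by (auto simp: polys_over_def acp_simps image_subset_iff)
  have sep_f: "rsquarefree (acp f)" using sep by (simp add: separable_poly_def)
  have pick: "\<exists>c. to_ac c \<notin> S" if "finite S" for S :: "'k alg_closure set"
  proof (rule ccontr)
    assume "\<not> ?thesis"
    then have "range to_ac \<subseteq> S" by auto
    then have "finite (range (to_ac :: 'k \<Rightarrow> _))" using that finite_subset by blast
    then show False using inf inj_to_ac finite_imageD by blast
  qed
  \<comment> \<open>As \<open>\<omega>\<close> is separable over K, a suitable multiple of it added
    to \<open>y\<close> generates both \<open>y\<close> and \<open>\<omega>\<close>.\<close>
  have join: "\<exists>c. \<omega> \<in> K_adj (y + to_ac c * \<omega>) \<and> y \<in> K_adj (y + to_ac c * \<omega>)" for y
  proof -
    obtain My where My: "mp y My" using mp_ex by blast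
    then have ny: "poly (acp My) y = 0" "acp My \<noteq> 0" by (auto simp: mp_def acp_eq_0_iff)
    obtain S where S: "finite S" "\<And>c E. c \<notin> S \<Longrightarrow> is_subring E \<Longrightarrow> range to_ac \<subseteq> E \<Longrightarrow> acp f \<in> polys_over E \<Longrightarrow>
        acp My \<in> polys_over E \<Longrightarrow> c \<in> E \<Longrightarrow> y + c * \<omega> \<in> E \<Longrightarrow> \<omega> \<in> E"
      using two_generators[OF root sep_f ny] by blast
    obtain c where c: "to_ac c \<notin> S" using pick[OF S(1)] by blast
    define y' where "y' = y + to_ac c * \<omega>"
    note E = K_adj[of y']
    have cE: "to_ac c \<in> K_adj y'" using E(2) by auto
    have w: "\<omega> \<in> K_adj y'"
      by (rule S(2)[OF c E(1,2) acp_over[OF E(2)] acp_over[OF E(2)] cE]) (use E(3) in \<open>simp add: y'_def\<close>)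
    have "y' - to_ac c * \<omega> \<in> K_adj y'" by (intro subring_diff[OF E(1)] subring_mult[OF E(1)] E(3) cE w)
    then show ?thesis using w unfolding y'_def by (intro exI[of _ c]) simp
  qed
  have \<omega>L: "\<omega> \<in> L" using \<omega>F L(2) by blast
  have in_L: "y + to_ac c * x \<in> L" if "y \<in> L" "x \<in> L" for x y c
    using that KL by (intro subring_add[OF RL] subring_mult[OF RL]) auto
  have L_adj: "L \<subseteq> K_adj \<theta>"
  proof
    fix \<beta> assume \<beta>: "\<beta> \<in> L"
    obtain \<mu> where \<mu>: "minimal_poly_over F \<beta> \<mu>" "rsquarefree \<mu>" using L(4)[OF \<beta>] unfolding separable_over_def by blast
    then have \<mu>r: "poly \<mu> \<beta> = 0" "\<mu> \<in> polys_over F" by (auto simp: minimal_poly_over_def polys_over_def)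
    have nM: "poly (acp M) \<theta> = 0" "acp M \<noteq> 0" using \<theta>(2) by (auto simp: mp_def acp_eq_0_iff)
    obtain S where S: "finite S" "\<And>c E. c \<notin> S \<Longrightarrow> is_subring E \<Longrightarrow> range to_ac \<subseteq> E \<Longrightarrow> \<mu> \<in> polys_over E \<Longrightarrow>
        acp M \<in> polys_over E \<Longrightarrow> c \<in> E \<Longrightarrow> \<theta> + c * \<beta> \<in> E \<Longrightarrow> \<beta> \<in> E"
      using two_generators[OF \<mu>r(1) \<mu>(2) nM] by blast
    obtain c where c: "to_ac c \<notin> S" using pick[OF S(1)] by blast
    \<comment> \<open>\<open>\<mu>\<close> has coefficients in \<open>F\<close>, so
      \<open>\<omega>\<close> has to be available before \<open>\<beta>\<close> can be recovered
      from \<open>\<theta> + c \<beta>\<close>. Hence a multiple of \<open>\<omega>\<close> is added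
      as well.\<close>
    define y where "y = \<theta> + to_ac c * \<beta>"
    obtain c' where c': "\<omega> \<in> K_adj (y + to_ac c' * \<omega>)" "y \<in> K_adj (y + to_ac c' * \<omega>)" using join by blast
    define y' where "y' = y + to_ac c' * \<omega>"
    note E = K_adj[of y']
    have FE: "F \<subseteq> K_adj y'" unfolding F_def using c'(1) by (intro K_adj_subset E) (simp add: y'_def)
    have cE: "to_ac c \<in> K_adj y'" using E(2) by auto
    have "\<mu> \<in> polys_over (K_adj y')" using \<mu>r(2) FE by (auto simp: polys_over_def)
    then have bE: "\<beta> \<in> K_adj y'"
      by (rule S(2)[OF c E(1,2) _ acp_over[OF E(2)] cE]) (use c'(2) in \<open>simp add: y'_def y_def\<close>)
    have "y - to_ac c * \<beta> \<in> K_adj y'"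
      using c'(2) by (intro subring_diff[OF E(1)] subring_mult[OF E(1)] cE bE) (simp add: y'_def)
    then have "\<theta> \<in> K_adj y'" by (simp add: y_def)
    moreover have "y' \<in> L" unfolding y'_def y_def by (intro in_L \<theta>(1) \<beta> \<omega>L)
    ultimately show "\<beta> \<in> K_adj \<theta>" using max bE by blast
  qed
  have M: "lead_coeff M = 1" "poly (acp M) \<theta> = 0" "\<And>q. poly (acp q) \<theta> = 0 \<Longrightarrow> M dvd q"
    using \<theta>(2) by (auto simp: mp_def)
  have degM: "degree M = n * d"
  proof (rule antisym)
    show "degree M \<le> n * d" using deg_bound[OF \<theta>(1,2)] by (simp add: mult.commute)
    have "card I \<le> card {..<degree M}"
      using B_L L_adj by (intro K_dim_bound[OF finI _ B_indep, of _ "\<lambda>i. \<theta> ^ i"]) (auto simp flip: mp_basis(2)[OF \<theta>(2)])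
    then show "n * d \<le> degree M" by (simp add: cardI mult.commute)
  qed
  obtain W where W: "\<omega> = poly (acp W) \<theta>" using L_adj \<omega>L unfolding K_adj_def by blast
  obtain \<mu> where \<mu>: "minimal_poly_over F \<theta> \<mu>" "rsquarefree \<mu>" using L(4)[OF \<theta>(1)] unfolding separable_over_def by blast
  define e where "e = degree \<mu>"
  have \<mu>F: "lead_coeff \<mu> = 1" "\<And>i. poly.coeff \<mu> i \<in> F" "poly \<mu> \<theta> = 0"
    "\<And>q. q \<noteq> 0 \<Longrightarrow> (\<And>i. poly.coeff q i \<in> F) \<Longrightarrow> poly q \<theta> = 0 \<Longrightarrow> e \<le> degree q"
    using \<mu>(1) by (auto simp: minimal_poly_over_def e_def)
  \<comment> \<open>The powers of \<open>\<theta>\<close> below \<open>e\<close> are independent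
    over \<open>F\<close>, so \<open>d * e\<close> independent products fit into dimension
    \<open>d * n\<close>.\<close>
  have e_n: "e \<le> n"
  proof -
    have "K_indep ({..<d} \<times> {..<e}) (\<lambda>(i, j). \<omega> ^ i * \<theta> ^ j)"
    proof (rule K_indep_tower[OF _ \<omega>_indep])
      fix u assume u: "\<And>j. j \<in> {..<e} \<Longrightarrow> u j \<in> F" "(\<Sum>j<e. u j * \<theta> ^ j) = 0"
      define q where "q = (\<Sum>j<e. Polynomial.monom (u j) j)"
      have cq: "poly.coeff q i = (if i < e then u i else 0)" for i by (simp add: q_def coeff_sum)
      have "q = 0"
      proof (rule ccontr)
        assume nz: "q \<noteq> 0"
        have "e \<le> degree q"
          using u subring_zero[OF RF] by (intro \<mu>F(4)[OF nz]) (auto simp: cq, simp add: q_def poly_sum poly_monom)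
        then have "lead_coeff q = 0" by (simp add: cq)
        with nz show False by simp
      qed
      then show "\<forall>j\<in>{..<e}. u j = 0" using cq by (metis coeff_0 lessThan_iff)
    qed (use F_span in auto)
    moreover have "\<omega> ^ i * \<theta> ^ j \<in> K_span I B" for i j
      using L_span \<omega>L \<theta>(1) by (blast intro: subring_mult[OF RL] subring_power[OF RL])
    ultimately have "card ({..<d} \<times> {..<e}) \<le> card I"
      by (intro K_dim_bound[OF _ finI]) auto
    then show ?thesis using d0 by (simp add: cardI)
  qed
  have "\<forall>i. \<exists>q. poly.coeff \<mu> i = poly (acp q) \<omega>" using \<mu>F(2) unfolding F_def K_adj_def by blast
  then obtain C0 where C0: "\<And>i. poly.coeff \<mu> i = poly (acp (C0 i)) \<omega>" by metis
  \<comment> \<open>Coefficients of \<open>\<mu>\<close> as polynomials in \<open>\<omega>\<close>,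
    the leading one literally \<open>1\<close>, so that it survives replacing
    \<open>\<omega>\<close> by any other value.\<close>
  define C where "C i = (if i = e then 1 else C0 i)" for i
  have C: "poly.coeff \<mu> i = poly (acp (C i)) \<omega>" for i using C0[of i] \<mu>F(1) by (auto simp: C_def e_def)
  \<comment> \<open>\<open>\<mu>\<close> with \<open>\<omega>\<close> replaced by \<open>W\<close>:
    a polynomial over K vanishing at \<open>\<theta>\<close>, hence divisible by
    \<open>M\<close>.\<close>
  define Z where "Z = (\<Sum>i\<le>e. pcompose (C i) W * Polynomial.monom 1 i)"
  have Z_eval: "poly (acp Z) x = (\<Sum>i\<le>e. poly (acp (C i)) (poly (acp W) x) * x ^ i)" for x
    by (simp add: Z_def acp_simps poly_sum poly_pcompose poly_monom)
  have "poly (acp Z) \<theta> = poly \<mu> \<theta>"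
    unfolding Z_eval by (simp add: poly_altdef C W e_def)
  then have "M dvd Z" using \<mu>F(3) by (intro M(3)) simp
  then obtain Q where Q: "Z = M * Q" by (elim dvdE)
  have "poly (acp (pcompose f W)) \<theta> = 0" using root by (simp add: acp_simps poly_pcompose W)
  then have "M dvd pcompose f W" by (rule M(3))
  then obtain R where R: "pcompose f W = M * R" by (elim dvdE)
  have Wroot: "poly (acp f) (poly (acp W) x) = 0" if "poly (acp M) x = 0" for x
  proof -
    have "poly (acp (pcompose f W)) x = 0" unfolding R using that by (simp add: acp_simps)
    then show ?thesis by (simp add: acp_simps poly_pcompose)
  qed
  text \<open>Differentiating \<open>Z = M * Q\<close> and \<open>pcompose f W = M * R\<close> at \<open>\<theta>\<close> transfers separability from the
    two steps of the tower to \<open>M\<close>.\<close>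
  have M'\<theta>: "poly (pderiv (acp M)) \<theta> \<noteq> 0"
  proof
    assume M'0: "poly (pderiv (acp M)) \<theta> = 0"
    have "poly (pderiv (acp (pcompose f W))) \<theta> = 0" unfolding R using M'0 M(2) by (simp add: acp_simps pderiv_mult)
    then have "poly (pderiv (acp f)) \<omega> * poly (pderiv (acp W)) \<theta> = 0"
      by (simp add: acp_simps pderiv_pcompose poly_pcompose W)
    moreover have "poly (pderiv (acp f)) \<omega> \<noteq> 0" using sep_f root unfolding rsquarefree_iff_simple_roots by blast
    ultimately have W'0: "poly (pderiv (acp W)) \<theta> = 0" by simp
    have "poly (pderiv (acp Z)) \<theta> = 0" unfolding Q using M'0 M(2) by (simp add: acp_simps pderiv_mult)
    \<comment> \<open>Since the derivative of \<open>W\<close> vanishes at \<open>\<theta>\<close>,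
      the coefficients contribute nothing and the derivative of \<open>\<mu>\<close>
      remains.\<close>
    moreover have "poly (pderiv (acp Z)) \<theta> = (\<Sum>i\<le>e. poly.coeff \<mu> i * (of_nat i * \<theta> ^ (i - 1)))"
      by (simp add: Z_def acp_simps pderiv_sum' pderiv_mult poly_sum pderiv_pcompose poly_pcompose W'0 pderiv_monom poly_monom C W)
    moreover have "poly (pderiv \<mu>) \<theta> = (\<Sum>i\<le>e. poly.coeff \<mu> i * (of_nat i * \<theta> ^ (i - 1)))"
    proof -
      have "\<mu> = (\<Sum>i\<le>e. Polynomial.monom (poly.coeff \<mu> i) i)" unfolding e_def by (rule poly_as_sum_of_monoms[symmetric])
      then have "pderiv \<mu> = (\<Sum>i\<le>e. pderiv (Polynomial.monom (poly.coeff \<mu> i) i))" by (metis pderiv_sum')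
      then show ?thesis by (simp add: poly_sum pderiv_monom poly_monom mult_ac)
    qed
    ultimately have "poly (pderiv \<mu>) \<theta> = 0" by simp
    then show False using \<mu>(2) \<mu>F(3) unfolding rsquarefree_iff_simple_roots by blast
  qed
  have M0: "M \<noteq> 0" using M(1) by auto
  \<comment> \<open>Irreducibility of \<open>M\<close> in terms of roots: if the minimal polynomial
    \<open>H\<close> of \<open>x\<close> did not vanish at \<open>\<theta>\<close>, then
    \<open>M\<close> would divide the cofactor \<open>G\<close> and \<open>H\<close> would be a
    unit.\<close>
  have M_dvd: "M dvd q" if x: "poly (acp M) x = 0" and q: "poly (acp q) x = 0" for x q
  proof -
    obtain H where H: "lead_coeff H = 1" "poly (acp H) x = 0" "\<And>q. poly (acp q) x = 0 \<Longrightarrow> H dvd q"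
      using minimal_polynomial_over_K by blast
    obtain G where G: "M = H * G" using H(3)[OF x] by (elim dvdE)
    have "poly (acp H) \<theta> * poly (acp G) \<theta> = 0" using M(2) by (simp add: G acp_simps)
    moreover have "\<not> M dvd G"
    proof
      assume "M dvd G"
      then obtain k where "G = M * k" by (elim dvdE)
      then have "M * (H * k) = M * 1" using G by (metis mult.left_commute mult.right_neutral)
      then have "H * k = 1" using M0 mult_left_cancel by blast
      then have "poly (acp 1) x = 0" using H(2) by (metis hom_mult[OF acp_hom] mult_zero_left poly_mult)
      then show False by simp
    qed
    ultimately have "poly (acp H) \<theta> = 0" using M(3) by auto
    then have "M dvd H" by (rule M(3))
    then show ?thesis using H(3)[OF q] by (rule dvd_trans)
  qed
  have simple: "poly (pderiv (acp M)) x \<noteq> 0" if x: "poly (acp M) x = 0" for x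
  proof
    assume "poly (pderiv (acp M)) x = 0"
    then have "M dvd pderiv M" by (intro M_dvd[OF x]) (simp add: pderiv_acp)
    then obtain k where "pderiv M = M * k" by (elim dvdE)
    then have "poly (pderiv (acp M)) \<theta> = 0" using M(2) by (simp add: pderiv_acp acp_simps)
    with M'\<theta> show False by simp
  qed
  have fibre: "card {x. poly (acp M) x = 0 \<and> poly (acp W) x = c} \<le> n" for c
  proof -
    define p where "p = (\<Sum>i\<le>e. Polynomial.monom (poly (acp (C i)) c) i)"
    have cp: "poly.coeff p i = (if i \<le> e then poly (acp (C i)) c else 0)" for i by (simp add: p_def coeff_sum)
    have "poly.coeff p e = 1" by (simp add: cp C_def)
    then have p0: "p \<noteq> 0" by auto
    have "degree p \<le> e" by (rule degree_le) (simp add: cp)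
    have "{x. poly (acp M) x = 0 \<and> poly (acp W) x = c} \<subseteq> {x. poly p x = 0}"
    proof
      fix x assume "x \<in> {x. poly (acp M) x = 0 \<and> poly (acp W) x = c}"
      then have x: "poly (acp M) x = 0" "poly (acp W) x = c" by auto
      have "poly (acp Z) x = 0" using x(1) by (simp add: Q acp_simps)
      then show "x \<in> {x. poly p x = 0}" unfolding Z_eval x(2) by (simp add: p_def poly_sum poly_monom)
    qed
    then have "card {x. poly (acp M) x = 0 \<and> poly (acp W) x = c} \<le> card {x. poly p x = 0}"
      by (intro card_mono poly_roots_finite[OF p0])
    also have "\<dots> \<le> degree p" by (rule card_poly_roots_bound[OF p0])
    finally show ?thesis using \<open>degree p \<le> e\<close> e_n by linarith
  qed
  show ?thesis
    by (intro exI[of _ M] exI[of _ W] conjI allI impI)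
      (use M(1) degM simple Wroot fibre M_dvd in \<open>auto simp: d_def\<close>)
qed

subsection \<open>Simultaneous irreducible values\<close>

text \<open>With \<open>M = 1\<close> there are no conditions on roots, so every nonzero polynomial
  over K in one variable is nonzero somewhere on K. Over a finite K the product of all
  \<open>X - c\<close> is not.\<close>

lemma pac_infinite:
  assumes "pac_field TYPE('k::field)"
  shows "infinite (UNIV :: 'k set)"
proof
  assume fin: "finite (UNIV :: 'k set)"
  define P :: "'k alg_closure mpoly" where "P = (\<Prod>c\<in>UNIV. Var 1 - Const (to_ac c))"
  have PK: "P \<in> K_mpolys 1"
    unfolding P_def
    by (intro subring_prod[OF is_subring_K_mpolys] subring_diff[OF is_subring_K_mpolys] Const_to_ac_K_mpolys Var_K_mpolys) simp
  have ne: "Var 1 - Const d \<noteq> (0 :: 'k alg_closure mpoly)" for d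
  proof
    assume "Var 1 - Const d = (0 :: 'k alg_closure mpoly)"
    then have "ev (\<lambda>c. c) (\<lambda>_. d + 1) (Var 1 - Const d) = 0" by (simp add: ev_zero[OF is_hom_id])
    then show False by (simp add: hom_diff[OF is_hom_ev[OF is_hom_id]] ev_Var[OF is_hom_id] ev_Const[OF is_hom_id] del: One_nat_def)
  qed
  have P0: "P \<noteq> 0" unfolding P_def using fin ne by (simp add: prod_zero_iff)
  obtain a where a: "ev (\<lambda>c. c) (\<lambda>i. to_ac (a i)) P \<noteq> 0"
    using pac_simultaneous_solution[OF assms, of 1 0 1 P] PK P0 by auto
  have "ev (\<lambda>c. c) (\<lambda>i. to_ac (a i)) P = (\<Prod>c\<in>UNIV. to_ac (a 1) - to_ac c)"
    unfolding P_def
    by (simp add: hom_prod[OF is_hom_ev[OF is_hom_id]] hom_diff[OF is_hom_ev[OF is_hom_id]] ev_Var[OF is_hom_id] ev_Const[OF is_hom_id] del: One_nat_def)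
  also have "\<dots> = 0" using fin by (intro prod_zero) auto
  finally show False using a by simp
qed

text \<open>A combination of least degree divides both polynomials, and a nonconstant one would give
  them a common root in the closure.\<close>

lemma no_common_root_bezout:
  fixes p q :: "'k::field poly"
  assumes p: "p \<noteq> 0" and no: "\<And>x. poly (acp p) x = 0 \<Longrightarrow> poly (acp q) x \<noteq> 0"
  shows "\<exists>u v. u * p + v * q = 1"
proof -
  define A where "A g \<longleftrightarrow> g \<noteq> 0 \<and> (\<exists>u v. g = u * p + v * q)" for g
  have "A p" unfolding A_def using p by (intro conjI exI[of _ 1] exI[of _ 0]) simp_all
  then obtain g where g: "A g" "\<And>h. A h \<Longrightarrow> degree g \<le> degree h"
    using ex_has_least_nat[of A _ degree] by blast
  obtain u v where uv: "g = u * p + v * q" and g0: "g \<noteq> 0" using g(1) by (auto simp: A_def)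
  define l where "l = inverse (lead_coeff g)"
  have l0: "l \<noteq> 0" using g0 by (simp add: l_def)
  have lg: "lead_coeff (smult l g) = 1" "degree (smult l g) = degree g" using g0 by (simp_all add: l_def)
  have dvd: "g dvd h" if h: "h = u' * p + v' * q" for h u' v'
  proof -
    obtain s r where s: "h = s * smult l g + r" "\<And>i. i \<ge> degree g \<Longrightarrow> poly.coeff r i = 0"
      using monic_division[of UNIV "smult l g" h] lg by (auto simp: polys_over_def is_subring_def)
    have "r = (u' - smult l s * u) * p + (v' - smult l s * v) * q"
      using s(1) unfolding h uv by (simp add: algebra_simps smult_add_right)
    moreover have "\<not> degree g \<le> degree r" if "r \<noteq> 0" using s(2)[of "degree r"] that by auto
    ultimately have "r = 0" using g(2)[of r] unfolding A_def by blast
    then have "h = smult l s * g" using s(1) by simp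
    then show ?thesis by (rule dvdI[OF trans[OF _ mult.commute]])
  qed
  have gp: "g dvd p" by (rule dvd[of _ 1 0]) simp
  have gq: "g dvd q" by (rule dvd[of _ 0 1]) simp
  have "degree g = 0"
  proof (rule ccontr)
    assume "degree g \<noteq> 0"
    then obtain x where x: "poly (acp g) x = 0" using alg_closed_imp_poly_has_root[of "acp g"] by (auto simp: degree_acp)
    obtain s t where "p = g * s" "q = g * t" using gp gq by (elim dvdE)
    then have "poly (acp p) x = 0" "poly (acp q) x = 0" using x by (simp_all add: acp_simps)
    then show False using no by blast
  qed
  then obtain c where c: "g = [:c:]" by (metis degree_eq_zeroE)
  have "smult (inverse c) u * p + smult (inverse c) v * q = smult (inverse c) g"
    unfolding uv by (simp add: smult_add_right)
  also have "\<dots> = 1" using g0 by (simp add: c one_pCons)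
  finally have "smult (inverse c) u * p + smult (inverse c) v * q = 1" .
  then show ?thesis by blast
qed

lemma irreducible_dvd_of_root:
  fixes f :: "'k::field poly"
  assumes f: "Factorial_Ring.irreducible f" "poly (acp f) x = 0" and q: "poly (acp q) x = 0"
  shows "f dvd q"
proof -
  obtain M where M: "poly (acp M) x = 0" "\<And>q. poly (acp q) x = 0 \<Longrightarrow> M dvd q" "degree M = degree f"
    using irreducible_minimal_polynomial[OF f] by blast
  obtain g where g: "f = M * g" using M(2)[OF f(2)] by (elim dvdE)
  have "f \<noteq> 0" using f(1) by auto
  then have "M \<noteq> 0" "g \<noteq> 0" using g by auto
  then have "degree g = 0" using M(3) by (simp add: g degree_mult_eq)
  then have "is_unit g" using \<open>g \<noteq> 0\<close> by (simp add: is_unit_iff_degree)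
  then have "f dvd M" by (simp add: g mult_unit_dvd_iff)
  then show ?thesis using M(2)[OF q] by (rule dvd_trans)
qed

text \<open>At most \<open>d\<close> fibres with at most \<open>n\<close> elements each make up
  \<open>n * d\<close> elements only if each of them is full.\<close>

lemma full_fibres:
  assumes "finite A" "finite R" "g ` A \<subseteq> R" "card A = n * d" "card R \<le> d"
    and le: "\<And>c. card {x \<in> A. g x = c} \<le> n" and c: "c \<in> R" and n: "n > 0"
  shows "card {x \<in> A. g x = c} = n"
proof (rule ccontr)
  assume "\<not> ?thesis"
  then have lt: "card {x \<in> A. g x = c} < n" using le[of c] by simp
  have "card A = (\<Sum>c\<in>R. card {x \<in> A. g x = c})"
  proof -
    have "A = (\<Union>c\<in>R. {x \<in> A. g x = c})" using assms(3) by auto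
    then have "card A = card (\<Union>c\<in>R. {x \<in> A. g x = c})" by simp
    also have "\<dots> = (\<Sum>c\<in>R. card {x \<in> A. g x = c})"
      by (rule card_UN_disjoint) (use assms in auto)
    finally show ?thesis .
  qed
  also have "\<dots> < (\<Sum>c\<in>R. n)" using assms(2) c lt le by (intro sum_strict_mono_ex1) auto
  also have "\<dots> \<le> n * d" using assms(5) by simp
  finally show False using assms(4) by simp
qed

lemma rsquarefree_if_many_roots:
  fixes p :: "'a::field poly"
  assumes p: "p \<noteq> 0" and card: "degree p \<le> card {x. poly p x = 0}"
  shows "rsquarefree p"
  unfolding rsquarefree_iff_simple_roots
proof (intro conjI allI impI p)
  fix x assume x: "poly p x = 0"
  then obtain q where q: "p = [:- x, 1:] * q" by (metis poly_eq_0_iff_dvd dvdE)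
  have q0: "q \<noteq> 0" using p q by auto
  have dp: "degree p = Suc (degree q)" unfolding q using q0 by (subst degree_mult_eq) auto
  show "poly (pderiv p) x \<noteq> 0"
  proof
    assume "poly (pderiv p) x = 0"
    then have "poly q x = 0" unfolding q pderiv_mult by (simp add: pderiv_pCons)
    then have "{x. poly p x = 0} = {x. poly q x = 0}" by (auto simp: q)
    then have "card {x. poly p x = 0} \<le> degree q" using card_poly_roots_bound[OF q0] by simp
    then show False using card dp by simp
  qed
qed

text \<open>Serves to replace a polynomial over the closure by one over K that vanishes at the same
  K-points and is still nonzero.\<close>

lemma K_linear_functional:
  fixes c :: "'k::field alg_closure"
  assumes "c \<noteq> 0"
  shows "\<exists>l :: 'k alg_closure \<Rightarrow> 'k. l c \<noteq> 0 \<and> (\<forall>x y. l (x + y) = l x + l y) \<and> (\<forall>k x. l (to_ac k * x) = k * l x)"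
proof -
  interpret W: vector_space "(*) :: 'k \<Rightarrow> 'k \<Rightarrow> 'k"
    by unfold_locales (auto simp: algebra_simps)
  interpret VP: vector_space_pair "\<lambda>(c::'k) x. to_ac c * (x :: 'k alg_closure)" "(*) :: 'k \<Rightarrow> 'k \<Rightarrow> 'k"
    by unfold_locales
  have "Kvs.independent {c}" using assms by simp
  then obtain l where l: "Vector_Spaces.linear (\<lambda>(c::'k) x. to_ac c * (x :: 'k alg_closure)) (*) l" "\<forall>x\<in>{c}. l x = 1"
    using VP.linear_independent_extend[of "{c}" "\<lambda>_. 1"] by blast
  interpret l: Vector_Spaces.linear "\<lambda>(c::'k) x. to_ac c * (x :: 'k alg_closure)" "(*)" l by (rule l(1))
  show ?thesis using l(2) l.add l.scale by (intro exI[of _ l]) auto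
qed

text \<open>Shifting each new factor by an element of the infinite field K keeps its roots apart
  from the earlier ones. The product is then separable, and the Chinese remainder theorem combines
  the \<open>Ws i\<close>.\<close>

lemma simultaneous_polynomial:
  fixes Ms Ws :: "nat \<Rightarrow> 'k::field poly"
  assumes inf: "infinite (UNIV :: 'k set)"
    and monic: "\<And>i. i \<in> {1..r} \<Longrightarrow> lead_coeff (Ms i) = 1"
    and simple: "\<And>i x. i \<in> {1..r} \<Longrightarrow> poly (acp (Ms i)) x = 0 \<Longrightarrow> poly (pderiv (acp (Ms i))) x \<noteq> 0"
  shows "\<exists>M W s. lead_coeff M = 1 \<and> (\<forall>x. poly (acp M) x = 0 \<longrightarrow> poly (pderiv (acp M)) x \<noteq> 0) \<and>
    (\<forall>x. poly (acp M) x = 0 \<longleftrightarrow> (\<exists>i\<in>{1..r}. poly (acp (Ms i)) (x - to_ac (s i)) = 0)) \<and>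
    (\<forall>i\<in>{1..r}. \<forall>x. poly (acp (Ms i)) (x - to_ac (s i)) = 0 \<longrightarrow> poly (acp W) x = poly (acp (Ws i)) (x - to_ac (s i)))"
  using monic simple
proof (induction r)
  case 0
  show ?case by (intro exI[of _ 1] exI[of _ 0] exI[of _ "\<lambda>_. 0"]) auto
next
  case (Suc r)
  have "\<exists>M W s. lead_coeff M = 1 \<and> (\<forall>x. poly (acp M) x = 0 \<longrightarrow> poly (pderiv (acp M)) x \<noteq> 0) \<and>
    (\<forall>x. poly (acp M) x = 0 \<longleftrightarrow> (\<exists>i\<in>{1..r}. poly (acp (Ms i)) (x - to_ac (s i)) = 0)) \<and>
    (\<forall>i\<in>{1..r}. \<forall>x. poly (acp (Ms i)) (x - to_ac (s i)) = 0 \<longrightarrow> poly (acp W) x = poly (acp (Ws i)) (x - to_ac (s i)))"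
    by (rule Suc.IH) (use Suc.prems in simp_all)
  then obtain M W s where MWs: "lead_coeff M = 1 \<and> (\<forall>x. poly (acp M) x = 0 \<longrightarrow> poly (pderiv (acp M)) x \<noteq> 0) \<and>
    (\<forall>x. poly (acp M) x = 0 \<longleftrightarrow> (\<exists>i\<in>{1..r}. poly (acp (Ms i)) (x - to_ac (s i)) = 0)) \<and>
    (\<forall>i\<in>{1..r}. \<forall>x. poly (acp (Ms i)) (x - to_ac (s i)) = 0 \<longrightarrow> poly (acp W) x = poly (acp (Ws i)) (x - to_ac (s i)))"
    by (elim exE)
  have M: "lead_coeff M = 1" "\<And>x. poly (acp M) x = 0 \<Longrightarrow> poly (pderiv (acp M)) x \<noteq> 0"
    "\<And>x. poly (acp M) x = 0 \<longleftrightarrow> (\<exists>i\<in>{1..r}. poly (acp (Ms i)) (x - to_ac (s i)) = 0)"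
    and W: "\<And>i x. i \<in> {1..r} \<Longrightarrow> poly (acp (Ms i)) (x - to_ac (s i)) = 0 \<Longrightarrow> poly (acp W) x = poly (acp (Ws i)) (x - to_ac (s i))"
    using MWs by blast+
  let ?L = "Ms (Suc r)"
  have L: "lead_coeff ?L = 1" "\<And>x. poly (acp ?L) x = 0 \<Longrightarrow> poly (pderiv (acp ?L)) x \<noteq> 0"
    using Suc.prems(1)[of "Suc r"] Suc.prems(2)[of "Suc r"] by auto
  have M0: "M \<noteq> 0" and L0: "?L \<noteq> 0" using M(1) L(1) by auto
  \<comment> \<open>The forbidden shifts, namely those that would move a root of the new factor onto
    a root of \<open>M\<close>.\<close>
  define S where "S = (\<lambda>(x, y). x - y) ` ({x. poly (acp M) x = 0} \<times> {y. poly (acp ?L) y = 0})"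
  have "finite S" unfolding S_def by (intro finite_imageI finite_cartesian_product poly_roots_finite) (simp_all add: acp_eq_0_iff M0 L0)
  have "\<exists>c. to_ac c \<notin> S"
  proof (rule ccontr)
    assume "\<not> ?thesis"
    then have "range (to_ac :: 'k \<Rightarrow> _) \<subseteq> S" by auto
    then have "finite (range (to_ac :: 'k \<Rightarrow> _))" using \<open>finite S\<close> finite_subset by blast
    then show False using inf inj_to_ac finite_imageD by blast
  qed
  then obtain c where c: "to_ac c \<notin> S" by blast
  define L' where "L' = pcompose ?L [:- c, 1:]"
  have aL': "acp L' = pcompose (acp ?L) [:- to_ac c, 1:]" by (simp add: L'_def acp_simps)
  have L'_eval: "poly (acp L') x = poly (acp ?L) (x - to_ac c)" for x
    by (simp add: aL' poly_pcompose)
  have L'_deriv: "poly (pderiv (acp L')) x = poly (pderiv (acp ?L)) (x - to_ac c)" for x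
    by (simp add: aL' pderiv_pcompose poly_pcompose pderiv_pCons)
  have lead_L': "lead_coeff L' = 1"
    unfolding L'_def using L(1) by (subst lead_coeff_comp) auto
  have disj: "poly (acp L') x \<noteq> 0" if "poly (acp M) x = 0" for x
  proof
    assume "poly (acp L') x = 0"
    then have "to_ac c \<in> S" unfolding S_def using that by (intro image_eqI[of _ _ "(x, x - to_ac c)"]) (auto simp: L'_eval)
    then show False using c by simp
  qed
  obtain u v where uv: "u * M + v * L' = 1" using no_common_root_bezout[OF M0, of L'] disj by blast
  define s' where "s' = s(Suc r := c)"
  \<comment> \<open>\<open>v * L'\<close> is \<open>1\<close> at the roots of \<open>M\<close> and
    \<open>0\<close> at those of \<open>L'\<close>, and \<open>u * M\<close> the other way
    round.\<close>
  define W' where "W' = W * (v * L') + pcompose (Ws (Suc r)) [:- c, 1:] * (u * M)"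
  have uv': "poly (acp u) x * poly (acp M) x + poly (acp v) x * poly (acp L') x = 1" for x
    using arg_cong[OF uv, of "\<lambda>p. poly (acp p) x"] by (simp add: acp_simps)
  have W'_eval: "poly (acp W') x = poly (acp W) x * (poly (acp v) x * poly (acp L') x)
      + poly (acp (Ws (Suc r))) (x - to_ac c) * (poly (acp u) x * poly (acp M) x)" for x
    by (simp add: W'_def acp_simps poly_pcompose)
  have split: "i \<in> {1..Suc r} \<longleftrightarrow> i \<in> {1..r} \<or> i = Suc r" for i by auto
  show ?case
  proof (rule exI[of _ "M * L'"], rule exI[of _ W'], rule exI[of _ s'], intro conjI allI ballI impI)
    show "lead_coeff (M * L') = 1" using M(1) lead_L' by (simp add: lead_coeff_mult)
    fix x
    show "poly (pderiv (acp (M * L'))) x \<noteq> 0" if "poly (acp (M * L')) x = 0"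
    proof (cases "poly (acp M) x = 0")
      case True
      then show ?thesis using M(2)[OF True] disj[OF True] by (simp add: acp_simps pderiv_mult)
    next
      case False
      then have z: "poly (acp L') x = 0" using that by (simp add: acp_simps)
      then have "poly (pderiv (acp L')) x \<noteq> 0" using L(2) by (simp add: L'_eval L'_deriv)
      then show ?thesis using False z by (simp add: acp_simps pderiv_mult)
    qed
    show "poly (acp (M * L')) x = 0 \<longleftrightarrow> (\<exists>i\<in>{1..Suc r}. poly (acp (Ms i)) (x - to_ac (s' i)) = 0)"
    proof -
      have "(\<exists>i\<in>{1..Suc r}. poly (acp (Ms i)) (x - to_ac (s' i)) = 0) \<longleftrightarrow>
          (\<exists>i\<in>{1..r}. poly (acp (Ms i)) (x - to_ac (s' i)) = 0) \<or> poly (acp L') x = 0"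
        unfolding split Bex_def by (auto simp: s'_def L'_eval)
      also have "(\<exists>i\<in>{1..r}. poly (acp (Ms i)) (x - to_ac (s' i)) = 0) \<longleftrightarrow> poly (acp M) x = 0"
        unfolding M(3) by (intro bex_cong refl) (auto simp: s'_def)
      finally show ?thesis by (simp add: acp_simps)
    qed
    fix i assume i: "i \<in> {1..Suc r}" and x: "poly (acp (Ms i)) (x - to_ac (s' i)) = 0"
    show "poly (acp W') x = poly (acp (Ws i)) (x - to_ac (s' i))"
    proof (cases "i = Suc r")
      case True
      then have "poly (acp L') x = 0" using x by (simp add: L'_eval s'_def)
      then show ?thesis using uv'[of x] True by (simp add: W'_eval s'_def)
    next
      case False
      then have i': "i \<in> {1..r}" "poly (acp (Ms i)) (x - to_ac (s i)) = 0" using i x by (auto simp: s'_def)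
      then have "poly (acp M) x = 0" using M(3) by blast
      then show ?thesis using uv'[of x] W[OF i'] False by (simp add: W'_eval s'_def)
    qed
  qed
qed

theorem theorem1p2:
  fixes f :: "nat \<Rightarrow> 'k::field poly"
    and \<omega> :: "nat \<Rightarrow> 'k alg_closure"
    and r n :: nat
  assumes "pac_field TYPE('k)"
    and "\<forall>i\<in>{1..r}. Factorial_Ring.irreducible (f i)"
    and "\<forall>i\<in>{1..r}. separable_poly (f i)"
    and "\<forall>i\<in>{1..r}. \<forall>j\<in>{1..r}. i \<noteq> j \<longrightarrow> \<not> (f i dvd f j \<and> f j dvd f i)"
    and "\<forall>i\<in>{1..r}. poly (map_poly to_ac (f i)) (\<omega> i) = 0"
    and "n > 0"
    and "CHAR('k) = 2 \<longrightarrow> odd n"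
    and "\<forall>i\<in>{1..r}. has_separable_extension_of_degree (K_adjoin (\<omega> i)) n"
  shows "\<exists>A :: (nat \<Rightarrow> 'k) set. A \<subseteq> affine_space n \<and> zariski_dense n A \<and>
    (\<forall>a\<in>A. \<forall>i\<in>{1..r}.
       separable_poly (pcompose (f i) (generic_monic n a)) \<and>
       Factorial_Ring.irreducible (pcompose (f i) (generic_monic n a)))"
proof -
  have inf: "infinite (UNIV :: 'k set)" by (rule pac_infinite[OF assms(1)])
  have "\<forall>i\<in>{1..r}. \<exists>MW. case MW of (M, W) \<Rightarrow> lead_coeff M = 1 \<and> degree M = n * degree (f i) \<and>
    (\<forall>x. poly (acp M) x = 0 \<longrightarrow> poly (pderiv (acp M)) x \<noteq> 0) \<and>
    (\<forall>x. poly (acp M) x = 0 \<longrightarrow> poly (acp (f i)) (poly (acp W) x) = 0) \<and>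
    (\<forall>c. card {x. poly (acp M) x = 0 \<and> poly (acp W) x = c} \<le> n) \<and>
    (\<forall>x q. poly (acp M) x = 0 \<longrightarrow> poly (acp q) x = 0 \<longrightarrow> M dvd q)"
    unfolding split_paired_Ex prod.case
    using assms(2,3,5,6,8) by (intro ballI separable_extension_polynomial[OF inf]) auto
  from bchoice[OF this] obtain MW where MW: "\<forall>i\<in>{1..r}. case MW i of (M, W) \<Rightarrow> lead_coeff M = 1 \<and> degree M = n * degree (f i) \<and>
    (\<forall>x. poly (acp M) x = 0 \<longrightarrow> poly (pderiv (acp M)) x \<noteq> 0) \<and>
    (\<forall>x. poly (acp M) x = 0 \<longrightarrow> poly (acp (f i)) (poly (acp W) x) = 0) \<and>
    (\<forall>c. card {x. poly (acp M) x = 0 \<and> poly (acp W) x = c} \<le> n) \<and>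
    (\<forall>x q. poly (acp M) x = 0 \<longrightarrow> poly (acp q) x = 0 \<longrightarrow> M dvd q)" by blast
  define Ms Ws where "Ms i = fst (MW i)" and "Ws i = snd (MW i)" for i
  have MW: "lead_coeff (Ms i) = 1" "degree (Ms i) = n * degree (f i)"
    "\<And>x. poly (acp (Ms i)) x = 0 \<Longrightarrow> poly (pderiv (acp (Ms i))) x \<noteq> 0"
    "\<And>x. poly (acp (Ms i)) x = 0 \<Longrightarrow> poly (acp (f i)) (poly (acp (Ws i)) x) = 0"
    "\<And>c. card {x. poly (acp (Ms i)) x = 0 \<and> poly (acp (Ws i)) x = c} \<le> n"
    "\<And>x q. poly (acp (Ms i)) x = 0 \<Longrightarrow> poly (acp q) x = 0 \<Longrightarrow> Ms i dvd q" if "i \<in> {1..r}" for i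
    using bspec[OF MW that] unfolding Ms_def Ws_def case_prod_unfold by blast+
  have "\<exists>M W s. lead_coeff M = 1 \<and> (\<forall>x. poly (acp M) x = 0 \<longrightarrow> poly (pderiv (acp M)) x \<noteq> 0) \<and>
    (\<forall>x. poly (acp M) x = 0 \<longleftrightarrow> (\<exists>i\<in>{1..r}. poly (acp (Ms i)) (x - to_ac (s i)) = 0)) \<and>
    (\<forall>i\<in>{1..r}. \<forall>x. poly (acp (Ms i)) (x - to_ac (s i)) = 0 \<longrightarrow> poly (acp W) x = poly (acp (Ws i)) (x - to_ac (s i)))"
    by (rule simultaneous_polynomial[OF inf MW(1) MW(3)])
  then obtain M W s where MWs: "lead_coeff M = 1 \<and> (\<forall>x. poly (acp M) x = 0 \<longrightarrow> poly (pderiv (acp M)) x \<noteq> 0) \<and>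
    (\<forall>x. poly (acp M) x = 0 \<longleftrightarrow> (\<exists>i\<in>{1..r}. poly (acp (Ms i)) (x - to_ac (s i)) = 0)) \<and>
    (\<forall>i\<in>{1..r}. \<forall>x. poly (acp (Ms i)) (x - to_ac (s i)) = 0 \<longrightarrow> poly (acp W) x = poly (acp (Ws i)) (x - to_ac (s i)))"
    by (elim exE)
  have M: "lead_coeff M = 1" "\<And>x. poly (acp M) x = 0 \<Longrightarrow> poly (pderiv (acp M)) x \<noteq> 0"
    "\<And>x. poly (acp M) x = 0 \<longleftrightarrow> (\<exists>i\<in>{1..r}. poly (acp (Ms i)) (x - to_ac (s i)) = 0)"
    and W: "\<And>i x. i \<in> {1..r} \<Longrightarrow> poly (acp (Ms i)) (x - to_ac (s i)) = 0 \<Longrightarrow> poly (acp W) x = poly (acp (Ws i)) (x - to_ac (s i))"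
    using MWs by blast+
  have f0: "f i \<noteq> 0" if "i \<in> {1..r}" for i using bspec[OF assms(2) that] by (auto simp: Factorial_Ring.irreducible_def)
  have Ms0: "acp (Ms i) \<noteq> 0" if "i \<in> {1..r}" for i using MW(1)[OF that] by (auto simp: acp_eq_0_iff)
  have card_Ms: "card {x. poly (acp (Ms i)) x = 0} = n * degree (f i)" if i: "i \<in> {1..r}" for i
    using card_roots_separable[OF Ms0[OF i] MW(3)[OF i]] MW(2)[OF i] by (simp add: degree_acp)
  \<comment> \<open>At most \<open>degree (f i)\<close> values, at most \<open>n\<close> roots above
    each, and \<open>n * degree (f i)\<close> roots in all.\<close>
  have fib: "card {x. poly (acp (Ms i)) x = 0 \<and> poly (acp (Ws i)) x = c} = n"
    if i: "i \<in> {1..r}" and c: "poly (acp (f i)) c = 0" for i c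
  proof -
    have "card {x \<in> {x. poly (acp (Ms i)) x = 0}. poly (acp (Ws i)) x = c} = n"
    proof (rule full_fibres[where R = "{c. poly (acp (f i)) c = 0}" and d = "degree (f i)"])
      show "card {c. poly (acp (f i)) c = 0} \<le> degree (f i)"
        using card_poly_roots_bound[of "acp (f i)"] f0[OF i] by (simp add: acp_eq_0_iff degree_acp)
      show "finite {c. poly (acp (f i)) c = 0}" using f0[OF i] by (intro poly_roots_finite) (simp add: acp_eq_0_iff)
      show "finite {x. poly (acp (Ms i)) x = 0}" by (rule poly_roots_finite[OF Ms0[OF i]])
    qed (use card_Ms[OF i] MW(4)[OF i] MW(5)[OF i] c assms(6) in auto)
    then show ?thesis by simp
  qed
  have fibM: "card {\<eta>. poly (acp M) \<eta> = 0 \<and> poly (acp W) \<eta> = poly (acp W) \<theta>} = n" if \<theta>: "poly (acp M) \<theta> = 0" for \<theta>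
  proof -
    obtain i where i: "i \<in> {1..r}" "poly (acp (Ms i)) (\<theta> - to_ac (s i)) = 0" using M(3) \<theta> by blast
    define c where "c = poly (acp W) \<theta>"
    have c: "poly (acp (f i)) c = 0" unfolding c_def W[OF i] by (rule MW(4)[OF i])
    have "{\<eta>. poly (acp M) \<eta> = 0 \<and> poly (acp W) \<eta> = c} = (\<lambda>x. x + to_ac (s i)) ` {x. poly (acp (Ms i)) x = 0 \<and> poly (acp (Ws i)) x = c}"
    proof (intro equalityI subsetI)
      fix \<eta> assume "\<eta> \<in> {\<eta>. poly (acp M) \<eta> = 0 \<and> poly (acp W) \<eta> = c}"
      then have \<eta>: "poly (acp M) \<eta> = 0" "poly (acp W) \<eta> = c" by auto
      obtain j where j: "j \<in> {1..r}" "poly (acp (Ms j)) (\<eta> - to_ac (s j)) = 0" using M(3) \<eta>(1) by blast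
      have "poly (acp (f j)) c = 0" using MW(4)[OF j] W[OF j] \<eta>(2) by simp
      \<comment> \<open>Irreducible polynomials with a common root are associate, so a fibre never
        mixes roots belonging to different indices.\<close>
      then have "f i dvd f j" "f j dvd f i" using irreducible_dvd_of_root c assms(2) i(1) j(1) by blast+
      then have "j = i" using assms(4) i(1) j(1) by blast
      then show "\<eta> \<in> (\<lambda>x. x + to_ac (s i)) ` {x. poly (acp (Ms i)) x = 0 \<and> poly (acp (Ws i)) x = c}"
        using j W[OF j] \<eta>(2) by (intro image_eqI[of _ _ "\<eta> - to_ac (s i)"]) auto
    next
      fix \<eta> assume "\<eta> \<in> (\<lambda>x. x + to_ac (s i)) ` {x. poly (acp (Ms i)) x = 0 \<and> poly (acp (Ws i)) x = c}"
      then obtain x where x: "\<eta> = x + to_ac (s i)" "poly (acp (Ms i)) x = 0" "poly (acp (Ws i)) x = c" by blast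
      then have \<eta>: "poly (acp (Ms i)) (\<eta> - to_ac (s i)) = 0" by simp
      then have "poly (acp M) \<eta> = 0" unfolding M(3) using i(1) by blast
      then show "\<eta> \<in> {\<eta>. poly (acp M) \<eta> = 0 \<and> poly (acp W) \<eta> = c}"
        using W[OF i(1) \<eta>] x by simp
    qed
    then show ?thesis using fib[OF i(1) c] by (simp add: card_image c_def)
  qed
  have M0: "acp M \<noteq> 0" using M(1) by (auto simp: acp_eq_0_iff)
  have cardM: "card {\<theta>. poly (acp M) \<theta> = 0} = degree M"
    using card_roots_separable[OF M0 M(2)] by (simp add: degree_acp)
  define good where "good a \<longleftrightarrow> (\<forall>i\<in>{1..r}. separable_poly (pcompose (f i) (generic_monic n a)) \<and>
       Factorial_Ring.irreducible (pcompose (f i) (generic_monic n a)))" for a :: "nat \<Rightarrow> 'k"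
  define A where "A = {a \<in> affine_space n. good a}"
  have key: "\<exists>a\<in>A. ev (\<lambda>c. c) (\<lambda>i. to_ac (a i)) P \<noteq> 0" if P: "P \<in> K_mpolys n" "P \<noteq> 0" for P :: "'k alg_closure mpoly"
  proof -
    obtain a0 Q where a0: "ev (\<lambda>c. c) (\<lambda>i. to_ac (a0 i)) P \<noteq> 0"
      and g: "\<And>\<theta>. poly (acp M) \<theta> = 0 \<Longrightarrow> poly (gmon n (\<lambda>i. to_ac (a0 i))) (poly (acp Q) \<theta>) = poly (acp W) \<theta>"
      and inj: "inj_on (poly (acp Q)) {\<theta>. poly (acp M) \<theta> = 0}"
      using pac_simultaneous_solution[OF assms(1) M(1) cardM fibM assms(6,7) P] by blast
    \<comment> \<open>Only the first \<open>n\<close> entries enter \<open>g\<close> and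
      \<open>P\<close>; the others are cleared to normalise the point.\<close>
    define a where "a i = (if i \<in> {1..n} then a0 i else 0)" for i
    have aff: "a \<in> affine_space n" by (auto simp: a_def affine_space_def)
    have "P \<in> mpolys n" using P(1) by (simp add: K_mpolys_eq)
    then have aP: "ev (\<lambda>c. c) (\<lambda>i. to_ac (a i)) P \<noteq> 0"
      using a0 by (subst ev_cong[of _ n _ "\<lambda>i. to_ac (a0 i)"]) (auto simp: a_def)
    define G where "G = generic_monic n a"
    have G: "G = gmon n a" by (simp add: G_def generic_monic_eq_gmon)
    have aG: "acp G = gmon n (\<lambda>i. to_ac (a0 i))"
      unfolding G map_poly_gmon[OF is_hom_to_ac] by (intro gmon_cong) (auto simp: a_def)
    have "separable_poly (pcompose (f i) G) \<and> Factorial_Ring.irreducible (pcompose (f i) G)" if i: "i \<in> {1..r}" for i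
    proof -
      define h where "h = pcompose (f i) G"
      define R where "R = {x. poly (acp (Ms i)) x = 0}"
      define \<tau> where "\<tau> x = poly (acp Q) (x + to_ac (s i))" for x
      define k where "k = n * degree (f i)"
      have dh: "degree h = k" by (simp add: h_def degree_pcompose G gmon_degree k_def mult.commute)
      have "\<not> is_unit (f i)" using bspec[OF assms(2) i] by (auto simp: Factorial_Ring.irreducible_def)
      then have df: "degree (f i) > 0" using f0[OF i] by (simp add: is_unit_iff_degree)
      then have k0: "k > 0" using assms(6) by (simp add: k_def)
      have h0: "h \<noteq> 0" using dh k0 by auto
      have finR: "finite R" unfolding R_def by (rule poly_roots_finite[OF Ms0[OF i]])
      have cardR: "card R = k" unfolding R_def k_def by (rule card_Ms[OF i])
      have Mx: "poly (acp M) (x + to_ac (s i)) = 0" if "x \<in> R" for x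
        unfolding M(3) using that by (intro bexI[OF _ i]) (simp add: R_def)
      have inj\<tau>: "inj_on \<tau> R"
      proof (rule inj_onI)
        fix x y assume xy: "x \<in> R" "y \<in> R" "\<tau> x = \<tau> y"
        then have "x + to_ac (s i) = y + to_ac (s i)"
          using inj_onD[OF inj, of "x + to_ac (s i)" "y + to_ac (s i)"] Mx by (simp add: \<tau>_def)
        then show "x = y" by simp
      qed
      have card\<tau>: "card (\<tau> ` R) = k" using cardR by (simp add: card_image[OF inj\<tau>])
      have h_root: "poly (acp h) (\<tau> x) = 0" if x: "x \<in> R" for x
      proof -
        have "poly (acp G) (\<tau> x) = poly (acp (Ws i)) x"
          using g[OF Mx[OF x]] W[OF i, of "x + to_ac (s i)"] x by (simp add: aG \<tau>_def R_def)
        then show ?thesis using MW(4)[OF i] x by (simp add: h_def acp_simps poly_pcompose R_def)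
      qed
      have many: "k \<le> degree p" if p: "p \<noteq> 0" "\<And>x. x \<in> R \<Longrightarrow> poly (acp p) (\<tau> x) = 0" for p
      proof -
        have ap: "acp p \<noteq> 0" using p(1) by (simp add: acp_eq_0_iff)
        have "k \<le> card {y. poly (acp p) y = 0}"
          unfolding card\<tau>[symmetric] using p(2) by (intro card_mono poly_roots_finite[OF ap]) auto
        also have "\<dots> \<le> degree p" using card_poly_roots_bound[OF ap] by (simp add: degree_acp)
        finally show ?thesis .
      qed
      have ah0: "acp h \<noteq> 0" using h0 by (simp add: acp_eq_0_iff)
      have "degree (acp h) \<le> card {y. poly (acp h) y = 0}"
        unfolding degree_acp dh card\<tau>[symmetric] using h_root by (intro card_mono poly_roots_finite[OF ah0]) auto
      then have "separable_poly h" unfolding separable_poly_def by (intro rsquarefree_if_many_roots ah0)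
      moreover have "Factorial_Ring.irreducible h"
      proof (rule Factorial_Ring.irreducibleI[OF h0])
        show "\<not> is_unit h" using h0 dh k0 by (simp add: is_unit_iff_degree)
        fix u v assume huv: "h = u * v"
        have u0: "u \<noteq> 0" and v0: "v \<noteq> 0" using h0 huv by auto
        have deg: "degree u + degree v = k" using dh u0 v0 by (simp add: huv degree_mult_eq)
        have "R \<noteq> {}" using cardR k0 by auto
        then obtain x0 where x0: "x0 \<in> R" by blast
        \<comment> \<open>\<open>Ms i\<close> divides every polynomial over K that vanishes at one
          of its roots. So a factor of \<open>h\<close> with one root \<open>\<tau> x0\<close> has
          all \<open>k\<close> of them, and the other factor is constant.\<close>
        have all: "k \<le> degree p" if p: "p \<noteq> 0" "poly (acp p) (\<tau> x0) = 0" for p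
        proof (rule many[OF p(1)])
          define q where "q = pcompose p (pcompose Q [:s i, 1:])"
          have q: "poly (acp q) x = poly (acp p) (\<tau> x)" for x
            by (simp add: q_def acp_simps poly_pcompose \<tau>_def add.commute)
          have "Ms i dvd q" using MW(6)[OF i, of x0 q] x0 p(2) q by (simp add: R_def)
          then obtain l where "q = Ms i * l" by (elim dvdE)
          then have "poly (acp q) x = 0" if "x \<in> R" for x using that by (simp add: acp_simps R_def)
          then show "poly (acp p) (\<tau> x) = 0" if "x \<in> R" for x using q that by simp
        qed
        have "poly (acp u) (\<tau> x0) = 0 \<or> poly (acp v) (\<tau> x0) = 0"
          using h_root[OF x0] by (simp add: huv acp_simps)
        then have "k \<le> degree u \<or> k \<le> degree v" using all u0 v0 by blast
        then have "degree v = 0 \<or> degree u = 0" using deg by auto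
        then show "is_unit u \<or> is_unit v" using u0 v0 by (auto simp: is_unit_iff_degree)
      qed
      ultimately show ?thesis by (simp add: h_def)
    qed
    then have "good a" by (simp add: good_def G_def)
    then show ?thesis using aff aP by (intro bexI[of _ a]) (auto simp: A_def)
  qed
  have "zariski_dense n A"
    unfolding zariski_dense_def
  proof (intro allI impI, elim conjE)
    fix V :: "(nat \<Rightarrow> 'k alg_closure) set" assume cl: "zariski_closed n V" and AV: "(\<lambda>a. to_ac \<circ> a) ` A \<subseteq> V"
    obtain S where S: "S \<subseteq> mpolys n" "V = {x \<in> affine_space n. \<forall>p\<in>S. ev (\<lambda>c. c) x p = 0}"
      using cl unfolding zariski_closed_def mpoly_eval_ev by blast
    show "V = affine_space n"
    proof (rule ccontr)
      assume "V \<noteq> affine_space n"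
      then obtain y p where p: "p \<in> S" "ev (\<lambda>c. c) y p \<noteq> 0" using S(2) by blast
      then have "p \<noteq> 0" by (auto simp: ev_zero[OF is_hom_id])
      then obtain m0 where m0: "Poly_Mapping.lookup p m0 \<noteq> 0" by (metis lookup_zero poly_mapping_eqI)
      \<comment> \<open>\<open>p\<close> has coefficients in the closure, while \<open>key\<close>
        concerns polynomials over K. Monomials take values in K at K-points, so the polynomial whose
        coefficients are the images under \<open>l\<close> takes there the image under
        \<open>l\<close> of the value of \<open>p\<close>.\<close>
      obtain l :: "'k alg_closure \<Rightarrow> 'k" where l: "l (Poly_Mapping.lookup p m0) \<noteq> 0"
        "\<And>x y. l (x + y) = l x + l y" "\<And>k x. l (to_ac k * x) = k * l x"
        using K_linear_functional[OF m0] by blast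
      have l_zero: "l 0 = 0" using l(3)[of 0 0] by simp
      have l_right: "l (x * to_ac k) = l x * k" for x k using l(3)[of k x] by (simp only: mult.commute)
      have l_sum: "l (sum g B) = (\<Sum>b\<in>B. l (g b))" for g :: "(nat \<Rightarrow>\<^sub>0 nat) \<Rightarrow> _" and B
        by (induction B rule: infinite_finite_induct) (auto simp: l_zero l(2))
      define P where "P = (\<Sum>m\<in>Poly_Mapping.keys p. Poly_Mapping.single m (to_ac (l (Poly_Mapping.lookup p m))))"
      have lookup_P: "Poly_Mapping.lookup P m = to_ac (l (Poly_Mapping.lookup p m))" for m
        by (auto simp: P_def lookup_sum lookup_single when_def in_keys_iff l_zero)
      have "P \<noteq> 0" using lookup_P[of m0] l(1) by auto
      moreover have "P \<in> K_mpolys n"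
      proof -
        have "Poly_Mapping.keys P \<subseteq> Poly_Mapping.keys p" by (auto simp: in_keys_iff lookup_P l_zero)
        then have "P \<in> mpolys n" using S(1) p(1) unfolding mpolys_def by blast
        then show ?thesis by (auto simp: K_mpolys_def lookup_P)
      qed
      ultimately obtain a where a: "a \<in> A" "ev (\<lambda>c. c) (\<lambda>i. to_ac (a i)) P \<noteq> 0" using key by blast
      define x where "x = (\<lambda>i. to_ac (a i))"
      have mono: "mono_eval x m = to_ac (mono_eval a m)" for m
        by (simp add: mono_eval_def x_def to_ac_prod)
      have "ev (\<lambda>c. c) x P = (\<Sum>m\<in>Poly_Mapping.keys p. to_ac (l (Poly_Mapping.lookup p m)) * mono_eval x m)"
        unfolding P_def by (simp add: ev_sum[OF is_hom_id] ev_single[OF is_hom_id])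
      also have "\<dots> = to_ac (\<Sum>m\<in>Poly_Mapping.keys p. l (Poly_Mapping.lookup p m * mono_eval x m))"
        unfolding to_ac_sum mono by (intro sum.cong refl) (simp add: l_right)
      also have "\<dots> = to_ac (l (ev (\<lambda>c. c) x p))" by (simp add: ev_def l_sum)
      also have "ev (\<lambda>c. c) x p = 0"
      proof -
        have "to_ac \<circ> a \<in> V" using AV a(1) by blast
        then show ?thesis using S(2) p(1) by (auto simp: x_def o_def)
      qed
      finally show False using a(2) by (simp add: x_def l_zero)
    qed
  qed
  then show ?thesis unfolding good_def[symmetric] by (intro exI[of _ A]) (auto simp: A_def)
qed

end
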